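(* Let $d=d(n)$ with $d(n)\to\infty$ as $n\to\infty$, and for each $n$ let $W_1,\ldots,W_{d}\in M_n(\mathbb{C})$ be Hermitian random matrices with $\mathbb{E}(W_i)=0$, which are normalized, i.e. $\mathbb{E}\,\tau^{(n)}(W_i)=0$ and $\mathbb{E}\,\tau^{(n)}(W_i^2)=1$, and which satisfy Assumptions (A.1), (A.2) (for every fixed number of the matrices), (A.3) and (A.4). Set \[\Delta:=\frac{1}{\sqrt d}\sum_{i\in[d]}\Big(W_i\otimes\overline{W}_i-\mathbb{E}\big(W_i\otimes\overline{W}_i\big)\Big)\in M_{n^2}(\mathbb{C}).\] Then $\Delta$ converges weakly in probability and in expectation to the semicircular distribution $\mu_{sc}$ with density $f_{sc}(x)=\frac{1}{2\pi}\sqrt{4-x^2}\,\mathbf 1_{|x|\le2}$; equivalently, for every $p\ge1$, $\tau^{(n^2)}(\Delta^p)\to|NC_2(p)|$ in probability and $\mathbb{E}\,\tau^{(n^2)}(\Delta^p)\to|NC_2(p)|$.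
   Context: Notation: $[d]=\{1,\ldots,d\}$; $\overline{W}$ is the entrywise complex conjugate; $\tau^{(N)}(M)=\frac1N\operatorname{tr}(M)$ for $M\in M_N(\mathbb{C})$; $NC_2(p)$ is the set of noncrossing pair partitions of $[p]$ (all blocks of size 2, and no two blocks $\{i,j\},\{k,l\}$ with $i<k<j<l$). A sequence of random Hermitian matrices $M_N\in M_N(\mathbb{C})$ with $\operatorname{tr}(M_N^p)$ integrable for all $p$ converges weakly in probability (resp. in expectation) to a probability measure $\mu$ with all moments finite if for every $p\ge1$, $\tau^{(N)}(M_N^p)\to\int x^p\,d\mu$ in probability (resp. $\mathbb{E}\,\tau^{(N)}(M_N^p)\to\int x^p d\mu$). Hermitian random matrices $M_1,\ldots,M_k\in M_n(\mathbb{C})$ are asymptotically free in probability if for all $m\ge1$, $i_1\ne i_2\ne\cdots\ne i_m\in[k]$ and $p_1,\ldots,p_m\ge1$, $\tau^{(n)}\big((M_{i_1}^{p_1}-\tau^{(n)}(M_{i_1}^{p_1}))\cdots(M_{i_m}^{p_m}-\tau^{(n)}(M_{i_m}^{p_m}))\big)\to0$ in probability; asymptotically free in expectation if the same holds with $\tau^{(n)}$ replaced by $\mathbb{E}\,\tau^{(n)}$ everywhere. Assumptions: (A.1) for each $i$, $W_i$ converges weakly in probability and in expectation to a probability measure $\mu_i$ on $\mathbb R$; (A.2) for each fixed $k$, the family $(W_i)_{i\in[k]}$ is asymptotically free in probability and in expectation; (A.3) for each $i$, $\tau^{(n^2)}\big((\mathbb{E}(W_i\otimes\overline W_i))^p\big)\to0$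 for all $p\ge1$; (A.4) the matrices $(W_i)_{i\in[d]}$ are independent and identically distributed. *)

theory Defs
  imports "HOL-Probability.Probability" "HOL-Library.Disjoint_Sets"
begin

text \<open>Square matrices of size N are represented as functions nat => nat => complex;
  only the entries with indices < N are relevant.\<close>

type_synonym cmat = "nat \<Rightarrow> nat \<Rightarrow> complex"

definition mmult :: "nat \<Rightarrow> cmat \<Rightarrow> cmat \<Rightarrow> cmat" where
  "mmult N A B = (\<lambda>i j. \<Sum>k<N. A i k * B k j)"

definition mone :: cmat where
  "mone = (\<lambda>i j. if i = j then 1 else 0)"

fun mpow :: "nat \<Rightarrow> cmat \<Rightarrow> nat \<Rightarrow> cmat" where
  "mpow N A 0 = mone"
| "mpow N A (Suc p) = mmult N A (mpow N A p)"

definition mlist_prod :: "nat \<Rightarrow> cmat list \<Rightarrow> cmat" where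
  "mlist_prod N As = foldr (mmult N) As mone"

definition mtrace :: "nat \<Rightarrow> cmat \<Rightarrow> complex" where
  "mtrace N A = (\<Sum>i<N. A i i)"

definition tau :: "nat \<Rightarrow> cmat \<Rightarrow> complex" where
  "tau N A = mtrace N A / of_nat N"

definition mconj :: "cmat \<Rightarrow> cmat" where
  "mconj A = (\<lambda>i j. cnj (A i j))"

definition hermitian_mat :: "nat \<Rightarrow> cmat \<Rightarrow> bool" where
  "hermitian_mat N A \<longleftrightarrow> (\<forall>i<N. \<forall>j<N. A j i = cnj (A i j))"

text \<open>Kronecker product of two n x n matrices, an n^2 x n^2 matrix; the index
  r of M_{n^2} corresponds to the pair (r div n, r mod n).\<close>
definition kron :: "nat \<Rightarrow> cmat \<Rightarrow> cmat \<Rightarrow> cmat" where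
  "kron n A B = (\<lambda>r c. A (r div n) (c div n) * B (r mod n) (c mod n))"

definition mexp :: "'a measure \<Rightarrow> nat \<Rightarrow> ('a \<Rightarrow> cmat) \<Rightarrow> cmat" where
  "mexp M N A = (\<lambda>r c. if r < N \<and> c < N then integral\<^sup>L M (\<lambda>\<omega>. A \<omega> r c) else 0)"

text \<open>A random N x N matrix as a random variable with values in the product space
  of its N^2 entries.\<close>
definition mat_rv :: "nat \<Rightarrow> cmat \<Rightarrow> (nat \<times> nat \<Rightarrow> complex)" where
  "mat_rv N A = (\<lambda>rc \<in> {..<N} \<times> {..<N}. A (fst rc) (snd rc))"

definition mat_space :: "nat \<Rightarrow> (nat \<times> nat \<Rightarrow> complex) measure" where
  "mat_space N = PiM ({..<N} \<times> {..<N}) (\<lambda>_. borel)"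

definition conv_in_prob :: "(nat \<Rightarrow> 'a measure) \<Rightarrow> (nat \<Rightarrow> 'a \<Rightarrow> complex) \<Rightarrow> complex \<Rightarrow> bool" where
  "conv_in_prob M X c \<longleftrightarrow>
     (\<forall>\<epsilon>>0. (\<lambda>n. measure (M n) {\<omega> \<in> space (M n). \<epsilon> < norm (X n \<omega> - c)}) \<longlonglongrightarrow> 0)"

definition moment_measure :: "real measure \<Rightarrow> bool" where
  "moment_measure \<mu> \<longleftrightarrow> prob_space \<mu> \<and> sets \<mu> = sets borel \<and>
     (\<forall>p::nat. integrable \<mu> (\<lambda>x. x ^ p))"

definition moment :: "real measure \<Rightarrow> nat \<Rightarrow> real" where
  "moment \<mu> p = integral\<^sup>L \<mu> (\<lambda>x. x ^ p)"

definition weak_conv_in_prob ::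
  "(nat \<Rightarrow> 'a measure) \<Rightarrow> (nat \<Rightarrow> nat) \<Rightarrow> (nat \<Rightarrow> 'a \<Rightarrow> cmat) \<Rightarrow> real measure \<Rightarrow> bool" where
  "weak_conv_in_prob M N A \<mu> \<longleftrightarrow>
     (\<forall>p\<ge>1. conv_in_prob M (\<lambda>n \<omega>. tau (N n) (mpow (N n) (A n \<omega>) p)) (complex_of_real (moment \<mu> p)))"

definition weak_conv_in_exp ::
  "(nat \<Rightarrow> 'a measure) \<Rightarrow> (nat \<Rightarrow> nat) \<Rightarrow> (nat \<Rightarrow> 'a \<Rightarrow> cmat) \<Rightarrow> real measure \<Rightarrow> bool" where
  "weak_conv_in_exp M N A \<mu> \<longleftrightarrow>
     (\<forall>p\<ge>1. (\<lambda>n. integral\<^sup>L (M n) (\<lambda>\<omega>. tau (N n) (mpow (N n) (A n \<omega>) p)))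
               \<longlonglongrightarrow> complex_of_real (moment \<mu> p))"

definition centered_prob :: "nat \<Rightarrow> cmat \<Rightarrow> nat \<Rightarrow> cmat" where
  "centered_prob N A p =
     (\<lambda>r c. mpow N A p r c - tau N (mpow N A p) * mone r c)"

definition centered_exp :: "'a measure \<Rightarrow> nat \<Rightarrow> ('a \<Rightarrow> cmat) \<Rightarrow> nat \<Rightarrow> 'a \<Rightarrow> cmat" where
  "centered_exp M N A p \<omega> =
     (\<lambda>r c. mpow N (A \<omega>) p r c
            - integral\<^sup>L M (\<lambda>\<omega>'. tau N (mpow N (A \<omega>') p)) * mone r c)"

definition admissible_word :: "nat \<Rightarrow> nat list \<Rightarrow> nat list \<Rightarrow> bool" where
  "admissible_word k is ps \<longleftrightarrow> is \<noteq> [] \<and> length ps = length is \<and> set is \<subseteq> {..<k} \<and>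
     (\<forall>j. Suc j < length is \<longrightarrow> is ! j \<noteq> is ! Suc j) \<and> (\<forall>p\<in>set ps. 1 \<le> p)"

definition asym_free_in_prob ::
  "(nat \<Rightarrow> 'a measure) \<Rightarrow> (nat \<Rightarrow> nat) \<Rightarrow> (nat \<Rightarrow> nat \<Rightarrow> 'a \<Rightarrow> cmat) \<Rightarrow> nat \<Rightarrow> bool" where
  "asym_free_in_prob M N X k \<longleftrightarrow>
     (\<forall>is ps. admissible_word k is ps \<longrightarrow>
        conv_in_prob M
          (\<lambda>n \<omega>. tau (N n) (mlist_prod (N n)
               (map (\<lambda>(i, p). centered_prob (N n) (X n i \<omega>) p) (zip is ps)))) 0)"

definition asym_free_in_exp ::
  "(nat \<Rightarrow> 'a measure) \<Rightarrow> (nat \<Rightarrow> nat) \<Rightarrow> (nat \<Rightarrow> nat \<Rightarrow> 'a \<Rightarrow> cmat) \<Rightarrow> nat \<Rightarrow> bool" where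
  "asym_free_in_exp M N X k \<longleftrightarrow>
     (\<forall>is ps. admissible_word k is ps \<longrightarrow>
        (\<lambda>n. integral\<^sup>L (M n) (\<lambda>\<omega>. tau (N n) (mlist_prod (N n)
               (map (\<lambda>(i, p). centered_exp (M n) (N n) (X n i) p \<omega>) (zip is ps))))) \<longlonglongrightarrow> 0)"

definition NC2 :: "nat \<Rightarrow> nat set set set" where
  "NC2 p = {P. partition_on {1..p} P \<and> (\<forall>B\<in>P. card B = 2) \<and>
     (\<forall>B1\<in>P. \<forall>B2\<in>P. \<not> (\<exists>i j k l. B1 = {i, j} \<and> B2 = {k, l} \<and> i < k \<and> k < j \<and> j < l))}"

definition f_sc :: "real \<Rightarrow> real" where
  "f_sc x = (if \<bar>x\<bar> \<le> 2 then sqrt (4 - x\<^sup>2) / (2 * pi) else 0)"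

definition mu_sc :: "real measure" where
  "mu_sc = density lborel (\<lambda>x. ennreal (f_sc x))"

definition Delta :: "'a measure \<Rightarrow> nat \<Rightarrow> nat \<Rightarrow> (nat \<Rightarrow> 'a \<Rightarrow> cmat) \<Rightarrow> 'a \<Rightarrow> cmat" where
  "Delta M n d W \<omega> = (\<lambda>r c. complex_of_real (1 / sqrt (real d)) *
     (\<Sum>i<d. kron n (W i \<omega>) (mconj (W i \<omega>)) r c
            - mexp M (n\<^sup>2) (\<lambda>\<omega>'. kron n (W i \<omega>') (mconj (W i \<omega>'))) r c))"

end

theory Submission
  imports Defs
begin

text \<open>
  Expanding \<open>\<tau>(\<Delta>\<^sup>p) \<tau>(\<Delta>\<^sup>q)\<close> gives a sum over words \<open>w\<close>, \<open>v\<close> of mixed moments of traces of the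
  centred tensors \<open>X\<^sub>i = W\<^sub>i \<otimes> conj W\<^sub>i - T\<close>. By independence and identical distribution, the moment of \<open>w @ v\<close>
  depends only on which positions carry equal letters, and it vanishes if some letter occurs exactly once; so
  after division by \<open>d\<close> to the power \<open>(p + q) / 2\<close> only words in which each letter occurs exactly twice survive.
  For these, a chessboard (iterated Cauchy-Schwarz) estimate removes \<open>T\<close>, since its normalised trace moments
  vanish, and leaves \<open>|\<tau>(W\<^sub>w)|\<^sup>2 |\<tau>(W\<^sub>v)|\<^sup>2\<close>. Freeness gives \<open>\<tau>(W\<^sub>w) \<rightarrow> 1\<close> or \<open>0\<close> according to
  whether \<open>w\<close> is a noncrossing pairing: a neighbouring pair \<open>W\<^sub>i W\<^sub>i\<close> is the centred square plus a scalar that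
  tends to \<open>1\<close>. The number of noncrossing pairings compatible with a word sums to exactly \<open>|NC\<^sub>2(p)|\<close> times \<open>d\<close>
  to the power \<open>p / 2\<close>, which identifies the limit. Taking \<open>q = 0\<close> and \<open>q = p\<close> yields the first and second moments of
  \<open>\<tau>(\<Delta>\<^sup>p)\<close>, hence both modes of convergence.
\<close>

section \<open>Words and matrix traces\<close>

text \<open>Only normalised traces are controlled, never operator norms: \<open>T\<close> may have a
  few large eigenvalues, so it cannot be discarded as small. Traces of words are instead bounded
  sample by sample through even trace moments of single letters; since those of \<open>T\<close>
  tend to zero, \<open>T\<close> may be multiplied by any fixed constant, which shows that each word
  containing it is negligible.

  Freeness is used in probability, while the expansion needs expectations of products of traces.
  Convergence of the expected moments bounds, by Cauchy-Schwarz, every absolute moment of the trace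
  of a word, so that limits can be taken in all \<open>L^q\<close> at once. This mode of convergence
  respects products and conjugates, hence squared moduli.

  When each letter of \<open>w @ v\<close> occurs twice, a letter shared by \<open>w\<close> and
  \<open>v\<close> is single in both, so both traces tend to zero and the limit factorises without a
  separate argument. The number of compatible pairings is defined for all words, not only for
  pairings; subtracting it from every mixed moment leaves an exact main term for each positive
  \<open>d\<close> and an error governed by a number of patterns that does not depend on
  \<open>d\<close>.\<close>

definition words :: "'b set \<Rightarrow> nat \<Rightarrow> 'b list set" where
  "words A n = {xs. set xs \<subseteq> A \<and> length xs = n}"

lemma finite_words [simp]: "finite A \<Longrightarrow> finite (words A n)"
  unfolding words_def by (rule finite_lists_length_eq)

lemma words_0 [simp]: "words A 0 = {[]}"
  by (auto simp: words_def)

lemma sum_words_Suc: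
  fixes f :: "'b list \<Rightarrow> 'c::comm_monoid_add"
  shows "(\<Sum>w\<in>words A (Suc n). f w) = (\<Sum>a\<in>A. \<Sum>w\<in>words A n. f (a # w))"
proof -
  have "(\<Sum>w\<in>words A (Suc n). f w) = (\<Sum>(a, w)\<in>A \<times> words A n. f (a # w))"
    by (rule sum.reindex_bij_witness[of _ "\<lambda>(a, w). a # w" "\<lambda>w. (hd w, tl w)"])
       (auto simp: words_def length_Suc_conv)
  then show ?thesis by (simp add: sum.cartesian_product)
qed

lemma sum_words_append:
  fixes f :: "'b list \<Rightarrow> 'b list \<Rightarrow> 'c::comm_monoid_add"
  shows "(\<Sum>l\<in>words A (p + q). f (take p l) (drop p l)) = (\<Sum>w\<in>words A p. \<Sum>v\<in>words A q. f w v)"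
proof -
  have "(\<Sum>l\<in>words A (p + q). f (take p l) (drop p l)) = (\<Sum>(w, v)\<in>words A p \<times> words A q. f w v)"
    by (rule sum.reindex_bij_witness[of _ "\<lambda>(w, v). w @ v" "\<lambda>l. (take p l, drop p l)"])
       (auto simp: words_def dest: in_set_takeD in_set_dropD)
  then show ?thesis by (simp add: sum.cartesian_product)
qed

section \<open>Products of words and cyclicity of the trace\<close>

lemma mlist_prod_Nil [simp]: "mlist_prod N [] = mone"
  and mlist_prod_Cons [simp]: "mlist_prod N (A # As) = mmult N A (mlist_prod N As)"
  by (simp_all add: mlist_prod_def)

lemma mpow_eq_mlist_prod: "mpow N A p = mlist_prod N (replicate p A)"
  by (induction p) auto

lemma mmult_assoc: "mmult N (mmult N A B) C = mmult N A (mmult N B C)"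
proof (intro ext)
  fix i j
  have "mmult N (mmult N A B) C i j = (\<Sum>k<N. \<Sum>l<N. A i l * B l k * C k j)"
    by (simp add: mmult_def sum_distrib_right)
  also have "\<dots> = (\<Sum>l<N. \<Sum>k<N. A i l * B l k * C k j)" by (rule sum.swap)
  also have "\<dots> = mmult N A (mmult N B C) i j"
    by (simp add: mmult_def sum_distrib_left mult.assoc)
  finally show "mmult N (mmult N A B) C i j = mmult N A (mmult N B C) i j" .
qed

text \<open>\<open>mone\<close> is the unit matrix on all of \<open>nat\<close>, whereas
  \<open>mmult\<close> sums only below \<open>N\<close>; the unit law therefore holds only at row
  indices below \<open>N\<close>, and this bound propagates to the lemmas that concatenate
  products.\<close>

lemma mmult_mone_left: "r < N \<Longrightarrow> mmult N mone A r c = A r c"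
  by (simp add: mmult_def mone_def if_distrib[of "\<lambda>x. x * _"] cong: if_cong)

lemma mmult_cong:
  assumes "\<And>k. k < N \<Longrightarrow> A r k = A' r k" "\<And>k. k < N \<Longrightarrow> B k c = B' k c"
  shows "mmult N A B r c = mmult N A' B' r c"
  unfolding mmult_def using assms by (intro sum.cong) auto

lemma mlist_prod_append:
  "r < N \<Longrightarrow> mlist_prod N (As @ Bs) r c = mmult N (mlist_prod N As) (mlist_prod N Bs) r c"
proof (induction As arbitrary: r)
  case Nil
  then show ?case by (simp add: mmult_mone_left)
next
  case (Cons A As)
  then show ?case by (auto simp: mmult_assoc intro!: mmult_cong)
qed

lemma tau_cong: "(\<And>r. r < N \<Longrightarrow> A r r = B r r) \<Longrightarrow> tau N A = tau N B"
  unfolding tau_def mtrace_def by (auto intro!: sum.cong arg_cong[where f="\<lambda>x. x / _"])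

abbreviation ttr :: "nat \<Rightarrow> cmat list \<Rightarrow> complex" where
  "ttr N As \<equiv> tau N (mlist_prod N As)"

text \<open>Equality of matrices as functions would be too strong: entries with an index at least
  \<open>N\<close> carry no meaning, and traces of words do not see them.\<close>

definition entries_eq :: "nat \<Rightarrow> cmat \<Rightarrow> cmat \<Rightarrow> bool" where
  "entries_eq N A B \<longleftrightarrow> (\<forall>r<N. \<forall>c<N. A r c = B r c)"

lemma mlist_prod_cong:
  assumes "list_all2 (entries_eq N) As Bs" "r < N"
  shows "mlist_prod N As r c = mlist_prod N Bs r c"
  using assms
proof (induction arbitrary: r rule: list_all2_induct)
  case (Cons A As B Bs)
  then show ?case by (auto intro!: mmult_cong simp: entries_eq_def)
qed simp

lemma ttr_cong: "list_all2 (entries_eq N) As Bs \<Longrightarrow> ttr N As = ttr N Bs"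
  by (intro tau_cong mlist_prod_cong)

lemma ttr_map_cong:
  "(\<And>x. x \<in> set xs \<Longrightarrow> entries_eq N (f x) (g x)) \<Longrightarrow> ttr N (map f xs) = ttr N (map g xs)"
  by (rule ttr_cong) (simp add: list_all2_conv_all_nth)

lemma ttr_append: "ttr N (As @ Bs) = (\<Sum>i<N. \<Sum>k<N. mlist_prod N As i k * mlist_prod N Bs k i) / of_nat N"
  unfolding tau_def mtrace_def
  by (intro arg_cong[where f="\<lambda>x. x / _"] sum.cong) (simp_all add: mlist_prod_append mmult_def)

lemma ttr_append_commute: "ttr N (As @ Bs) = ttr N (Bs @ As)"
  unfolding ttr_append
  by (subst (2) sum.swap) (simp add: mult.commute)

lemma ttr_Cons: "ttr N (A # Bs) = (\<Sum>i<N. \<Sum>k<N. A i k * mlist_prod N Bs k i) / of_nat N"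
  by (simp add: tau_def mtrace_def mmult_def)

lemma ttr_mid: "ttr N (u @ A # v) = ttr N (A # v @ u)"
  using ttr_append_commute[of N u "A # v"] by simp

text \<open>Cyclicity moves the distinguished factor to the front, where the trace is visibly linear
  in the entries of that factor.\<close>

lemma ttr_lin:
  assumes "\<And>r c. r < N \<Longrightarrow> c < N \<Longrightarrow> A r c = B r c + s * C r c"
  shows "ttr N (u @ A # v) = ttr N (u @ B # v) + s * ttr N (u @ C # v)"
proof -
  have "(\<Sum>i<N. \<Sum>k<N. A i k * mlist_prod N (v @ u) k i)
      = (\<Sum>i<N. \<Sum>k<N. B i k * mlist_prod N (v @ u) k i)
       + s * (\<Sum>i<N. \<Sum>k<N. C i k * mlist_prod N (v @ u) k i)"
    by (simp add: assms sum_distrib_left sum.distrib[symmetric] algebra_simps)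
  then show ?thesis
    unfolding ttr_mid ttr_Cons by (simp add: add_divide_distrib)
qed

lemma ttr_mone: "ttr N (u @ mone # v) = ttr N (u @ v)"
proof -
  have "ttr N (u @ mone # v) = ttr N (v @ u)"
    unfolding ttr_mid by (intro tau_cong) (simp add: mmult_mone_left)
  then show ?thesis by (simp add: ttr_append_commute)
qed

lemma ttr_mmult: "ttr N (u @ mmult N A B # v) = ttr N (u @ A # B # v)"
  using ttr_mid[of N u "mmult N A B" v] ttr_mid[of N u A "B # v"] by (simp add: mmult_assoc)

text \<open>The adjoint of a product is the product of the adjoints in reverse order, so for
  hermitian factors reversing the list takes the place of the adjoint.\<close>

lemma mlist_prod_rev_hermitian:
  assumes "\<And>A. A \<in> set As \<Longrightarrow> hermitian_mat N A" "r < N" "c < N"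
  shows "mlist_prod N (rev As) r c = cnj (mlist_prod N As c r)"
  using assms
proof (induction As arbitrary: r c)
  case Nil
  then show ?case by (simp add: mone_def)
next
  case (Cons A As)
  have 1: "mlist_prod N [A] k c = A k c" if "k < N" for k
    using that \<open>c < N\<close> by (simp add: mmult_def mone_def if_distrib cong: if_cong)
  have "mlist_prod N (rev (A # As)) r c = (\<Sum>k<N. mlist_prod N (rev As) r k * mlist_prod N [A] k c)"
    using Cons.prems mlist_prod_append[of r N "rev As" "[A]" c] by (simp add: mmult_def)
  also have "\<dots> = (\<Sum>k<N. cnj (mlist_prod N As k r) * A k c)"
    using Cons 1 by (intro sum.cong) auto
  also have "\<dots> = (\<Sum>k<N. cnj (mlist_prod N As k r) * cnj (A c k))"
    using Cons.prems by (intro sum.cong) (auto simp: hermitian_mat_def)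
  also have "\<dots> = cnj (mlist_prod N (A # As) c r)"
    by (simp add: mmult_def mult.commute)
  finally show ?case .
qed

section \<open>Normalised Hilbert-Schmidt norms, Cauchy-Schwarz and the chessboard estimate\<close>

definition frobenius :: "nat \<Rightarrow> cmat list \<Rightarrow> real" where
  "frobenius N As = (\<Sum>i<N. \<Sum>k<N. (cmod (mlist_prod N As i k))\<^sup>2) / real N"

lemma frobenius_nonneg [simp]: "0 \<le> frobenius N As"
  unfolding frobenius_def by (intro divide_nonneg_nonneg sum_nonneg) auto

text \<open>Reversal gives the adjoint, so the left side is the trace of a product times its
  adjoint: \<open>frobenius\<close> is the normalised squared Hilbert-Schmidt norm.\<close>

lemma ttr_append_rev:
  assumes "\<And>A. A \<in> set As \<Longrightarrow> hermitian_mat N A"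
  shows "ttr N (As @ rev As) = complex_of_real (frobenius N As)"
proof -
  have "ttr N (As @ rev As) = (\<Sum>i<N. \<Sum>k<N. complex_of_real ((cmod (mlist_prod N As i k))\<^sup>2)) / of_nat N"
    unfolding ttr_append
    by (intro arg_cong[where f="\<lambda>x. x / _"] sum.cong refl)
       (simp add: mlist_prod_rev_hermitian assms flip: complex_norm_square)
  then show ?thesis by (simp add: frobenius_def)
qed

lemma frobenius_rev:
  assumes "\<And>A. A \<in> set As \<Longrightarrow> hermitian_mat N A"
  shows "frobenius N (rev As) = frobenius N As"
proof -
  have "(\<Sum>i<N. \<Sum>k<N. (cmod (mlist_prod N (rev As) i k))\<^sup>2) = (\<Sum>i<N. \<Sum>k<N. (cmod (mlist_prod N As k i))\<^sup>2)"
    by (intro sum.cong refl) (simp add: mlist_prod_rev_hermitian assms)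
  also have "\<dots> = (\<Sum>k<N. \<Sum>i<N. (cmod (mlist_prod N As k i))\<^sup>2)" by (rule sum.swap)
  finally show ?thesis by (simp add: frobenius_def)
qed

text \<open>Cauchy-Schwarz for the Hilbert-Schmidt inner product, applied to the product of
  \<open>As\<close> and the adjoint of the product of \<open>Bs\<close>. Both sides carry two
  factors \<open>1 / N\<close>.\<close>

lemma ttr_cauchy_schwarz:
  assumes "\<And>A. A \<in> set Bs \<Longrightarrow> hermitian_mat N A"
  shows "(cmod (ttr N (As @ Bs)))\<^sup>2 \<le> frobenius N As * frobenius N Bs"
proof -
  let ?S = "{..<N} \<times> {..<N}"
  let ?a = "\<lambda>(i, k). cmod (mlist_prod N As i k)" and ?b = "\<lambda>(i, k). cmod (mlist_prod N (rev Bs) i k)"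
  have "cmod (\<Sum>i<N. \<Sum>k<N. mlist_prod N As i k * mlist_prod N Bs k i) \<le> (\<Sum>x\<in>?S. ?a x * ?b x)"
  proof -
    have "(\<Sum>i<N. \<Sum>k<N. mlist_prod N As i k * mlist_prod N Bs k i)
        = (\<Sum>(i, k)\<in>?S. mlist_prod N As i k * mlist_prod N Bs k i)"
      by (simp add: sum.cartesian_product)
    also have "cmod \<dots> \<le> (\<Sum>(i, k)\<in>?S. cmod (mlist_prod N As i k * mlist_prod N Bs k i))"
      by (rule order_trans[OF norm_sum]) (simp add: case_prod_beta)
    also have "\<dots> = (\<Sum>x\<in>?S. ?a x * ?b x)"
      by (intro sum.cong) (auto simp: norm_mult mlist_prod_rev_hermitian assms)
    finally show ?thesis .
  qed
  then have "(cmod (\<Sum>i<N. \<Sum>k<N. mlist_prod N As i k * mlist_prod N Bs k i))\<^sup>2 \<le> (\<Sum>x\<in>?S. ?a x * ?b x)\<^sup>2"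
    by (intro power_mono) auto
  also have "\<dots> \<le> (\<Sum>x\<in>?S. (?a x)\<^sup>2) * (\<Sum>x\<in>?S. (?b x)\<^sup>2)"
    by (rule Cauchy_Schwarz_ineq_sum)
  also have "\<dots> = (frobenius N As * real N) * (frobenius N (rev Bs) * real N)"
    by (cases "N = 0") (simp_all add: frobenius_def sum.cartesian_product case_prod_beta)
  finally have "(cmod (\<Sum>i<N. \<Sum>k<N. mlist_prod N As i k * mlist_prod N Bs k i))\<^sup>2
      \<le> (frobenius N As * frobenius N Bs) * (real N)\<^sup>2"
    by (simp add: frobenius_rev assms power2_eq_square mult_ac)
  then show ?thesis
    by (cases "N = 0") (simp_all add: ttr_append norm_divide power_divide divide_le_eq)
qed

text \<open>Equality for positive \<open>N\<close>; the inequality absorbs \<open>N = 0\<close>,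
  where division by zero makes the left side vanish.\<close>

lemma frobenius_Nil_le: "frobenius N [] \<le> 1"
proof (cases "N = 0")
  case False
  have "(cmod (mone i k))\<^sup>2 = (if i = k then 1 else 0)" for i k
    by (simp add: mone_def)
  then have "(\<Sum>i<N. \<Sum>k<N. (cmod (mone i k))\<^sup>2) = real N"
    by simp
  with False show ?thesis by (simp add: frobenius_def)
qed (simp add: frobenius_def)

lemma ttr_sq_le_frobenius: "(cmod (ttr N As))\<^sup>2 \<le> frobenius N As"
  using ttr_cauchy_schwarz[of "[]" N As] mult_left_mono[OF frobenius_Nil_le[of N] frobenius_nonneg[of N As]] by simp

lemma frobenius_le_norm:
  assumes "\<And>A. A \<in> set As \<Longrightarrow> hermitian_mat N A"
  shows "frobenius N As = cmod (ttr N (As @ rev As))"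
  using ttr_append_rev[OF assms] by simp

text \<open>Among all words of length \<open>2 m\<close> in \<open>S\<close> take one with the largest absolute trace. By
  Cauchy-Schwarz its reflected half \<open>B B\<^sup>*\<close> is again maximal, and up to a cyclic shift this doubles
  the initial run of equal letters, until only one letter is left.\<close>

lemma chessboard_even:
  assumes fin: "finite S" and herm: "\<And>A. A \<in> S \<Longrightarrow> hermitian_mat N A" and m: "1 \<le> m"
    and w: "w \<in> words S (2 * m)"
  shows "cmod (ttr N w) \<le> (\<Sum>A\<in>S. frobenius N (replicate m A))"
proof -
  define K where "K = Max ((\<lambda>w. cmod (ttr N w)) ` words S (2 * m))"
  have le_K: "cmod (ttr N v) \<le> K" if "v \<in> words S (2 * m)" for v
    unfolding K_def using that fin by (intro Max_ge) auto
  have "K \<in> (\<lambda>w. cmod (ttr N w)) ` words S (2 * m)"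
    unfolding K_def using w fin by (intro Max_in) auto
  then obtain w0 where w0: "w0 \<in> words S (2 * m)" "cmod (ttr N w0) = K" by auto
  from w0 m obtain a x0 where ax: "w0 = a # x0"
    by (cases w0) (auto simp: words_def)
  have aS: "a \<in> S" using w0 ax by (auto simp: words_def)
  have sum_ge: "frobenius N (replicate m a) \<le> (\<Sum>A\<in>S. frobenius N (replicate m A))"
    using aS fin by (intro member_le_sum) auto
  show ?thesis
  proof (cases "K \<le> 0")
    case True
    then have "cmod (ttr N w) \<le> 0" using le_K[OF w] by linarith
    then show ?thesis by (rule order_trans) (simp add: sum_nonneg)
  next
    case False
    \<comment> \<open>Reflecting the other half gives a competitor of the same length, so
      \<open>frobenius N C\<close> is at most \<open>K\<close>; Cauchy-Schwarz then bounds
      \<open>K\<^sup>2\<close> by \<open>frobenius N B * K\<close>, and the positive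
      \<open>K\<close> cancels.\<close>
    have half: "K \<le> frobenius N B" if BC: "B @ C \<in> words S (2 * m)" "cmod (ttr N (B @ C)) = K" "length B = m" for B C
    proof -
      have hB: "hermitian_mat N A" if "A \<in> set B" for A using BC(1) that herm by (auto simp: words_def)
      have hC: "hermitian_mat N A" if "A \<in> set (rev C)" for A using BC(1) that herm by (auto simp: words_def)
      have "rev C @ C \<in> words S (2 * m)" using BC by (auto simp: words_def)
      then have "cmod (ttr N (rev C @ rev (rev C))) \<le> K" using le_K by simp
      then have "frobenius N (rev C) \<le> K" using frobenius_le_norm[of "rev C" N] hC by simp
      then have "frobenius N C \<le> K" using frobenius_rev[of C N] hC by simp
      moreover have "K\<^sup>2 \<le> frobenius N B * frobenius N C"
        using ttr_cauchy_schwarz[of C N B] hC BC by simp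
      ultimately have "K * K \<le> frobenius N B * K"
        using mult_left_mono[of "frobenius N C" K "frobenius N B"] by (simp add: power2_eq_square)
      then show ?thesis using False by simp
    qed
    define P where "P = (\<lambda>r. \<exists>x. replicate r a @ x \<in> words S (2 * m) \<and> cmod (ttr N (replicate r a @ x)) = K)"
    have P1: "P 1" unfolding P_def using w0 ax by (intro exI[of _ x0]) simp
    have dbl: "P (2 * r)" if "P r" "r \<le> m" for r
    proof -
      from that obtain x where x: "replicate r a @ x \<in> words S (2 * m)" "cmod (ttr N (replicate r a @ x)) = K"
        unfolding P_def by auto
      have lx: "length x = 2 * m - r" using x(1) by (auto simp: words_def)
      define y where "y = take (m - r) x"
      define B where "B = replicate r a @ y"
      have lB: "length B = m" using that lx by (simp add: B_def y_def)
      have xy: "replicate r a @ x = B @ drop (m - r) x" by (simp add: B_def y_def)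
      have KB: "K \<le> frobenius N B" using half[of B "drop (m - r) x"] x xy lB by simp
      have BS: "set B \<subseteq> S" using x(1) unfolding xy by (auto simp: words_def)
      have hB: "hermitian_mat N A" if "A \<in> set B" for A using BS that herm by auto
      have eq: "ttr N (B @ rev B) = ttr N (replicate (2 * r) a @ (y @ rev y))"
      proof -
        have "ttr N (B @ rev B) = ttr N ((replicate r a @ y @ rev y) @ replicate r a)"
          by (simp add: B_def)
        also have "\<dots> = ttr N (replicate r a @ replicate r a @ y @ rev y)"
          by (rule ttr_append_commute)
        finally show ?thesis by (simp add: mult_2 replicate_add)
      qed
      have mem: "replicate (2 * r) a @ (y @ rev y) \<in> words S (2 * m)"
        using BS lB aS by (auto simp: words_def B_def)
      have "cmod (ttr N (replicate (2 * r) a @ (y @ rev y))) = K"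
        using KB le_K[OF mem] frobenius_le_norm[of B N] hB eq by simp
      with mem show ?thesis unfolding P_def by blast
    qed
    have mono: "P r'" if "P r" "r' \<le> r" for r r'
    proof -
      have r: "replicate r a = replicate r' a @ replicate (r - r') a"
        using that(2) by (metis le_add_diff_inverse replicate_add)
      show ?thesis using that(1) unfolding P_def r append_assoc by blast
    qed
    \<comment> \<open>Doubling followed by truncation lengthens the run by at least one, so length
      \<open>m\<close> is reached even if \<open>m\<close> is not a power of two.\<close>
    have "j \<le> m \<longrightarrow> P j" if "1 \<le> j" for j
      using that
    proof (induction j rule: dec_induct)
      case (step j)
      show ?case
      proof
        assume "Suc j \<le> m"
        then have "P (2 * j)" using step.IH by (intro dbl) auto
        then show "P (Suc j)" by (rule mono) (use step.hyps in simp)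
      qed
    qed (use P1 in simp)
    from this[OF m] have "P m" by blast
    then have "K \<le> frobenius N (replicate m a)" unfolding P_def using half[of "replicate m a"] by auto
    then show ?thesis using le_K[OF w] sum_ge by linarith
  qed
qed

text \<open>\<open>w @ rev w\<close> has even length whatever the parity of \<open>p\<close>, and
  its trace dominates the square of the trace of \<open>w\<close>. The sum over \<open>S\<close>
  stands in for a maximum, which suffices for bounds on fixed words.\<close>

lemma chessboard:
  assumes "finite S" "\<And>A. A \<in> S \<Longrightarrow> hermitian_mat N A" "w \<in> words S p" "1 \<le> p"
  shows "(cmod (ttr N w))\<^sup>2 \<le> (\<Sum>A\<in>S. cmod (tau N (mpow N A (2 * p))))"
proof -
  have hw: "hermitian_mat N A" if "A \<in> set w" for A using assms that by (auto simp: words_def)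
  have "(cmod (ttr N w))\<^sup>2 \<le> cmod (ttr N (w @ rev w))"
    using ttr_sq_le_frobenius[of N w] frobenius_le_norm[of w N] hw by simp
  also have "\<dots> \<le> (\<Sum>A\<in>S. frobenius N (replicate p A))"
    by (rule chessboard_even) (use assms in \<open>auto simp: words_def\<close>)
  also have "\<dots> = (\<Sum>A\<in>S. cmod (tau N (mpow N A (2 * p))))"
  proof (intro sum.cong refl)
    fix A assume "A \<in> S"
    then show "frobenius N (replicate p A) = cmod (tau N (mpow N A (2 * p)))"
      using frobenius_le_norm[of "replicate p A" N] assms(2)
      by (simp add: mpow_eq_mlist_prod mult_2 replicate_add)
  qed
  finally show ?thesis .
qed

text \<open>Each use of Cauchy-Schwarz doubles the exponent. The gain is that a high power of an
  absolute value is bounded by a single trace moment, which is linear in the trace and so accessible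
  to assumptions on expectations.\<close>

lemma tau_mpow_power_le:
  assumes "hermitian_mat N A" "1 \<le> k"
  shows "(cmod (tau N (mpow N A p))) ^ (2 ^ k) \<le> Re (tau N (mpow N A (p * 2 ^ k)))"
  using assms(2)
proof (induction k rule: dec_induct)
  case base
  have "(cmod (ttr N (replicate p A)))\<^sup>2 \<le> Re (ttr N (replicate p A @ rev (replicate p A)))"
    using ttr_sq_le_frobenius[of N "replicate p A"] ttr_append_rev[of "replicate p A" N] assms by simp
  then show ?case by (simp add: mpow_eq_mlist_prod mult_2_right replicate_add)
next
  case (step k)
  let ?q = "p * 2 ^ k"
  have "(cmod (tau N (mpow N A p))) ^ (2 ^ Suc k) = ((cmod (tau N (mpow N A p))) ^ (2 ^ k))\<^sup>2"
    by (simp only: power_Suc2 power_mult)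
  also have "\<dots> \<le> (cmod (tau N (mpow N A ?q)))\<^sup>2"
    using step complex_Re_le_cmod[of "tau N (mpow N A ?q)"] by (intro power_mono) auto
  also have "\<dots> \<le> Re (ttr N (replicate ?q A @ rev (replicate ?q A)))"
    using ttr_sq_le_frobenius[of N "replicate ?q A"] ttr_append_rev[of "replicate ?q A" N] assms
    by (simp add: mpow_eq_mlist_prod)
  also have "\<dots> = Re (tau N (mpow N A (p * 2 ^ Suc k)))"
    by (simp only: mpow_eq_mlist_prod rev_replicate replicate_add[symmetric] power_Suc mult_2 distrib_left)
  finally show ?case .
qed

section \<open>Kronecker products and the tensor of a matrix with its conjugate\<close>

lemma sum_div_mod:
  fixes f :: "nat \<Rightarrow> nat \<Rightarrow> 'c::comm_monoid_add"
  shows "(\<Sum>k<n\<^sup>2. f (k div n) (k mod n)) = (\<Sum>a<n. \<Sum>b<n. f a b)"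
proof -
  have "(\<Sum>k<n\<^sup>2. f (k div n) (k mod n)) = (\<Sum>(a, b)\<in>{..<n} \<times> {..<n}. f a b)"
  proof (rule sum.reindex_bij_witness[of _ "\<lambda>(a, b). a * n + b" "\<lambda>k. (k div n, k mod n)"])
    fix x assume "x \<in> {..<n} \<times> {..<n}"
    then obtain a b where x: "x = (a, b)" "a < n" "b < n" by auto
    have "a * n + b < Suc a * n" using x by simp
    also have "\<dots> \<le> n * n" using x by (intro mult_le_mono) auto
    finally show "(case x of (a, b) \<Rightarrow> a * n + b) \<in> {..<n\<^sup>2}" using x by (simp add: power2_eq_square)
  next
    fix k assume "k \<in> {..<n\<^sup>2}"
    then show "(k div n, k mod n) \<in> {..<n} \<times> {..<n}"
      by (cases "n = 0") (auto simp: power2_eq_square less_mult_imp_div_less)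
  qed auto
  then show ?thesis by (simp add: sum.cartesian_product)
qed

lemma tau_kron: "tau (n\<^sup>2) (kron n A B) = tau n A * tau n B"
  unfolding tau_def mtrace_def kron_def sum_div_mod[of "\<lambda>a b. A a a * B b b"]
  by (simp add: sum_product power2_eq_square)

lemma mlist_prod_kron:
  "r < n\<^sup>2 \<Longrightarrow> c < n\<^sup>2 \<Longrightarrow>
    mlist_prod (n\<^sup>2) (map (\<lambda>x. kron n (f x) (g x)) xs) r c
      = kron n (mlist_prod n (map f xs)) (mlist_prod n (map g xs)) r c"
proof (induction xs arbitrary: r)
  case Nil
  have "r = c \<longleftrightarrow> r div n = c div n \<and> r mod n = c mod n"
    by (metis div_mult_mod_eq)
  then show ?case by (simp add: kron_def mone_def)
next
  case (Cons x xs)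
  let ?F = "mlist_prod n (map f xs)" and ?G = "mlist_prod n (map g xs)"
  have "mlist_prod (n\<^sup>2) (map (\<lambda>x. kron n (f x) (g x)) (x # xs)) r c
      = (\<Sum>k<n\<^sup>2. kron n (f x) (g x) r k * kron n ?F ?G k c)"
    using Cons by (auto simp: mmult_def intro!: sum.cong)
  also have "\<dots> = (\<Sum>a<n. \<Sum>b<n. (f x (r div n) a * ?F a (c div n)) * (g x (r mod n) b * ?G b (c mod n)))"
    by (subst sum_div_mod[symmetric]) (simp add: kron_def mult_ac)
  also have "\<dots> = kron n (mlist_prod n (map f (x # xs))) (mlist_prod n (map g (x # xs))) r c"
    by (simp add: kron_def mmult_def sum_product)
  finally show ?case .
qed

lemma mlist_prod_mconj: "mlist_prod n (map (\<lambda>x. mconj (f x)) xs) r c = cnj (mlist_prod n (map f xs) r c)"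
  by (induction xs arbitrary: r) (auto simp: mmult_def mconj_def mone_def)

definition kron_conj :: "nat \<Rightarrow> cmat \<Rightarrow> cmat" where
  "kron_conj n A = kron n A (mconj A)"

text \<open>Words multiply in each tensor leg separately, the trace of a tensor product factorises,
  and the conjugate leg contributes the conjugate trace.\<close>

lemma ttr_kron_conj: "ttr (n\<^sup>2) (map (\<lambda>x. kron_conj n (f x)) xs) = complex_of_real ((cmod (ttr n (map f xs)))\<^sup>2)"
proof -
  have "ttr (n\<^sup>2) (map (\<lambda>x. kron_conj n (f x)) xs)
      = tau (n\<^sup>2) (kron n (mlist_prod n (map f xs)) (mlist_prod n (map (\<lambda>x. mconj (f x)) xs)))"
    unfolding kron_conj_def by (intro tau_cong mlist_prod_kron)
  also have "\<dots> = ttr n (map f xs) * cnj (ttr n (map f xs))"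
    unfolding tau_kron by (simp add: mlist_prod_mconj tau_def mtrace_def)
  finally show ?thesis by (simp only: complex_norm_square)
qed

lemma tau_mpow_kron_conj: "tau (n\<^sup>2) (mpow (n\<^sup>2) (kron_conj n A) p) = complex_of_real ((cmod (tau n (mpow n A p)))\<^sup>2)"
  using ttr_kron_conj[of n "\<lambda>_. A" "replicate p ()"] by (simp add: mpow_eq_mlist_prod)

lemma hermitian_kron_conj: "hermitian_mat n A \<Longrightarrow> hermitian_mat (n\<^sup>2) (kron_conj n A)"
proof -
  assume A: "hermitian_mat n A"
  have H: "A j i = cnj (A i j)" if "i < n" "j < n" for i j
    using A that unfolding hermitian_mat_def by blast
  have lt: "i div n < n" "i mod n < n" if "i < n\<^sup>2" for i
    using that by (cases "n = 0"; simp add: power2_eq_square less_mult_imp_div_less)+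
  show ?thesis
    unfolding hermitian_mat_def kron_conj_def kron_def mconj_def
    using H lt by (metis complex_cnj_cnj complex_cnj_mult)
qed

section \<open>Multilinear expansion of products and traces\<close>

lemma mlist_prod_sum:
  assumes "finite B"
  shows "mlist_prod N (map (\<lambda>j r c. \<Sum>b\<in>B. Y b j r c) js) r c
    = (\<Sum>bs\<in>words B (length js). mlist_prod N (map2 Y bs js) r c)"
proof (induction js arbitrary: r)
  case (Cons j js)
  have "mlist_prod N (map (\<lambda>j r c. \<Sum>b\<in>B. Y b j r c) (j # js)) r c
     = (\<Sum>k<N. \<Sum>b\<in>B. \<Sum>bs\<in>words B (length js). Y b j r k * mlist_prod N (map2 Y bs js) k c)"
    unfolding list.map mlist_prod_Cons mmult_def Cons.IH sum_product ..
  also have "\<dots> = (\<Sum>b\<in>B. \<Sum>bs\<in>words B (length js). \<Sum>k<N. Y b j r k * mlist_prod N (map2 Y bs js) k c)"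
    by (subst sum.swap, intro sum.cong refl, subst sum.swap, rule refl)
  also have "\<dots> = (\<Sum>bs\<in>words B (length (j # js)). mlist_prod N (map2 Y bs (j # js)) r c)"
    unfolding list.size add_Suc_right add_0_right sum_words_Suc
    by (simp only: zip_Cons_Cons list.map prod.case mlist_prod_Cons mmult_def)
  finally show ?case .
qed simp

text \<open>One summand is chosen at each position, so the choices form a word over
  \<open>B\<close>; through \<open>js\<close> the summands may also vary with the position. The
  splitting of \<open>X\<close> into tensor and mean and the expansion of powers over the index set
  \<open>{..<d n}\<close> are both instances.\<close>

lemma ttr_sum:
  assumes "finite B"
  shows "ttr N (map (\<lambda>j r c. \<Sum>b\<in>B. Y b j r c) js) = (\<Sum>bs\<in>words B (length js). ttr N (map2 Y bs js))"
proof -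
  have "(\<Sum>r<N. mlist_prod N (map (\<lambda>j r c. \<Sum>b\<in>B. Y b j r c) js) r r)
      = (\<Sum>bs\<in>words B (length js). \<Sum>r<N. mlist_prod N (map2 Y bs js) r r)"
    unfolding mlist_prod_sum[OF assms] by (rule sum.swap)
  then show ?thesis
    unfolding tau_def mtrace_def sum_divide_distrib[symmetric] by (simp only:)
qed

lemma mlist_prod_scale:
  "mlist_prod N (map (\<lambda>j r c. s j * Y j r c) js) r c = (\<Prod>j\<leftarrow>js. s j) * mlist_prod N (map Y js) r c"
proof (induction js arbitrary: r)
  case (Cons j js)
  have "mlist_prod N (map (\<lambda>j r c. s j * Y j r c) (j # js)) r c
      = (\<Sum>k<N. s j * Y j r k * ((\<Prod>j\<leftarrow>js. s j) * mlist_prod N (map Y js) k c))"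
    unfolding list.map mlist_prod_Cons mmult_def Cons.IH ..
  also have "\<dots> = (\<Prod>j\<leftarrow>j # js. s j) * mlist_prod N (map Y (j # js)) r c"
    by (simp add: mmult_def sum_distrib_left mult.assoc mult.left_commute)
  finally show ?case .
qed simp

lemma ttr_scale: "ttr N (map (\<lambda>j r c. s j * Y j r c) js) = (\<Prod>j\<leftarrow>js. s j) * ttr N (map Y js)"
proof -
  have "(\<Sum>i<N. mlist_prod N (map (\<lambda>j r c. s j * Y j r c) js) i i)
      = (\<Prod>j\<leftarrow>js. s j) * (\<Sum>i<N. mlist_prod N (map Y js) i i)"
    unfolding sum_distrib_left by (intro sum.cong refl mlist_prod_scale)
  then show ?thesis unfolding tau_def mtrace_def by simp
qed

text \<open>The product as a sum over paths: \<open>r # ks\<close> lists the vertices visited, and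
  the final \<open>mone\<close> forces the path to end at \<open>c\<close>.\<close>

lemma mlist_prod_indices:
  "mlist_prod N As r c
    = (\<Sum>ks\<in>words {..<N} (length As). (\<Prod>t<length As. (As ! t) ((r # ks) ! t) (ks ! t)) * mone ((r # ks) ! length As) c)"
proof (induction As arbitrary: r)
  case (Cons A As)
  have "mlist_prod N (A # As) r c = (\<Sum>k<N. \<Sum>ks\<in>words {..<N} (length As).
      A r k * ((\<Prod>t<length As. (As ! t) ((k # ks) ! t) (ks ! t)) * mone ((k # ks) ! length As) c))"
    unfolding mlist_prod_Cons mmult_def Cons.IH sum_distrib_left ..
  also have "\<dots> = (\<Sum>ks\<in>words {..<N} (length (A # As)).
      (\<Prod>t<length (A # As). ((A # As) ! t) ((r # ks) ! t) (ks ! t)) * mone ((r # ks) ! length (A # As)) c)"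
    unfolding list.size add_Suc_right add_0_right sum_words_Suc prod.lessThan_Suc_shift
    by (intro sum.cong refl) (simp add: mult.assoc)
  finally show ?case .
qed simp

section \<open>Sequences of random variables with bounded or vanishing moments\<close>

text \<open>Membership in every \<open>L^q\<close>. The class is closed under sums, products and
  conjugates, so polynomials in the entries are integrable without further argument.\<close>

definition all_moments :: "'a measure \<Rightarrow> ('a \<Rightarrow> complex) \<Rightarrow> bool" where
  "all_moments M f \<longleftrightarrow> f \<in> borel_measurable M \<and> (\<forall>q. integrable M (\<lambda>\<omega>. cmod (f \<omega>) ^ q))"

lemma norm_add_power_le:
  fixes x y :: "'b::real_normed_vector"
  shows "norm (x + y) ^ q \<le> 2 ^ q * (norm x ^ q + norm y ^ q)"
proof -
  have "norm (x + y) \<le> 2 * max (norm x) (norm y)"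
    using norm_triangle_ineq[of x y] by linarith
  then have "norm (x + y) ^ q \<le> (2 * max (norm x) (norm y)) ^ q"
    by (intro power_mono) auto
  also have "\<dots> = 2 ^ q * max (norm x) (norm y) ^ q" by (rule power_mult_distrib)
  also have "max (norm x) (norm y) ^ q \<le> norm x ^ q + norm y ^ q"
    by (cases "norm x \<le> norm y") (auto simp: max_def)
  finally show ?thesis by simp
qed

text \<open>Young's inequality with a free weight. Choosing the weight according to the target
  accuracy lets it replace Hoelder's inequality in the estimates of expectations.\<close>

lemma mult_le_eps:
  fixes a b \<delta> :: real
  assumes "0 < \<delta>"
  shows "a * b \<le> \<delta> * a\<^sup>2 + b\<^sup>2 / \<delta>"
proof -
  have "0 \<le> (\<delta> * a - b)\<^sup>2 / \<delta>" using assms by simp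
  also have "(\<delta> * a - b)\<^sup>2 / \<delta> = \<delta> * a\<^sup>2 + b\<^sup>2 / \<delta> - 2 * (a * b)"
    using assms by (simp add: field_simps power2_eq_square)
  finally have "2 * (a * b) \<le> \<delta> * a\<^sup>2 + b\<^sup>2 / \<delta>" by simp
  moreover have "0 \<le> \<delta> * a\<^sup>2 + b\<^sup>2 / \<delta>" using assms by simp
  ultimately show ?thesis by linarith
qed

lemma tendsto_zero_eps:
  fixes f :: "nat \<Rightarrow> real"
  assumes "\<And>n. 0 \<le> f n"
    and "\<And>\<delta>. 0 < \<delta> \<Longrightarrow> \<exists>a. a \<longlonglongrightarrow> 0 \<and> (\<forall>n. f n \<le> a n + \<delta>)"
  shows "f \<longlonglongrightarrow> 0"
proof (rule LIMSEQ_I)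
  fix r :: real assume "0 < r"
  then obtain a where a: "a \<longlonglongrightarrow> 0" "\<And>n. f n \<le> a n + r / 2"
    using assms(2)[of "r / 2"] by auto
  from LIMSEQ_D[OF a(1), of "r / 2"] \<open>0 < r\<close> obtain N where N: "\<And>n. N \<le> n \<Longrightarrow> \<bar>a n\<bar> < r / 2" by auto
  have "norm (f n - 0) < r" if "N \<le> n" for n
    using N[OF that] a(2)[of n] assms(1)[of n] by simp
  then show "\<exists>N. \<forall>n\<ge>N. norm (f n - 0) < r" by blast
qed

context prob_space
begin

lemma all_moments_integrable_power: "all_moments M f \<Longrightarrow> integrable M (\<lambda>\<omega>. cmod (f \<omega>) ^ q)"
  by (simp add: all_moments_def)

lemma all_moments_measurable [measurable_dest]: "all_moments M f \<Longrightarrow> f \<in> borel_measurable M"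
  by (simp add: all_moments_def)

lemma all_moments_integrable: "all_moments M f \<Longrightarrow> integrable M f"
  using all_moments_integrable_power[of f 1] all_moments_measurable[of f] by (simp add: integrable_norm_iff)

lemma all_moments_const [simp]: "all_moments M (\<lambda>_. c)"
  by (simp add: all_moments_def)

lemma all_momentsI_bound:
  assumes "f \<in> borel_measurable M"
    and "\<And>q. integrable M (g q)" "\<And>q \<omega>. \<omega> \<in> space M \<Longrightarrow> cmod (f \<omega>) ^ q \<le> g q \<omega>"
  shows "all_moments M f"
  unfolding all_moments_def
proof (intro conjI allI)
  fix q
  note assms(1)[measurable]
  show "integrable M (\<lambda>\<omega>. cmod (f \<omega>) ^ q)"
    by (rule Bochner_Integration.integrable_bound[OF assms(2)[of q]])
       (use assms(3)[of _ q] in \<open>force intro!: AE_I2\<close>)+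
qed (fact assms(1))

lemma all_moments_add: "all_moments M f \<Longrightarrow> all_moments M g \<Longrightarrow> all_moments M (\<lambda>\<omega>. f \<omega> + g \<omega>)"
  by (rule all_momentsI_bound[where g="\<lambda>q \<omega>. 2 ^ q * (cmod (f \<omega>) ^ q + cmod (g \<omega>) ^ q)"])
     (auto intro!: all_moments_integrable_power norm_add_power_le borel_measurable_add all_moments_measurable)

lemma power_mult_le: "cmod (x * y) ^ q \<le> cmod x ^ (2 * q) + cmod y ^ (2 * q)"
  using mult_le_eps[of 1 "cmod x ^ q" "cmod y ^ q"]
  by (simp add: norm_mult power_mult_distrib power_mult mult.commute flip: power_mult)

lemma all_moments_mult: "all_moments M f \<Longrightarrow> all_moments M g \<Longrightarrow> all_moments M (\<lambda>\<omega>. f \<omega> * g \<omega>)"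
  by (rule all_momentsI_bound[where g="\<lambda>q \<omega>. cmod (f \<omega>) ^ (2 * q) + cmod (g \<omega>) ^ (2 * q)"])
     (auto intro!: all_moments_integrable_power power_mult_le borel_measurable_times all_moments_measurable)

lemma all_moments_cmult: "all_moments M f \<Longrightarrow> all_moments M (\<lambda>\<omega>. c * f \<omega>)"
  by (rule all_moments_mult) auto

lemma all_moments_minus: "all_moments M f \<Longrightarrow> all_moments M (\<lambda>\<omega>. - f \<omega>)"
  using all_moments_cmult[of f "-1"] by simp

lemma all_moments_diff: "all_moments M f \<Longrightarrow> all_moments M g \<Longrightarrow> all_moments M (\<lambda>\<omega>. f \<omega> - g \<omega>)"
  using all_moments_add[of f "\<lambda>\<omega>. - g \<omega>"] all_moments_minus[of g] by simp

lemma all_moments_divide: "all_moments M f \<Longrightarrow> all_moments M (\<lambda>\<omega>. f \<omega> / c)"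
  using all_moments_cmult[of f "1 / c"] by simp

lemma all_moments_sum: "(\<And>i. i \<in> A \<Longrightarrow> all_moments M (f i)) \<Longrightarrow> all_moments M (\<lambda>\<omega>. \<Sum>i\<in>A. f i \<omega>)"
  by (induction A rule: infinite_finite_induct) (auto intro: all_moments_add)

lemma all_moments_prod: "(\<And>i. i \<in> A \<Longrightarrow> all_moments M (f i)) \<Longrightarrow> all_moments M (\<lambda>\<omega>. \<Prod>i\<in>A. f i \<omega>)"
  by (induction A rule: infinite_finite_induct) (auto intro: all_moments_mult)

lemma all_moments_cnj: "all_moments M f \<Longrightarrow> all_moments M (\<lambda>\<omega>. cnj (f \<omega>))"
  using measurable_compose[of f M borel cnj borel]
  by (simp add: all_moments_def borel_measurable_continuous_onI continuous_on_cnj)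

lemma all_moments_norm: "all_moments M f \<Longrightarrow> all_moments M (\<lambda>\<omega>. complex_of_real (cmod (f \<omega>)))"
  by (auto simp: all_moments_def intro!: measurable_compose[OF _ borel_measurable_of_real] borel_measurable_norm)

lemma all_moments_mlist_prod:
  assumes "\<And>A r c. A \<in> set As \<Longrightarrow> all_moments M (\<lambda>\<omega>. A \<omega> r c)"
  shows "all_moments M (\<lambda>\<omega>. mlist_prod N (map (\<lambda>A. A \<omega>) As) r c)"
  using assms
proof (induction As arbitrary: r)
  case (Cons A As)
  then show ?case
    unfolding list.map mlist_prod_Cons mmult_def by (intro all_moments_sum all_moments_mult) auto
qed simp

lemma all_moments_tau: "(\<And>r c. all_moments M (\<lambda>\<omega>. A \<omega> r c)) \<Longrightarrow> all_moments M (\<lambda>\<omega>. tau N (A \<omega>))"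
  unfolding tau_def mtrace_def by (intro all_moments_divide all_moments_sum)

lemma all_moments_ttr:
  assumes "\<And>x r c. x \<in> set xs \<Longrightarrow> all_moments M (\<lambda>\<omega>. f x \<omega> r c)"
  shows "all_moments M (\<lambda>\<omega>. ttr N (map (\<lambda>x. f x \<omega>) xs))"
proof (intro all_moments_tau)
  fix r c
  have "all_moments M (\<lambda>\<omega>. mlist_prod N (map (\<lambda>A. A \<omega>) (map f xs)) r c)"
    by (rule all_moments_mlist_prod) (use assms in auto)
  then show "all_moments M (\<lambda>\<omega>. mlist_prod N (map (\<lambda>x. f x \<omega>) xs) r c)"
    by (simp add: o_def)
qed

lemma all_moments_kron_conj: "(\<And>r c. all_moments M (\<lambda>\<omega>. A \<omega> r c)) \<Longrightarrow> all_moments M (\<lambda>\<omega>. kron_conj n (A \<omega>) r c)"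
  unfolding kron_conj_def kron_def mconj_def by (intro all_moments_mult all_moments_cnj)

end

section \<open>Sequences bounded, vanishing or converging in every \<open>L^q\<close>\<close>

locale prob_seq =
  fixes M :: "nat \<Rightarrow> 'a measure"
  assumes prob: "\<And>n. prob_space (M n)"
begin

text \<open>The bound is uniform in \<open>n\<close> for each exponent. These sequences form an
  algebra in which the \<open>null\<close> ones are an ideal; limits in the sense of
  \<open>conv\<close> therefore multiply.\<close>

definition bdd :: "(nat \<Rightarrow> 'a \<Rightarrow> complex) \<Rightarrow> bool" where
  "bdd X \<longleftrightarrow> (\<forall>n. all_moments (M n) (X n)) \<and> (\<forall>q. \<exists>C. \<forall>n. integral\<^sup>L (M n) (\<lambda>\<omega>. cmod (X n \<omega>) ^ q) \<le> C)"

definition null :: "(nat \<Rightarrow> 'a \<Rightarrow> complex) \<Rightarrow> bool" where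
  "null X \<longleftrightarrow> (\<forall>n. all_moments (M n) (X n)) \<and> (\<forall>q\<ge>1. (\<lambda>n. integral\<^sup>L (M n) (\<lambda>\<omega>. cmod (X n \<omega>) ^ q)) \<longlonglongrightarrow> 0)"

definition conv :: "(nat \<Rightarrow> 'a \<Rightarrow> complex) \<Rightarrow> complex \<Rightarrow> bool" where
  "conv X c \<longleftrightarrow> null (\<lambda>n \<omega>. X n \<omega> - c)"

lemma bdd_all_moments: "bdd X \<Longrightarrow> all_moments (M n) (X n)" by (simp add: bdd_def)
lemma null_all_moments: "null X \<Longrightarrow> all_moments (M n) (X n)" by (simp add: null_def)

lemma bddE:
  assumes "bdd X"
  obtains C where "0 < C" "\<And>n. integral\<^sup>L (M n) (\<lambda>\<omega>. cmod (X n \<omega>) ^ q) \<le> C"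
proof -
  from assms obtain C where "\<And>n. integral\<^sup>L (M n) (\<lambda>\<omega>. cmod (X n \<omega>) ^ q) \<le> C" unfolding bdd_def by blast
  then have "\<And>n. integral\<^sup>L (M n) (\<lambda>\<omega>. cmod (X n \<omega>) ^ q) \<le> max C 1" by (simp add: le_max_iff_disj)
  then show ?thesis using that[of "max C 1"] by simp
qed

lemma bddI_bound:
  assumes X: "\<And>n. X n \<in> borel_measurable (M n)"
    and g: "\<And>n q. integrable (M n) (g n q)" "\<And>n q \<omega>. \<omega> \<in> space (M n) \<Longrightarrow> cmod (X n \<omega>) ^ q \<le> g n q \<omega>"
    and C: "\<And>n q. integral\<^sup>L (M n) (g n q) \<le> C q"
  shows "bdd X"
proof -
  interpret prob_space "M n" for n by (rule prob)
  have L: "all_moments (M n) (X n)" for n by (rule all_momentsI_bound[OF X g])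
  have "integral\<^sup>L (M n) (\<lambda>\<omega>. cmod (X n \<omega>) ^ q) \<le> C q" for n q
    by (rule order_trans[OF integral_mono C[of n q]])
       (use L g in \<open>auto simp: all_moments_def\<close>)
  with L show ?thesis unfolding bdd_def by blast
qed

lemma bdd_const [simp]: "bdd (\<lambda>n \<omega>. c)"
proof (rule bddI_bound)
  interpret prob_space "M n" for n by (rule prob)
  show "integrable (M n) (\<lambda>_. cmod c ^ q)" "integral\<^sup>L (M n) (\<lambda>_. cmod c ^ q) \<le> cmod c ^ q" for n q
    by (simp_all add: prob_space)
qed auto

lemma bdd_add:
  assumes "bdd X" "bdd Y"
  shows "bdd (\<lambda>n \<omega>. X n \<omega> + Y n \<omega>)"
proof -
  interpret prob_space "M n" for n by (rule prob)
  note [simp] = all_moments_integrable_power[OF bdd_all_moments[OF assms(1)]] all_moments_integrable_power[OF bdd_all_moments[OF assms(2)]]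
  from assms obtain C D where CD: "\<And>q n. integral\<^sup>L (M n) (\<lambda>\<omega>. cmod (X n \<omega>) ^ q) \<le> C q"
    "\<And>q n. integral\<^sup>L (M n) (\<lambda>\<omega>. cmod (Y n \<omega>) ^ q) \<le> D q"
    unfolding bdd_def by metis
  show ?thesis
  proof (rule bddI_bound[where g="\<lambda>n q \<omega>. 2 ^ q * (cmod (X n \<omega>) ^ q + cmod (Y n \<omega>) ^ q)"])
    show "integral\<^sup>L (M n) (\<lambda>\<omega>. 2 ^ q * (cmod (X n \<omega>) ^ q + cmod (Y n \<omega>) ^ q)) \<le> 2 ^ q * (C q + D q)" for n q
      using CD[of n q] by (simp add: add_mono)
    show "(\<lambda>\<omega>. X n \<omega> + Y n \<omega>) \<in> borel_measurable (M n)" for n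
      using assms[THEN bdd_all_moments] by (auto intro!: borel_measurable_add all_moments_measurable)
  qed (auto simp: norm_add_power_le)
qed

lemma bdd_mult:
  assumes "bdd X" "bdd Y"
  shows "bdd (\<lambda>n \<omega>. X n \<omega> * Y n \<omega>)"
proof -
  interpret prob_space "M n" for n by (rule prob)
  note [simp] = all_moments_integrable_power[OF bdd_all_moments[OF assms(1)]] all_moments_integrable_power[OF bdd_all_moments[OF assms(2)]]
  from assms obtain C D where CD: "\<And>q n. integral\<^sup>L (M n) (\<lambda>\<omega>. cmod (X n \<omega>) ^ q) \<le> C q"
    "\<And>q n. integral\<^sup>L (M n) (\<lambda>\<omega>. cmod (Y n \<omega>) ^ q) \<le> D q"
    unfolding bdd_def by metis
  show ?thesis
  proof (rule bddI_bound[where g="\<lambda>n q \<omega>. cmod (X n \<omega>) ^ (2 * q) + cmod (Y n \<omega>) ^ (2 * q)"])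
    show "integral\<^sup>L (M n) (\<lambda>\<omega>. cmod (X n \<omega>) ^ (2 * q) + cmod (Y n \<omega>) ^ (2 * q)) \<le> C (2 * q) + D (2 * q)" for n q
      using CD[of n "2 * q"] by (simp add: add_mono)
    show "(\<lambda>\<omega>. X n \<omega> * Y n \<omega>) \<in> borel_measurable (M n)" for n
      using assms[THEN bdd_all_moments] by (auto intro!: borel_measurable_times all_moments_measurable)
  qed (auto simp: power_mult_le)
qed

lemma bdd_sum: "(\<And>i. i \<in> A \<Longrightarrow> bdd (X i)) \<Longrightarrow> bdd (\<lambda>n \<omega>. \<Sum>i\<in>A. X i n \<omega>)"
  by (induction A rule: infinite_finite_induct) (auto intro: bdd_add)

lemma bdd_norm: "bdd X \<Longrightarrow> bdd (\<lambda>n \<omega>. complex_of_real (cmod (X n \<omega>)))"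
  using prob unfolding bdd_def by (simp add: prob_space.all_moments_norm)

lemma bdd_cnj: "bdd X \<Longrightarrow> bdd (\<lambda>n \<omega>. cnj (X n \<omega>))"
  using prob unfolding bdd_def by (simp add: prob_space.all_moments_cnj)

text \<open>The chessboard estimate controls the square of a trace;
  \<open>x^q \<le> 1 + x^(2 q)\<close> turns this into bounds on all powers.\<close>

lemma bdd_sqrt_dom:
  assumes X: "\<And>n. X n \<in> borel_measurable (M n)" and Y: "bdd Y"
    and le: "\<And>n \<omega>. \<omega> \<in> space (M n) \<Longrightarrow> (cmod (X n \<omega>))\<^sup>2 \<le> cmod (Y n \<omega>)"
  shows "bdd X"
proof -
  interpret prob_space "M n" for n by (rule prob)
  note [simp] = all_moments_integrable_power[OF bdd_all_moments[OF Y]]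
  from Y obtain C where C: "\<And>q n. integral\<^sup>L (M n) (\<lambda>\<omega>. cmod (Y n \<omega>) ^ q) \<le> C q"
    unfolding bdd_def by metis
  show ?thesis
  proof (rule bddI_bound[OF X])
    fix n q \<omega> assume w: "\<omega> \<in> space (M n)"
    have "cmod (X n \<omega>) ^ q \<le> 1 + ((cmod (X n \<omega>))\<^sup>2) ^ q"
    proof (cases "cmod (X n \<omega>) \<le> 1")
      case True
      then have "cmod (X n \<omega>) ^ q \<le> 1" by (simp add: power_le_one)
      moreover have "0 \<le> ((cmod (X n \<omega>))\<^sup>2) ^ q" by simp
      ultimately show ?thesis by linarith
    next
      case False
      then have "cmod (X n \<omega>) ^ q \<le> cmod (X n \<omega>) ^ (2 * q)" by (intro power_increasing) auto
      then show ?thesis by (simp add: power_mult)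
    qed
    also have "((cmod (X n \<omega>))\<^sup>2) ^ q \<le> cmod (Y n \<omega>) ^ q"
      using le[OF w] by (intro power_mono) auto
    finally show "cmod (X n \<omega>) ^ q \<le> 1 + cmod (Y n \<omega>) ^ q" by simp
  next
    show "integral\<^sup>L (M n) (\<lambda>\<omega>. 1 + cmod (Y n \<omega>) ^ q) \<le> 1 + C q" for n q
      using C[of n q] by (simp add: prob_space)
  qed simp
qed

lemma null_add:
  assumes "null X" "null Y"
  shows "null (\<lambda>n \<omega>. X n \<omega> + Y n \<omega>)"
proof -
  interpret prob_space "M n" for n by (rule prob)
  note [simp] = all_moments_integrable_power[OF null_all_moments[OF assms(1)]] all_moments_integrable_power[OF null_all_moments[OF assms(2)]]
  have L: "all_moments (M n) (\<lambda>\<omega>. X n \<omega> + Y n \<omega>)" for n by (intro all_moments_add null_all_moments assms)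
  have "(\<lambda>n. integral\<^sup>L (M n) (\<lambda>\<omega>. cmod (X n \<omega> + Y n \<omega>) ^ q)) \<longlonglongrightarrow> 0" if q: "1 \<le> q" for q
  proof (rule tendsto_sandwich[OF always_eventually always_eventually tendsto_const])
    have le: "integral\<^sup>L (M n) (\<lambda>\<omega>. cmod (X n \<omega> + Y n \<omega>) ^ q)
      \<le> integral\<^sup>L (M n) (\<lambda>\<omega>. 2 ^ q * (cmod (X n \<omega>) ^ q + cmod (Y n \<omega>) ^ q))" for n
      using all_moments_integrable_power[OF L] by (intro integral_mono) (auto simp: norm_add_power_le)
    show "\<forall>n. 0 \<le> integral\<^sup>L (M n) (\<lambda>\<omega>. cmod (X n \<omega> + Y n \<omega>) ^ q)" by simp
    show "\<forall>n. integral\<^sup>L (M n) (\<lambda>\<omega>. cmod (X n \<omega> + Y n \<omega>) ^ q)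
      \<le> 2 ^ q * (integral\<^sup>L (M n) (\<lambda>\<omega>. cmod (X n \<omega>) ^ q) + integral\<^sup>L (M n) (\<lambda>\<omega>. cmod (Y n \<omega>) ^ q))" using le by simp
    have "(\<lambda>n. 2 ^ q * (integral\<^sup>L (M n) (\<lambda>\<omega>. cmod (X n \<omega>) ^ q) + integral\<^sup>L (M n) (\<lambda>\<omega>. cmod (Y n \<omega>) ^ q)))
      \<longlonglongrightarrow> 2 ^ q * (0 + 0)"
      using assms q unfolding null_def by (intro tendsto_intros) auto
    then show "(\<lambda>n. 2 ^ q * (integral\<^sup>L (M n) (\<lambda>\<omega>. cmod (X n \<omega>) ^ q) + integral\<^sup>L (M n) (\<lambda>\<omega>. cmod (Y n \<omega>) ^ q)))
      \<longlonglongrightarrow> 0" by simp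
  qed
  with L show ?thesis unfolding null_def by blast
qed

lemma null_bdd_mult:
  assumes X: "null X" and Y: "bdd Y"
  shows "null (\<lambda>n \<omega>. X n \<omega> * Y n \<omega>)"
proof -
  interpret prob_space "M n" for n by (rule prob)
  note [simp] = all_moments_integrable_power[OF null_all_moments[OF X]] all_moments_integrable_power[OF bdd_all_moments[OF Y]]
  have L: "all_moments (M n) (\<lambda>\<omega>. X n \<omega> * Y n \<omega>)" for n by (intro all_moments_mult null_all_moments bdd_all_moments assms)
  have "(\<lambda>n. integral\<^sup>L (M n) (\<lambda>\<omega>. cmod (X n \<omega> * Y n \<omega>) ^ q)) \<longlonglongrightarrow> 0" if q: "1 \<le> q" for q
  proof (rule tendsto_zero_eps)
    fix \<delta> :: real assume d: "0 < \<delta>"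
    obtain C where C: "0 < C" "\<And>n. integral\<^sup>L (M n) (\<lambda>\<omega>. cmod (Y n \<omega>) ^ (2 * q)) \<le> C" using bddE[OF Y] by blast
    \<comment> \<open>The weight \<open>\<delta> / C\<close> is tuned so that the bounded factor
      contributes at most \<open>\<delta>\<close>, while the null factor is only divided by a
      constant.\<close>
    let ?a = "\<lambda>n. integral\<^sup>L (M n) (\<lambda>\<omega>. cmod (X n \<omega>) ^ (2 * q)) / (\<delta> / C)"
    show "\<exists>a. a \<longlonglongrightarrow> 0 \<and> (\<forall>n. integral\<^sup>L (M n) (\<lambda>\<omega>. cmod (X n \<omega> * Y n \<omega>) ^ q) \<le> a n + \<delta>)"
    proof (intro exI[of _ ?a] conjI allI)
      have "?a \<longlonglongrightarrow> 0 / (\<delta> / C)"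
        using X q d C by (intro tendsto_divide tendsto_const) (auto simp: null_def)
      then show "?a \<longlonglongrightarrow> 0" by simp
    next
      fix n
      have pt: "cmod (X n \<omega> * Y n \<omega>) ^ q \<le> cmod (X n \<omega>) ^ (2 * q) / (\<delta> / C) + \<delta> / C * cmod (Y n \<omega>) ^ (2 * q)" for \<omega>
        using mult_le_eps[of "\<delta> / C" "cmod (Y n \<omega>) ^ q" "cmod (X n \<omega>) ^ q"] d C(1)
        by (simp only: norm_mult power_mult_distrib power_mult[symmetric] mult.commute[of _ 2] mult.commute[of "cmod (X n \<omega>) ^ q"])
           (simp add: divide_simps mult_ac add_ac)
      have "integral\<^sup>L (M n) (\<lambda>\<omega>. cmod (X n \<omega> * Y n \<omega>) ^ q)
          \<le> integral\<^sup>L (M n) (\<lambda>\<omega>. cmod (X n \<omega>) ^ (2 * q) / (\<delta> / C) + \<delta> / C * cmod (Y n \<omega>) ^ (2 * q))"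
        using all_moments_integrable_power[OF L] by (intro integral_mono pt Bochner_Integration.integrable_add integrable_mult_right integrable_divide) auto
      also have "\<dots> = ?a n + \<delta> / C * integral\<^sup>L (M n) (\<lambda>\<omega>. cmod (Y n \<omega>) ^ (2 * q))"
        by (subst Bochner_Integration.integral_add) (auto intro!: integrable_mult_right integrable_divide)
      also have "\<delta> / C * integral\<^sup>L (M n) (\<lambda>\<omega>. cmod (Y n \<omega>) ^ (2 * q)) \<le> \<delta> / C * C"
        using C d by (intro mult_left_mono) auto
      finally show "integral\<^sup>L (M n) (\<lambda>\<omega>. cmod (X n \<omega> * Y n \<omega>) ^ q) \<le> ?a n + \<delta>" using C(1) by simp
    qed
  qed simp
  with L show ?thesis unfolding null_def by blast
qed

lemma null_zero [simp]: "null (\<lambda>n \<omega>. 0)"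
  using prob unfolding null_def by (simp add: prob_space.all_moments_const power_0_left)

lemma null_cmult: "null X \<Longrightarrow> null (\<lambda>n \<omega>. c * X n \<omega>)"
  using null_bdd_mult[of X "\<lambda>_ _. c"] by (simp add: mult.commute)

lemma null_sum: "(\<And>i. i \<in> A \<Longrightarrow> null (X i)) \<Longrightarrow> null (\<lambda>n \<omega>. \<Sum>i\<in>A. X i n \<omega>)"
  by (induction A rule: infinite_finite_induct) (auto intro: null_add)

lemma null_imp_bdd:
  assumes "null X" shows "bdd X"
  unfolding bdd_def
proof (intro conjI allI)
  interpret prob_space "M n" for n by (rule prob)
  fix q
  show "\<exists>C. \<forall>n. integral\<^sup>L (M n) (\<lambda>\<omega>. cmod (X n \<omega>) ^ q) \<le> C"
  proof (cases "q = 0")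
    case True
    then show ?thesis by (auto simp: prob_space)
  next
    case False
    then have "convergent (\<lambda>n. integral\<^sup>L (M n) (\<lambda>\<omega>. cmod (X n \<omega>) ^ q))"
      using assms unfolding null_def by (intro convergentI[where L=0]) auto
    then have "Bseq (\<lambda>n. integral\<^sup>L (M n) (\<lambda>\<omega>. cmod (X n \<omega>) ^ q))" by (rule convergent_imp_Bseq)
    then obtain C where "\<And>n. norm (integral\<^sup>L (M n) (\<lambda>\<omega>. cmod (X n \<omega>) ^ q)) \<le> C" unfolding Bseq_def by blast
    then show ?thesis by (intro exI[of _ C] allI) (simp add: abs_le_iff)
  qed
qed (use assms null_all_moments in blast)

lemma conv_imp_bdd: "conv X c \<Longrightarrow> bdd X"
  using bdd_add[OF null_imp_bdd bdd_const[of c], of "\<lambda>n \<omega>. X n \<omega> - c"] by (simp add: conv_def)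

lemma conv_add: "conv X a \<Longrightarrow> conv Y b \<Longrightarrow> conv (\<lambda>n \<omega>. X n \<omega> + Y n \<omega>) (a + b)"
  unfolding conv_def using null_add[of "\<lambda>n \<omega>. X n \<omega> - a" "\<lambda>n \<omega>. Y n \<omega> - b"] by (simp add: algebra_simps)

lemma conv_mult:
  assumes "conv X a" "conv Y b"
  shows "conv (\<lambda>n \<omega>. X n \<omega> * Y n \<omega>) (a * b)"
proof -
  have "null (\<lambda>n \<omega>. (X n \<omega> - a) * Y n \<omega> + a * (Y n \<omega> - b))"
    using assms by (intro null_add null_bdd_mult null_cmult conv_imp_bdd) (auto simp: conv_def)
  then show ?thesis by (simp add: conv_def algebra_simps)
qed

lemma conv_cnj:
  assumes "conv X a" shows "conv (\<lambda>n \<omega>. cnj (X n \<omega>)) (cnj a)"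
proof -
  interpret prob_space "M n" for n by (rule prob)
  have "cmod (cnj (X n \<omega>) - cnj a) = cmod (X n \<omega> - a)" for n \<omega>
    by (metis complex_cnj_diff complex_mod_cnj)
  moreover have "all_moments (M n) (\<lambda>\<omega>. cnj (X n \<omega>) - cnj a)" for n
    using all_moments_cnj[OF null_all_moments[of "\<lambda>n \<omega>. X n \<omega> - a" n]] assms by (simp add: conv_def)
  ultimately show ?thesis using assms unfolding conv_def null_def by simp
qed

lemma conv_norm_sq:
  assumes "conv X a" shows "conv (\<lambda>n \<omega>. complex_of_real ((cmod (X n \<omega>))\<^sup>2)) (complex_of_real ((cmod a)\<^sup>2))"
  using conv_mult[OF assms conv_cnj[OF assms]] by (simp only: complex_norm_square)

lemma conv_null_cong: "conv X a \<Longrightarrow> null (\<lambda>n \<omega>. Y n \<omega> - X n \<omega>) \<Longrightarrow> conv Y a"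
  unfolding conv_def using null_add[of "\<lambda>n \<omega>. X n \<omega> - a" "\<lambda>n \<omega>. Y n \<omega> - X n \<omega>"] by simp

lemma conv_expectation:
  assumes "conv X a" shows "(\<lambda>n. integral\<^sup>L (M n) (X n)) \<longlonglongrightarrow> a"
proof -
  interpret prob_space "M n" for n by (rule prob)
  have L: "all_moments (M n) (\<lambda>\<omega>. X n \<omega> - a)" for n using assms null_all_moments unfolding conv_def by blast
  have L': "all_moments (M n) (X n)" for n using conv_imp_bdd[OF assms] bdd_all_moments by blast
  have "(\<lambda>n. integral\<^sup>L (M n) (X n) - a) \<longlonglongrightarrow> 0"
  proof (rule Lim_null_comparison[OF always_eventually])
    show "\<forall>n. norm (integral\<^sup>L (M n) (X n) - a) \<le> integral\<^sup>L (M n) (\<lambda>\<omega>. cmod (X n \<omega> - a) ^ 1)"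
    proof
      fix n
      have "integral\<^sup>L (M n) (X n) - a = integral\<^sup>L (M n) (\<lambda>\<omega>. X n \<omega> - a)"
        using all_moments_integrable[OF L'[of n]] by (simp add: prob_space)
      then show "norm (integral\<^sup>L (M n) (X n) - a) \<le> integral\<^sup>L (M n) (\<lambda>\<omega>. cmod (X n \<omega> - a) ^ 1)"
        by (simp add: integral_norm_bound)
    qed
    show "(\<lambda>n. integral\<^sup>L (M n) (\<lambda>\<omega>. cmod (X n \<omega> - a) ^ 1)) \<longlonglongrightarrow> 0"
      using assms unfolding conv_def null_def by blast
  qed
  then show ?thesis by (rule LIM_zero_cancel)
qed

text \<open>Uniformly bounded moments of higher order rule out escaping mass, so convergence in
  probability upgrades to convergence in every \<open>L^q\<close>.\<close>

lemma conv_in_prob_imp_conv: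
  assumes X: "conv_in_prob M X c" and B: "bdd X"
  shows "conv X c"
proof -
  interpret prob_space "M n" for n by (rule prob)
  have B': "bdd (\<lambda>n \<omega>. X n \<omega> - c)" using bdd_add[OF B bdd_const[of "-c"]] by simp
  note L = bdd_all_moments[OF B']
  note [simp] = all_moments_integrable_power[OF L]
  have [measurable]: "X n \<in> borel_measurable (M n)" for n using all_moments_measurable[OF bdd_all_moments[OF B]] .
  have "(\<lambda>n. integral\<^sup>L (M n) (\<lambda>\<omega>. cmod (X n \<omega> - c) ^ q)) \<longlonglongrightarrow> 0" if q: "1 \<le> q" for q
  proof (rule tendsto_zero_eps)
    fix \<delta> :: real assume d: "0 < \<delta>"
    obtain C where C: "0 < C" "\<And>n. integral\<^sup>L (M n) (\<lambda>\<omega>. cmod (X n \<omega> - c) ^ (2 * q)) \<le> C" using bddE[OF B'] by blast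
    \<comment> \<open>\<open>\<epsilon>\<close> covers the event of a small deviation, where
      \<open>\<epsilon> \<le> 1\<close> gives \<open>\<epsilon> ^ q \<le> \<epsilon>\<close>;
      \<open>\<eta>\<close> is the Young weight on the complement and makes the moment of order
      \<open>2 * q\<close> cost at most half of \<open>\<delta>\<close>.\<close>
    define \<epsilon> where "\<epsilon> = min 1 (\<delta> / 2)"
    define \<eta> where "\<eta> = \<delta> / 2 / C"
    have e: "0 < \<epsilon>" "\<epsilon> \<le> 1" "\<epsilon> \<le> \<delta> / 2" "0 < \<eta>" using d C by (auto simp: \<epsilon>_def \<eta>_def)
    let ?A = "\<lambda>n. {\<omega> \<in> space (M n). \<epsilon> < norm (X n \<omega> - c)}"
    let ?a = "\<lambda>n. measure (M n) (?A n) / \<eta>"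
    have A [measurable]: "?A n \<in> sets (M n)" for n by measurable
    have [simp]: "integrable (M n) (indicat_real (?A n))" for n
      using A by (simp add: emeasure_eq_measure)
    show "\<exists>a. a \<longlonglongrightarrow> 0 \<and> (\<forall>n. integral\<^sup>L (M n) (\<lambda>\<omega>. cmod (X n \<omega> - c) ^ q) \<le> a n + \<delta>)"
    proof (intro exI[of _ ?a] conjI allI)
      have "?a \<longlonglongrightarrow> 0 / \<eta>"
        using X e by (intro tendsto_divide tendsto_const) (auto simp: conv_in_prob_def)
      then show "?a \<longlonglongrightarrow> 0" by simp
    next
      fix n
      have pt: "cmod (X n \<omega> - c) ^ q \<le> \<epsilon> + (\<eta> * cmod (X n \<omega> - c) ^ (2 * q) + indicator (?A n) \<omega> / \<eta>)"
        if "\<omega> \<in> space (M n)" for \<omega>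
      proof (cases "\<epsilon> < norm (X n \<omega> - c)")
        case True
        have "cmod (X n \<omega> - c) ^ q * 1 \<le> \<eta> * (cmod (X n \<omega> - c) ^ q)\<^sup>2 + 1\<^sup>2 / \<eta>"
          using e by (intro mult_le_eps) auto
        then show ?thesis using True that e by (simp add: power_mult[symmetric] mult.commute)
      next
        case False
        have "cmod (X n \<omega> - c) ^ q \<le> \<epsilon> ^ q" using False by (intro power_mono) auto
        also have "\<epsilon> ^ q \<le> \<epsilon> ^ 1" using e q by (intro power_decreasing) auto
        finally show ?thesis using e by (simp add: add_increasing2)
      qed
      have "integral\<^sup>L (M n) (\<lambda>\<omega>. cmod (X n \<omega> - c) ^ q)
          \<le> integral\<^sup>L (M n) (\<lambda>\<omega>. \<epsilon> + (\<eta> * cmod (X n \<omega> - c) ^ (2 * q) + indicator (?A n) \<omega> / \<eta>))"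
        by (intro integral_mono pt Bochner_Integration.integrable_add integrable_mult_right integrable_divide
              integrable_const) auto
      also have "\<dots> = \<epsilon> + (\<eta> * integral\<^sup>L (M n) (\<lambda>\<omega>. cmod (X n \<omega> - c) ^ (2 * q)) + ?a n)"
        by (subst Bochner_Integration.integral_add; simp add: prob_space)+
      also have "\<eta> * integral\<^sup>L (M n) (\<lambda>\<omega>. cmod (X n \<omega> - c) ^ (2 * q)) \<le> \<eta> * C"
        using C e by (intro mult_left_mono) auto
      finally show "integral\<^sup>L (M n) (\<lambda>\<omega>. cmod (X n \<omega> - c) ^ q) \<le> ?a n + \<delta>"
        using e C(1) by (simp add: \<eta>_def)
    qed
  qed simp
  with L show ?thesis unfolding conv_def null_def by blast
qed

text \<open>The deterministic error \<open>a\<close> may depend on \<open>\<delta>\<close>: the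
  small constant is fixed before \<open>n\<close> grows. This is the form in which rescaling the
  mean tensor yields negligibility.\<close>

lemma null_squeeze:
  assumes R: "\<And>n. all_moments (M n) (R n)" and S: "bdd S"
    and le: "\<And>\<delta>. 0 < \<delta> \<Longrightarrow> \<exists>a. a \<longlonglongrightarrow> 0 \<and> (\<forall>n. \<forall>\<omega>\<in>space (M n). (cmod (R n \<omega>))\<^sup>2 \<le> \<delta> * cmod (S n \<omega>) + a n)"
  shows "null R"
proof -
  interpret prob_space "M n" for n by (rule prob)
  note [simp] = all_moments_integrable_power[OF R] all_moments_integrable_power[OF bdd_all_moments[OF S]]
  have even: "(\<lambda>n. integral\<^sup>L (M n) (\<lambda>\<omega>. cmod (R n \<omega>) ^ (2 * q))) \<longlonglongrightarrow> 0" if q: "1 \<le> q" for q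
  proof (rule tendsto_zero_eps)
    fix \<delta> :: real assume d: "0 < \<delta>"
    obtain C where C: "0 < C" "\<And>n. integral\<^sup>L (M n) (\<lambda>\<omega>. cmod (S n \<omega>) ^ q) \<le> C" using bddE[OF S] by blast
    \<comment> \<open>The factor \<open>2 ^ q\<close> comes from splitting a \<open>q\<close>-th
      power of a sum and \<open>C\<close> bounds the moments of \<open>S\<close>; the cap at 1 gives
      \<open>\<epsilon> ^ q \<le> \<epsilon>\<close>.\<close>
    define \<epsilon> where "\<epsilon> = min 1 (\<delta> / (2 ^ q * C))"
    have e: "0 < \<epsilon>" "\<epsilon> \<le> 1" "\<epsilon> \<le> \<delta> / (2 ^ q * C)" using d C by (auto simp: \<epsilon>_def)
    obtain a where a: "a \<longlonglongrightarrow> 0" "\<And>n \<omega>. \<omega> \<in> space (M n) \<Longrightarrow> (cmod (R n \<omega>))\<^sup>2 \<le> \<epsilon> * cmod (S n \<omega>) + a n"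
      using le[OF e(1)] by blast
    let ?a = "\<lambda>n. 2 ^ q * \<bar>a n\<bar> ^ q"
    show "\<exists>a. a \<longlonglongrightarrow> 0 \<and> (\<forall>n. integral\<^sup>L (M n) (\<lambda>\<omega>. cmod (R n \<omega>) ^ (2 * q)) \<le> a n + \<delta>)"
    proof (intro exI[of _ ?a] conjI allI)
      have "?a \<longlonglongrightarrow> 2 ^ q * \<bar>0\<bar> ^ q"
        using a by (intro tendsto_intros)
      then show "?a \<longlonglongrightarrow> 0" using q by (simp add: power_0_left)
    next
      fix n
      have pt: "cmod (R n \<omega>) ^ (2 * q) \<le> 2 ^ q * (\<epsilon> * cmod (S n \<omega>) ^ q + \<bar>a n\<bar> ^ q)" if "\<omega> \<in> space (M n)" for \<omega>
      proof -
        have "cmod (R n \<omega>) ^ (2 * q) = ((cmod (R n \<omega>))\<^sup>2) ^ q" by (rule power_mult)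
        moreover have "(cmod (R n \<omega>))\<^sup>2 \<le> norm (\<epsilon> * cmod (S n \<omega>) + \<bar>a n\<bar>)"
          using a(2)[OF that] unfolding real_norm_def by linarith
        then have "((cmod (R n \<omega>))\<^sup>2) ^ q \<le> (norm (\<epsilon> * cmod (S n \<omega>) + \<bar>a n\<bar>)) ^ q"
          by (rule power_mono) simp
        ultimately have "cmod (R n \<omega>) ^ (2 * q) \<le> (norm (\<epsilon> * cmod (S n \<omega>) + \<bar>a n\<bar>)) ^ q" by simp
        also have "\<dots> \<le> 2 ^ q * (norm (\<epsilon> * cmod (S n \<omega>)) ^ q + norm \<bar>a n\<bar> ^ q)"
          by (rule norm_add_power_le)
        also have "norm (\<epsilon> * cmod (S n \<omega>)) ^ q = \<epsilon> ^ q * cmod (S n \<omega>) ^ q"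
          using e by (simp add: power_mult_distrib)
        also have "\<epsilon> ^ q * cmod (S n \<omega>) ^ q \<le> \<epsilon> ^ 1 * cmod (S n \<omega>) ^ q"
          using e q by (intro mult_right_mono power_decreasing) auto
        finally show ?thesis by simp
      qed
      have "integral\<^sup>L (M n) (\<lambda>\<omega>. cmod (R n \<omega>) ^ (2 * q))
          \<le> integral\<^sup>L (M n) (\<lambda>\<omega>. 2 ^ q * (\<epsilon> * cmod (S n \<omega>) ^ q + \<bar>a n\<bar> ^ q))"
        by (intro integral_mono pt) auto
      also have "\<dots> = 2 ^ q * (\<epsilon> * integral\<^sup>L (M n) (\<lambda>\<omega>. cmod (S n \<omega>) ^ q) + \<bar>a n\<bar> ^ q)"
        by (simp add: prob_space)
      also have "\<dots> \<le> 2 ^ q * (\<epsilon> * C + \<bar>a n\<bar> ^ q)"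
        using C e by (intro mult_left_mono add_mono) auto
      also have "2 ^ q * (\<epsilon> * C + \<bar>a n\<bar> ^ q) = 2 ^ q * C * \<epsilon> + ?a n" by (simp add: algebra_simps)
      also have "2 ^ q * C * \<epsilon> \<le> \<delta>" using e(3) C(1) by (simp add: field_simps)
      finally show "integral\<^sup>L (M n) (\<lambda>\<omega>. cmod (R n \<omega>) ^ (2 * q)) \<le> ?a n + \<delta>" by simp
    qed
  qed simp
  \<comment> \<open>Arbitrary powers follow from even ones by Young's inequality with one factor
    equal to 1.\<close>
  have "(\<lambda>n. integral\<^sup>L (M n) (\<lambda>\<omega>. cmod (R n \<omega>) ^ q)) \<longlonglongrightarrow> 0" if q: "1 \<le> q" for q
  proof (rule tendsto_zero_eps)
    fix \<delta> :: real assume d: "0 < \<delta>"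
    let ?a = "\<lambda>n. integral\<^sup>L (M n) (\<lambda>\<omega>. cmod (R n \<omega>) ^ (2 * q)) / \<delta>"
    show "\<exists>a. a \<longlonglongrightarrow> 0 \<and> (\<forall>n. integral\<^sup>L (M n) (\<lambda>\<omega>. cmod (R n \<omega>) ^ q) \<le> a n + \<delta>)"
    proof (intro exI[of _ ?a] conjI allI)
      have "?a \<longlonglongrightarrow> 0 / \<delta>" using even[OF q] d by (intro tendsto_divide tendsto_const) auto
      then show "?a \<longlonglongrightarrow> 0" by simp
    next
      fix n
      have pt: "cmod (R n \<omega>) ^ q \<le> \<delta> + cmod (R n \<omega>) ^ (2 * q) / \<delta>" for \<omega>
        using mult_le_eps[OF d, of 1 "cmod (R n \<omega>) ^ q"] by (simp add: power_mult[symmetric] mult.commute)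
      have "integral\<^sup>L (M n) (\<lambda>\<omega>. cmod (R n \<omega>) ^ q) \<le> integral\<^sup>L (M n) (\<lambda>\<omega>. \<delta> + cmod (R n \<omega>) ^ (2 * q) / \<delta>)"
        by (intro integral_mono pt) auto
      then show "integral\<^sup>L (M n) (\<lambda>\<omega>. cmod (R n \<omega>) ^ q) \<le> ?a n + \<delta>" by (simp add: prob_space)
    qed
  qed simp
  with R show ?thesis unfolding null_def by blast
qed

lemma conv_in_probI_L2:
  assumes X: "\<And>n. all_moments (M n) (X n)"
    and lim: "(\<lambda>n. integral\<^sup>L (M n) (\<lambda>\<omega>. (cmod (X n \<omega> - c))\<^sup>2)) \<longlonglongrightarrow> 0"
  shows "conv_in_prob M X c"
  unfolding conv_in_prob_def
proof (intro allI impI)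
  interpret prob_space "M n" for n by (rule prob)
  fix \<epsilon> :: real assume e: "0 < \<epsilon>"
  note [measurable] = all_moments_measurable[OF X]
  have L: "all_moments (M n) (\<lambda>\<omega>. X n \<omega> - c)" for n by (intro all_moments_diff X all_moments_const)
  have "measure (M n) {\<omega> \<in> space (M n). \<epsilon> < cmod (X n \<omega> - c)}
      \<le> integral\<^sup>L (M n) (\<lambda>\<omega>. (cmod (X n \<omega> - c))\<^sup>2) / \<epsilon>\<^sup>2" (is "?m n \<le> ?r n") for n
  proof -
    have "measure (M n) {\<omega> \<in> space (M n). \<epsilon> < cmod (X n \<omega> - c)}
        \<le> measure (M n) {\<omega> \<in> space (M n). \<epsilon>\<^sup>2 \<le> (cmod (X n \<omega> - c))\<^sup>2}"
    proof (rule finite_measure_mono)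
      show "{\<omega> \<in> space (M n). \<epsilon> < cmod (X n \<omega> - c)} \<subseteq> {\<omega> \<in> space (M n). \<epsilon>\<^sup>2 \<le> (cmod (X n \<omega> - c))\<^sup>2}"
      proof
        fix \<omega> assume "\<omega> \<in> {\<omega> \<in> space (M n). \<epsilon> < cmod (X n \<omega> - c)}"
        then have w: "\<omega> \<in> space (M n)" "\<epsilon> < cmod (X n \<omega> - c)" by blast+
        have "\<epsilon>\<^sup>2 \<le> (cmod (X n \<omega> - c))\<^sup>2" by (rule power_mono) (use w e in simp_all)
        then show "\<omega> \<in> {\<omega> \<in> space (M n). \<epsilon>\<^sup>2 \<le> (cmod (X n \<omega> - c))\<^sup>2}" using w by blast
      qed
      show "{\<omega> \<in> space (M n). \<epsilon>\<^sup>2 \<le> (cmod (X n \<omega> - c))\<^sup>2} \<in> sets (M n)"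
        by measurable
    qed
    also have "\<dots> \<le> integral\<^sup>L (M n) (\<lambda>\<omega>. (cmod (X n \<omega> - c))\<^sup>2) / \<epsilon>\<^sup>2"
    proof -
      have "integrable (M n) (\<lambda>\<omega>. (cmod (X n \<omega> - c))\<^sup>2)" by (rule all_moments_integrable_power[OF L])
      from integral_Markov_inequality_measure[OF this sets.top _ zero_less_power[OF e]]
      show ?thesis by simp
    qed
    finally show ?thesis by blast
  qed
  then have "\<forall>n. norm (?m n) \<le> ?r n" by simp
  moreover have "?r \<longlonglongrightarrow> 0 / \<epsilon>\<^sup>2"
    using e by (intro tendsto_divide lim tendsto_const) auto
  ultimately show "(\<lambda>n. measure (M n) {\<omega> \<in> space (M n). \<epsilon> < cmod (X n \<omega> - c)}) \<longlonglongrightarrow> 0"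
    using Lim_null_comparison[of ?m ?r sequentially] by (simp add: always_eventually)
qed

end

section \<open>Noncrossing pairings and words\<close>

definition crossing :: "'b list \<Rightarrow> bool" where
  "crossing w \<longleftrightarrow> (\<exists>p q r s. p < q \<and> q < r \<and> r < s \<and> s < length w \<and>
     w ! p = w ! r \<and> w ! q = w ! s \<and> w ! p \<noteq> w ! q)"

definition nc_word :: "'b list \<Rightarrow> bool" where
  "nc_word w \<longleftrightarrow> (\<forall>x\<in>set w. count_list w x = 2) \<and> \<not> crossing w"

lemma nc_word_Nil [simp]: "nc_word []"
  by (simp add: nc_word_def crossing_def)

lemma count_list_eq_card: "count_list w x = card {i. i < length w \<and> w ! i = x}"
  by (simp add: count_list_eq_length_filter length_filter_conv_card eq_commute[of x])

text \<open>Nothing fits strictly between the two occurrences of \<open>i\<close>, so neither chord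
  of a crossing can be theirs; all other positions correspond by a shift of two past the deleted
  pair, which preserves order and letters.\<close>

lemma crossing_collapse:
  assumes "i \<notin> set u" "i \<notin> set v"
  shows "crossing (u @ i # i # v) \<longleftrightarrow> crossing (u @ v)"
proof
  let ?n = "length u"
  let ?w = "u @ i # i # v" and ?w' = "u @ v"
  have nth: "?w ! (if k < ?n then k else k + 2) = ?w' ! k" for k
    by (auto simp: nth_append nth_Cons')
  {
    assume "crossing ?w'"
    then obtain p q r s where *: "p < q" "q < r" "r < s" "s < length ?w'"
      "?w' ! p = ?w' ! r" "?w' ! q = ?w' ! s" "?w' ! p \<noteq> ?w' ! q"
      unfolding crossing_def by blast
    define f where "f = (\<lambda>k. if k < ?n then k else k + 2)"
    have f: "f a < f b" if "a < b" for a b using that by (simp add: f_def)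
    have "f s < length ?w" using *(4) by (simp add: f_def)
    then have "f p < f q \<and> f q < f r \<and> f r < f s \<and> f s < length ?w \<and>
      ?w ! f p = ?w ! f r \<and> ?w ! f q = ?w ! f s \<and> ?w ! f p \<noteq> ?w ! f q"
      using f[OF *(1)] f[OF *(2)] f[OF *(3)] *(5-7) unfolding f_def nth by blast
    then show "crossing ?w" unfolding crossing_def by blast
  }
  assume "crossing ?w"
  then obtain p q r s where *: "p < q" "q < r" "r < s" "s < length ?w"
    "?w ! p = ?w ! r" "?w ! q = ?w ! s" "?w ! p \<noteq> ?w ! q"
    unfolding crossing_def by blast
  have i: "k = ?n \<or> k = Suc ?n" if "?w ! k = i" "k < length ?w" for k
  proof (rule ccontr)
    assume ne: "\<not> ?thesis"
    show False
    proof (cases "k < ?n")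
      case True
      then show False using that assms(1) nth_mem[of k u] by (simp add: nth_append)
    next
      case False
      define j where "j = k - ?n - 2"
      have "k = ?n + Suc (Suc j)" using False ne unfolding j_def by linarith
      then show False using that assms(2) nth_mem[of j v] by (simp add: nth_append)
    qed
  qed
  have wn: "?w ! ?n = i" "?w ! Suc ?n = i" by (auto simp: nth_append)
  have iff: "k = ?n \<or> k = Suc ?n \<longleftrightarrow> ?w ! k = i" if "k < length ?w" for k
    using i[OF _ that] wn by auto
  \<comment> \<open>The ends of a chord carry equal letters and \<open>i\<close> occurs only at
    these two neighbouring places, so both ends of a chord lie there or neither does; the first is
    excluded since another position separates them.\<close>
  have "p = ?n \<or> p = Suc ?n \<longleftrightarrow> r = ?n \<or> r = Suc ?n" "q = ?n \<or> q = Suc ?n \<longleftrightarrow> s = ?n \<or> s = Suc ?n"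
  proof -
    have "p < length ?w" "q < length ?w" "r < length ?w" using *(1-4) by linarith+
    note iff = iff[OF this(1)] iff[OF this(2)] iff[OF this(3)] iff[OF *(4)]
    show "p = ?n \<or> p = Suc ?n \<longleftrightarrow> r = ?n \<or> r = Suc ?n" "q = ?n \<or> q = Suc ?n \<longleftrightarrow> s = ?n \<or> s = Suc ?n"
      unfolding iff *(5,6) by (rule refl)+
  qed
  then have ne: "p \<noteq> ?n" "p \<noteq> Suc ?n" "q \<noteq> ?n" "q \<noteq> Suc ?n" "r \<noteq> ?n" "r \<noteq> Suc ?n" "s \<noteq> ?n" "s \<noteq> Suc ?n"
    using *(1-3) by linarith+
  define g where "g = (\<lambda>k. if k < ?n then k else k - 2)"
  have g: "?w' ! g k = ?w ! k" if "k \<noteq> ?n" "k \<noteq> Suc ?n" for k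
  proof (cases "k < ?n")
    case False
    then have "Suc (Suc (k - 2)) = k" "\<not> k - 2 < ?n" using that by auto
    then show ?thesis using nth[of "g k"] False by (simp add: g_def)
  qed (use nth[of k] in \<open>simp add: g_def\<close>)
  have mono: "g a < g b" if "a < b" "a \<noteq> ?n" "a \<noteq> Suc ?n" "b \<noteq> ?n" "b \<noteq> Suc ?n" for a b
    using that by (auto simp: g_def)
  have "g p < g q \<and> g q < g r \<and> g r < g s \<and> g s < length ?w' \<and>
      ?w' ! g p = ?w' ! g r \<and> ?w' ! g q = ?w' ! g s \<and> ?w' ! g p \<noteq> ?w' ! g q"
  proof (intro conjI)
    show "g p < g q" "g q < g r" "g r < g s" using mono *(1-3) ne by blast+
    have "s < ?n + length v + 2" using *(4) by simp
    then show "g s < length ?w'" using ne(7,8) unfolding g_def length_append by (cases "s < ?n") auto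
    show "?w' ! g p = ?w' ! g r" "?w' ! g q = ?w' ! g s" "?w' ! g p \<noteq> ?w' ! g q"
      unfolding g[OF ne(1,2)] g[OF ne(3,4)] g[OF ne(5,6)] g[OF ne(7,8)] by (fact *)+
  qed
  then show "crossing ?w'" unfolding crossing_def by blast
qed

lemma nc_word_collapse:
  assumes "i \<notin> set u" "i \<notin> set v"
  shows "nc_word (u @ i # i # v) \<longleftrightarrow> nc_word (u @ v)"
proof -
  have "(\<forall>x\<in>set (u @ i # i # v). count_list (u @ i # i # v) x = 2) \<longleftrightarrow>
        (\<forall>x\<in>set (u @ v). count_list (u @ v) x = 2)"
  proof -
    have i: "count_list u i = 0" "count_list v i = 0" using assms by simp_all
    have ci: "count_list (u @ i # i # v) i = 2" using i by simp
    have cx: "count_list (u @ i # i # v) x = count_list (u @ v) x" if "x \<noteq> i" for x using that by simp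
    have ne: "x \<noteq> i" if "x \<in> set (u @ v)" for x using assms that by auto
    have set: "set (u @ i # i # v) = insert i (set (u @ v))" by auto
    show ?thesis
    proof (intro iffI ballI)
      fix x assume "\<forall>x\<in>set (u @ i # i # v). count_list (u @ i # i # v) x = 2" "x \<in> set (u @ v)"
      then show "count_list (u @ v) x = 2" using cx[OF ne, of x] unfolding set by (metis insertCI)
    next
      fix x assume a: "\<forall>x\<in>set (u @ v). count_list (u @ v) x = 2" "x \<in> set (u @ i # i # v)"
      show "count_list (u @ i # i # v) x = 2"
      proof (cases "x = i")
        case False
        then have "x \<in> set (u @ v)" using a(2) unfolding set by blast
        then show ?thesis using a(1) cx[OF False] by metis
      qed (simp only: ci)
    qed
  qed
  then show ?thesis unfolding nc_word_def crossing_collapse[OF assms] by (rule conj_cong) (rule refl)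
qed

text \<open>An innermost pair of equal letters of a noncrossing word consists of neighbours.\<close>

lemma not_nc_word_if_no_neighbours:
  assumes "w \<noteq> []" and adj: "\<And>j. Suc j < length w \<Longrightarrow> w ! j \<noteq> w ! Suc j"
  shows "\<not> nc_word w"
proof
  assume nc: "nc_word w"
  define P where "P = (\<lambda>d. \<exists>i. i + d < length w \<and> 0 < d \<and> w ! i = w ! (i + d))"
  have two: "\<exists>k. k \<noteq> i \<and> k < length w \<and> w ! k = w ! i" if "i < length w" for i
  proof -
    have "card {k. k < length w \<and> w ! k = w ! i} = 2"
      unfolding count_list_eq_card[symmetric] using nc that nth_mem[OF that] unfolding nc_word_def by blast
    then obtain x y where xy: "{k. k < length w \<and> w ! k = w ! i} = {x, y}" "x \<noteq> y"
      unfolding card_2_iff by blast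
    then have "x < length w \<and> w ! x = w ! i" "y < length w \<and> w ! y = w ! i" by blast+
    then show ?thesis using xy(2) by metis
  qed
  have "\<exists>d. P d"
  proof -
    have "0 < length w" using assms(1) by simp
    from two[OF this] obtain k where "k \<noteq> 0" "k < length w" "w ! k = w ! 0" by blast
    then show ?thesis unfolding P_def by (intro exI[of _ k] exI[of _ 0]) simp
  qed
  then have "P (LEAST d. P d)" by (rule LeastI_ex)
  moreover define d where "d = (LEAST d. P d)"
  ultimately obtain i where i: "i + d < length w" "0 < d" "w ! i = w ! (i + d)" unfolding P_def by blast
  have least: "d \<le> e" if "P e" for e using that unfolding d_def by (rule Least_le)
  have "d \<noteq> 1" using i(1,3) adj[of i] by auto
  then have d1: "1 < d" using i(2) by linarith
  let ?b = "w ! Suc i"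
  have nb: "?b \<noteq> w ! i" using adj[of i] i(1) d1 by simp
  have "Suc i < length w" using i(1) d1 by linarith
  from two[OF this] obtain k where k: "k \<noteq> Suc i" "k < length w" "w ! k = ?b" by blast
  \<comment> \<open>The partner \<open>k\<close> of position \<open>Suc i\<close>: beyond either end
    it crosses the pair at distance \<open>d\<close>, at an end it repeats the letter of that pair,
    and inside it gives equal letters closer than the minimal \<open>d\<close>.\<close>
  consider "k < i" | "k = i" | "Suc i < k" "k < i + d" | "k = i + d" | "i + d < k" using k(1) by linarith
  then show False
  proof cases
    case 1
    then have "k < i \<and> i < Suc i \<and> Suc i < i + d \<and> i + d < length w \<and>
        w ! k = w ! Suc i \<and> w ! i = w ! (i + d) \<and> w ! k \<noteq> w ! i"
      using i(1) d1 k(3) nb by (intro conjI i(3)) simp_all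
    then have "crossing w" unfolding crossing_def by blast
    then show False using nc by (simp add: nc_word_def)
  next
    case 3
    then have "P (k - Suc i)" unfolding P_def using k(2,3) by (intro exI[of _ "Suc i"]) simp
    then have "d \<le> k - Suc i" by (rule least)
    then show False using 3 by linarith
  next
    case 5
    then have "i < Suc i \<and> Suc i < i + d \<and> i + d < k \<and> k < length w \<and>
        w ! i = w ! (i + d) \<and> w ! Suc i = w ! k \<and> w ! i \<noteq> w ! Suc i"
      using d1 k(2,3) nb by (intro conjI i(3)) simp_all
    then have "crossing w" unfolding crossing_def by blast
    then show False using nc by (simp add: nc_word_def)
  next
    case 2
    then show False using k(3) nb by simp
  next
    case 4
    then show False using k(3) nb i(3) by simp
  qed
qed

section \<open>Pairings compatible with a word; blocks live in \<open>{1..p}\<close>, list positions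
  start at 0\<close>

definition blockwise_const :: "nat set set \<Rightarrow> 'b list \<Rightarrow> bool" where
  "blockwise_const P w \<longleftrightarrow> (\<forall>B\<in>P. \<forall>i\<in>B. \<forall>j\<in>B. w ! (i - 1) = w ! (j - 1))"

text \<open>With a letter occurring more than twice several pairings may be compatible, so this is a
  count and not an indicator. Counting all of them makes the sum over words exact.\<close>

definition nc_count :: "'b list \<Rightarrow> nat" where
  "nc_count w = card {P \<in> NC2 (length w). blockwise_const P w}"

lemma finite_NC2: "finite (NC2 p)"
  by (rule finite_subset[of _ "Pow (Pow {1..p})"]) (auto simp: NC2_def partition_on_def)

lemma NC2_memD:
  assumes "P \<in> NC2 p" "B \<in> P"
  shows "card B = 2" "B \<subseteq> {1..p}" "finite B"
proof -
  show "card B = 2" "B \<subseteq> {1..p}" using assms by (auto simp: NC2_def partition_on_def)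
  then show "finite B" using finite_subset by blast
qed

definition fibre :: "'b list \<Rightarrow> 'b \<Rightarrow> nat set" where
  "fibre w x = {i \<in> {1..length w}. w ! (i - 1) = x}"

lemma card_fibre: "card (fibre w x) = count_list w x"
proof -
  have "fibre w x = Suc ` {i. i < length w \<and> w ! i = x}"
  proof (rule set_eqI)
    fix i
    show "i \<in> fibre w x \<longleftrightarrow> i \<in> Suc ` {i. i < length w \<and> w ! i = x}"
      by (cases i) (auto simp: fibre_def)
  qed
  then show ?thesis by (simp add: count_list_eq_card card_image)
qed

lemma finite_fibre [simp]: "finite (fibre w x)"
  by (simp add: fibre_def)

lemma blockwise_const_subset_fibre:
  assumes "P \<in> NC2 (length w)" "blockwise_const P w" "B \<in> P" "i \<in> B"
  shows "B \<subseteq> fibre w (w ! (i - 1))"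
proof
  fix x assume x: "x \<in> B"
  then have "w ! (x - 1) = w ! (i - 1)" using assms unfolding blockwise_const_def by blast
  then show "x \<in> fibre w (w ! (i - 1))" using NC2_memD(2)[OF assms(1,3)] x unfolding fibre_def by blast
qed

text \<open>A compatible pairing would place the position of \<open>x\<close> in a two-element block
  inside the one-element fibre of \<open>x\<close>.\<close>

lemma nc_count_eq_0_if_single:
  assumes "x \<in> set w" "count_list w x = 1"
  shows "nc_count w = 0"
proof -
  have "\<not> blockwise_const P w" if P: "P \<in> NC2 (length w)" for P
  proof
    assume c: "blockwise_const P w"
    from assms(1) obtain k where k: "k < length w" "w ! k = x" by (auto simp: in_set_conv_nth)
    have "\<Union>P = {1..length w}" using P by (simp add: NC2_def partition_on_def)
    then obtain B where B: "B \<in> P" "Suc k \<in> B" using k by (metis UnionE Suc_leI atLeastAtMost_iff le_add1 plus_1_eq_Suc)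
    have "card B \<le> card (fibre w x)"
      using blockwise_const_subset_fibre[OF P c B] k by (intro card_mono) auto
    then show False using NC2_memD[OF P B(1)] assms(2) by (simp add: card_fibre)
  qed
  then have "{P \<in> NC2 (length w). blockwise_const P w} = {}" by blast
  then show ?thesis by (simp only: nc_count_def card.empty)
qed

text \<open>A compatible block has two elements and lies in a fibre with at most two, hence equals
  it. The only candidate is the partition into fibres, which is a noncrossing pairing precisely when
  the word is.\<close>

lemma nc_count_eq_nc_word:
  assumes le2: "\<And>x. count_list w x \<le> 2"
  shows "nc_count w = (if nc_word w then 1 else 0)"
proof -
  let ?F = "fibre w ` set w"
  have unique: "P = ?F \<and> nc_word w" if P: "P \<in> NC2 (length w)" and c: "blockwise_const P w" for P
  proof -
    have part: "partition_on {1..length w} P" using P by (simp add: NC2_def)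
    have eq: "B = fibre w (w ! (i - 1)) \<and> count_list w (w ! (i - 1)) = 2" if "B \<in> P" "i \<in> B" for B i
    proof -
      have sub: "B \<subseteq> fibre w (w ! (i - 1))" by (rule blockwise_const_subset_fibre[OF P c that])
      have "card (fibre w (w ! (i - 1))) \<le> card B" using le2 NC2_memD[OF P that(1)] by (simp add: card_fibre)
      then have "B = fibre w (w ! (i - 1))" using sub by (intro card_seteq) auto
      then show ?thesis using NC2_memD[OF P that(1)] card_fibre[of w "w ! (i - 1)"] by simp
    qed
    have cover: "\<exists>B\<in>P. Suc k \<in> B" if "k < length w" for k
    proof -
      have "Suc k \<in> \<Union>P" using part that by (simp add: partition_on_def)
      then show ?thesis by blast
    qed
    have in_P: "fibre w (w ! k) \<in> P \<and> count_list w (w ! k) = 2" if "k < length w" for k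
    proof -
      from cover[OF that] obtain B where B: "B \<in> P" "Suc k \<in> B" by blast
      from eq[OF this] show ?thesis using B(1) by simp
    qed
    have "P \<subseteq> ?F"
    proof
      fix B assume B: "B \<in> P"
      have "B \<noteq> {}" using NC2_memD(1)[OF P B] by force
      then obtain i where i: "i \<in> B" by blast
      then have "1 \<le> i" "i \<le> length w" using NC2_memD(2)[OF P B] by auto
      then have "w ! (i - 1) \<in> set w" by (intro nth_mem) linarith
      then show "B \<in> ?F" using eq[OF B i] by blast
    qed
    moreover have in_P': "fibre w x \<in> P" "count_list w x = 2" if x: "x \<in> set w" for x
    proof -
      obtain k where "k < length w" "w ! k = x" using x unfolding in_set_conv_nth by blast
      then show "fibre w x \<in> P" "count_list w x = 2" using in_P[of k] by simp_all
    qed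
    moreover have "?F \<subseteq> P" using in_P'(1) by blast
    moreover have "\<not> crossing w"
    proof
      assume "crossing w"
      then obtain p q r s where *: "p < q" "q < r" "r < s" "s < length w"
        "w ! p = w ! r" "w ! q = w ! s" "w ! p \<noteq> w ! q" unfolding crossing_def by blast
      have pair: "fibre w (w ! a) = {Suc a, Suc b}" if "a < b" "b < length w" "w ! a = w ! b" for a b
      proof (rule sym, rule card_seteq)
        show "{Suc a, Suc b} \<subseteq> fibre w (w ! a)" using that by (auto simp: fibre_def)
        show "card (fibre w (w ! a)) \<le> card {Suc a, Suc b}"
          using that(1) le2[of "w ! a"] unfolding card_fibre by simp
      qed simp
      have "{Suc p, Suc r} \<in> P" "{Suc q, Suc s} \<in> P"
      proof -
        have lt: "p < r" "q < s" "r < length w" "p < length w" "q < length w" using *(1-4) by linarith+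
        show "{Suc p, Suc r} \<in> P" using in_P[OF lt(4)] pair[OF lt(1,3) *(5)] by simp
        show "{Suc q, Suc s} \<in> P" using in_P[OF lt(5)] pair[OF lt(2) *(4) *(6)] by simp
      qed
      moreover have "Suc p < Suc q" "Suc q < Suc r" "Suc r < Suc s" using *(1-3) by simp_all
      ultimately show False using P unfolding NC2_def by blast
    qed
    ultimately show ?thesis unfolding nc_word_def by blast
  qed
  have exist: "?F \<in> NC2 (length w) \<and> blockwise_const ?F w" if nc: "nc_word w"
  proof -
    have un: "\<Union>?F = {1..length w}"
    proof (intro equalityI subsetI)
      fix i assume i: "i \<in> {1..length w}"
      then have "w ! (i - 1) \<in> set w" by (intro nth_mem) auto
      moreover have "i \<in> fibre w (w ! (i - 1))" using i by (simp add: fibre_def)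
      ultimately show "i \<in> \<Union>?F" by blast
    qed (auto simp: fibre_def)
    have dj: "disjoint ?F" by (auto simp: disjoint_def fibre_def)
    have card2: "card B = 2" if "B \<in> ?F" for B using that nc by (auto simp: card_fibre nc_word_def)
    have em: "{} \<notin> ?F" using card2[of "{}"] by auto
    have noX: False if "B1 \<in> ?F" "B2 \<in> ?F" "B1 = {i, j}" "B2 = {k, l}" "i < k" "k < j" "j < l" for B1 B2 i j k l
    proof -
      have ij: "{i, j} \<in> ?F" "{k, l} \<in> ?F" using that(1,2) unfolding that(3,4) by blast+
      have a: "w ! (i - 1) = w ! (j - 1)" "w ! (k - 1) = w ! (l - 1)" "1 \<le> i" "l \<le> length w"
      proof -
        obtain x y where x: "{i, j} = fibre w x" and y: "{k, l} = fibre w y" using ij by auto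
        have "i \<in> fibre w x" "j \<in> fibre w x" "k \<in> fibre w y" "l \<in> fibre w y" using x y by blast+
        then show "w ! (i - 1) = w ! (j - 1)" "w ! (k - 1) = w ! (l - 1)" "1 \<le> i" "l \<le> length w"
          by (simp_all add: fibre_def)
      qed
      have b: "w ! (i - 1) \<noteq> w ! (k - 1)"
      proof
        assume eq: "w ! (i - 1) = w ! (k - 1)"
        obtain x where x: "{i, j} = fibre w x" using ij(1) by blast
        have "i \<in> fibre w x" using x by blast
        moreover have "k \<in> {1..length w}" using a(3,4) that(5-7) by simp
        ultimately have "k \<in> fibre w x" using eq unfolding fibre_def by simp
        then have "k \<in> {i, j}" using x by blast
        then show False using that(5-7) by auto
      qed
      have "i - 1 < k - 1 \<and> k - 1 < j - 1 \<and> j - 1 < l - 1 \<and> l - 1 < length w" using a(3,4) that(5-7) by linarith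
      with a(1,2) b have "crossing w" unfolding crossing_def by blast
      then show False using nc by (simp add: nc_word_def)
    qed
    have bc: "blockwise_const ?F w"
      unfolding blockwise_const_def
    proof (intro ballI)
      fix B i j assume "B \<in> ?F" "i \<in> B" "j \<in> B"
      then obtain x where "i \<in> fibre w x" "j \<in> fibre w x" by blast
      then show "w ! (i - 1) = w ! (j - 1)" unfolding fibre_def by simp
    qed
    have "\<forall>B1\<in>?F. \<forall>B2\<in>?F. \<not> (\<exists>i j k l. B1 = {i, j} \<and> B2 = {k, l} \<and> i < k \<and> k < j \<and> j < l)"
      by (intro ballI notI) (elim exE conjE, rule noX)
    moreover have "\<forall>B\<in>?F. card B = 2" using card2 by (intro ballI)
    ultimately show ?thesis
      unfolding NC2_def partition_on_def mem_Collect_eq using un dj em bc by (intro conjI) assumption+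
  qed
  show ?thesis
  proof (cases "nc_word w")
    case True
    then have "{P \<in> NC2 (length w). blockwise_const P w} = {?F}" using unique exist by blast
    then show ?thesis using True by (simp add: nc_count_def)
  next
    case False
    then have "{P \<in> NC2 (length w). blockwise_const P w} = {}" using unique by blast
    then show ?thesis using False by (simp only: nc_count_def) simp
  qed
qed

lemma NC2_card_double:
  assumes "P \<in> NC2 p" shows "2 * card P = p"
proof -
  have part: "partition_on {1..p} P" using assms by (simp add: NC2_def)
  then have "card {1..p} = (\<Sum>B\<in>P. card B)"
    using product_partition[OF part] NC2_memD(3)[OF assms] by simp
  also have "\<dots> = (\<Sum>B\<in>P. 2)" using NC2_memD(1)[OF assms] by (intro sum.cong) auto
  finally show ?thesis by simp
qed

text \<open>Such a word amounts to a function from blocks to letters, with \<open>d\<close> free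
  choices per block.\<close>

lemma card_blockwise_const:
  assumes P: "P \<in> NC2 p"
  shows "card {w \<in> words {..<d} p. blockwise_const P w} = d ^ card P"
proof -
  have part: "partition_on {1..p} P" using P by (simp add: NC2_def)
  have finP: "finite P" using part by (meson finite_atLeastAtMost finite_elements)
  define blk where "blk = (\<lambda>i. THE B. B \<in> P \<and> Suc i \<in> B)"
  have blk_eq: "blk i = B" if "B \<in> P" "Suc i \<in> B" for B i
    unfolding blk_def using that part
    by (intro the_equality) (auto simp: partition_on_def disjoint_def pairwise_def disjnt_def)
  have blk: "blk i \<in> P" "Suc i \<in> blk i" if i: "i < p" for i
  proof -
    have "Suc i \<in> \<Union>P" using part i by (simp add: partition_on_def)
    then obtain B where "B \<in> P" "Suc i \<in> B" by blast
    with blk_eq show "blk i \<in> P" "Suc i \<in> blk i" by metis+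
  qed
  define F where "F = (\<lambda>f. map (\<lambda>i. f (blk i) :: nat) [0..<p])"
  \<comment> \<open>The letter of a block is read off at its least element; the shift by one passes
    from positions to list indices.\<close>
  define G where "G = (\<lambda>w. \<lambda>B\<in>P. (w::nat list) ! (Min B - 1))"
  have MinB: "Min B \<in> B" "1 \<le> Min B" "Min B \<le> p" if "B \<in> P" for B
  proof -
    show "Min B \<in> B" using NC2_memD[OF P that] by (intro Min_in) auto
    then show "1 \<le> Min B" "Min B \<le> p" using NC2_memD(2)[OF P that] by auto
  qed
  have "bij_betw F (P \<rightarrow>\<^sub>E {..<d}) {w \<in> words {..<d} p. blockwise_const P w}"
  proof (rule bij_betw_byWitness[where f'=G])
    show "\<forall>f\<in>P \<rightarrow>\<^sub>E {..<d}. G (F f) = f"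
    proof
      fix f assume f: "f \<in> P \<rightarrow>\<^sub>E {..<d}"
      show "G (F f) = f"
      proof (rule PiE_ext[of _ P "\<lambda>_. UNIV"])
        fix B assume B: "B \<in> P"
        have "blk (Min B - 1) = B" using MinB[OF B] B by (intro blk_eq) auto
        moreover have "Min B - 1 < p" using MinB[OF B] by linarith
        ultimately show "G (F f) B = f B" using B by (simp add: G_def F_def)
      qed (use f in \<open>auto simp: G_def\<close>)
    qed
    show "\<forall>w\<in>{w \<in> words {..<d} p. blockwise_const P w}. F (G w) = w"
    proof
      fix w assume w: "w \<in> {w \<in> words {..<d} p. blockwise_const P w}"
      show "F (G w) = w"
      proof (rule nth_equalityI)
        fix i assume "i < length (F (G w))"
        then have i: "i < p" by (simp add: F_def)
        have "w ! (Min (blk i) - 1) = w ! (Suc i - 1)"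
        proof -
          have "blockwise_const P w" using w by blast
          then show ?thesis using blk[OF i] MinB(1)[OF blk(1)[OF i]] unfolding blockwise_const_def by blast
        qed
        then show "F (G w) ! i = w ! i" using i blk[OF i] by (simp add: F_def G_def)
      qed (use w in \<open>auto simp: F_def words_def\<close>)
    qed
    show "F ` (P \<rightarrow>\<^sub>E {..<d}) \<subseteq> {w \<in> words {..<d} p. blockwise_const P w}"
    proof safe
      fix f assume f: "f \<in> P \<rightarrow>\<^sub>E {..<d}"
      show "F f \<in> words {..<d} p" using f blk(1) by (auto simp: F_def words_def PiE_iff)
      show "blockwise_const P (F f)"
        unfolding blockwise_const_def
      proof (intro ballI)
        fix B i j assume B: "B \<in> P" "i \<in> B" "j \<in> B"
        have v: "F f ! (k - 1) = f B" if "k \<in> B" for k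
        proof -
          have k: "1 \<le> k" "k \<le> p" using NC2_memD(2)[OF P B(1)] that by auto
          then have "Suc (k - 1) \<in> B" using that by simp
          from blk_eq[OF B(1) this] have "blk (k - 1) = B" .
          moreover have "k - 1 < p" using k by linarith
          ultimately show ?thesis by (simp add: F_def)
        qed
        show "F f ! (i - 1) = F f ! (j - 1)" unfolding v[OF B(2)] v[OF B(3)] ..
      qed
    qed
    show "G ` {w \<in> words {..<d} p. blockwise_const P w} \<subseteq> P \<rightarrow>\<^sub>E {..<d}"
    proof (rule image_subsetI)
      fix w assume "w \<in> {w \<in> words {..<d} p. blockwise_const P w}"
      then have w: "w \<in> words {..<d} p" by blast
      have "w ! (Min B - 1) < d" if "B \<in> P" for B
      proof -
        have "Min B - 1 < length w" using MinB(2,3)[OF that] w unfolding words_def mem_Collect_eq by linarith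
        then have "w ! (Min B - 1) \<in> {..<d}" using w nth_mem unfolding words_def by blast
        then show ?thesis by simp
      qed
      then show "G w \<in> P \<rightarrow>\<^sub>E {..<d}" by (auto simp: G_def)
    qed
  qed
  then have "card {w \<in> words {..<d} p. blockwise_const P w} = card (P \<rightarrow>\<^sub>E {..<d})" by (simp add: bij_betw_same_card)
  then show ?thesis by (simp add: card_PiE[OF finP])
qed

text \<open>Double counting of words together with a compatible pairing: each pairing has
  \<open>p / 2\<close> blocks and contributes \<open>d\<close> to the power \<open>p / 2\<close>,
  which the scaling cancels exactly. For odd \<open>p\<close> both sides are zero.\<close>

lemma sum_nc_count:
  assumes "0 < d"
  shows "(\<Sum>w\<in>words {..<d} p. real (nc_count w)) * (1 / sqrt (real d)) ^ p = real (card (NC2 p))"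
proof -
  have "(\<Sum>w\<in>words {..<d} p. nc_count w) = (\<Sum>w\<in>words {..<d} p. \<Sum>P\<in>NC2 p. if blockwise_const P w then 1 else 0)"
    by (intro sum.cong) (auto simp: nc_count_def words_def finite_NC2 sum.If_cases Int_def)
  also have "\<dots> = (\<Sum>P\<in>NC2 p. \<Sum>w\<in>words {..<d} p. if blockwise_const P w then 1 else 0)" by (rule sum.swap)
  also have "\<dots> = (\<Sum>P\<in>NC2 p. d ^ card P)"
    by (intro sum.cong refl) (simp add: card_blockwise_const[symmetric] sum.If_cases Int_def)
  finally have *: "(\<Sum>w\<in>words {..<d} p. real (nc_count w)) = (\<Sum>P\<in>NC2 p. real d ^ card P)"
    by (simp flip: of_nat_sum of_nat_power)
  have "real d ^ card P * (1 / sqrt (real d)) ^ p = 1" if "P \<in> NC2 p" for P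
  proof -
    have "(1 / sqrt (real d)) ^ p = ((1 / sqrt (real d))\<^sup>2) ^ card P"
      using NC2_card_double[OF that] by (metis power_mult)
    also have "(1 / sqrt (real d))\<^sup>2 = 1 / real d" by (simp add: power_divide)
    finally show ?thesis using assms by (simp add: power_divide)
  qed
  then show ?thesis unfolding * sum_distrib_right by simp
qed

text \<open>Each letter becomes the position of its first occurrence. Words with the same equalities
  between positions share this normal form, whose alphabet does not grow with
  \<open>d\<close>.\<close>

definition canon :: "'b list \<Rightarrow> nat list" where
  "canon l = map (\<lambda>x. LEAST j. j < length l \<and> l ! j = x) l"

lemma canon_props:
  shows "map ((!) l) (canon l) = l" "canon l \<in> words {..<length l} (length l)" "inj_on ((!) l) (set (canon l))"
    "\<And>j. j \<in> set (canon l) \<Longrightarrow> l ! j \<in> set l"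
proof -
  let ?idx = "\<lambda>x. LEAST j. j < length l \<and> l ! j = x"
  have idx: "?idx x < length l \<and> l ! ?idx x = x" if "x \<in> set l" for x
    using that by (intro LeastI_ex[of "\<lambda>j. j < length l \<and> l ! j = x"]) (auto simp: in_set_conv_nth)
  show "map ((!) l) (canon l) = l" using idx by (auto simp: canon_def o_def intro: map_idI)
  show "canon l \<in> words {..<length l} (length l)" using idx by (auto simp: canon_def words_def)
  show "inj_on ((!) l) (set (canon l))" using idx by (auto simp: canon_def inj_on_def)
  show "l ! j \<in> set l" if "j \<in> set (canon l)" for j using idx that by (auto simp: canon_def)
qed

text \<open>A word with pattern \<open>c\<close> is recovered from the letters assigned to the
  elements of \<open>set c\<close>.\<close>

lemma card_canon_class_le: "card {l \<in> words {..<d} m. canon l = c} \<le> d ^ card (set c)"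
proof -
  have "{l \<in> words {..<d} m. canon l = c} \<subseteq> (\<lambda>f. map f c) ` (set c \<rightarrow>\<^sub>E {..<d})"
  proof safe
    fix l assume l: "l \<in> words {..<d} m" "c = canon l"
    have "l = map (restrict ((!) l) (set (canon l))) (canon l)"
      using canon_props(1)[of l] by (simp cong: map_cong)
    moreover have "restrict ((!) l) (set (canon l)) \<in> set (canon l) \<rightarrow>\<^sub>E {..<d}"
      using canon_props(4)[of _ l] l by (auto simp: words_def)
    ultimately show "l \<in> (\<lambda>f. map f (canon l)) ` (set (canon l) \<rightarrow>\<^sub>E {..<d})" by blast
  qed
  then have "card {l \<in> words {..<d} m. canon l = c} \<le> card ((\<lambda>f. map f c) ` (set c \<rightarrow>\<^sub>E {..<d}))"
    by (intro card_mono finite_imageI finite_PiE) auto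
  also have "\<dots> \<le> card (set c \<rightarrow>\<^sub>E {..<d})" by (intro card_image_le finite_PiE) auto
  finally show ?thesis by (simp add: card_PiE)
qed

text \<open>As the bound sees the pattern alone, a sum over a growing set of words turns into one
  over a fixed set of patterns, each weighted by a bound on the number of its words.\<close>

lemma norm_sum_words_le:
  fixes F :: "nat list \<Rightarrow> complex"
  assumes "\<And>l. l \<in> words {..<d} m \<Longrightarrow> norm (F l) \<le> K (canon l)" "\<And>c. 0 \<le> K c"
  shows "norm (\<Sum>l\<in>words {..<d} m. F l) \<le> (\<Sum>c\<in>words {..<m} m. real d ^ card (set c) * K c)"
proof -
  have "norm (\<Sum>l\<in>words {..<d} m. F l) \<le> (\<Sum>l\<in>words {..<d} m. K (canon l))"
    using assms(1) by (rule sum_norm_le)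
  also have "\<dots> = (\<Sum>c\<in>words {..<m} m. \<Sum>l | l \<in> words {..<d} m \<and> canon l = c. K (canon l))"
  proof (rule sum.group[symmetric])
    show "canon ` words {..<d} m \<subseteq> words {..<m} m"
      using canon_props(2) unfolding words_def by fastforce
  qed simp_all
  also have "\<dots> = (\<Sum>c\<in>words {..<m} m. real (card {l \<in> words {..<d} m. canon l = c}) * K c)"
    by (intro sum.cong refl) simp
  also have "\<dots> \<le> (\<Sum>c\<in>words {..<m} m. real d ^ card (set c) * K c)"
    using assms(2) card_canon_class_le by (intro sum_mono mult_right_mono) (auto simp flip: of_nat_power)
  finally show ?thesis .
qed

text \<open>Without single letters a word of length \<open>m\<close> has at most
  \<open>m / 2\<close> distinct letters, and exactly \<open>m / 2\<close> only as a pairing; these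
  are the patterns that survive division by \<open>d\<close> to the power
  \<open>m / 2\<close>.\<close>

lemma length_ge_twice_card:
  assumes "\<And>x. x \<in> set c \<Longrightarrow> count_list c x \<noteq> 1"
  shows "2 * card (set c) \<le> length c"
    and "2 * card (set c) = length c \<Longrightarrow> x \<in> set c \<Longrightarrow> count_list c x = 2"
proof -
  have ge: "2 \<le> count_list c x" if "x \<in> set c" for x
  proof -
    have "count_list c x \<noteq> 0" "count_list c x \<noteq> 1" using that assms[OF that] count_list_0_iff[of c x] by auto
    then show ?thesis by linarith
  qed
  have len: "(\<Sum>x\<in>set c. count_list c x) = length c" by (rule sum_count_set) auto
  have "(\<Sum>x\<in>set c. 2) \<le> (\<Sum>x\<in>set c. count_list c x)" using ge by (intro sum_mono)
  then show "2 * card (set c) \<le> length c" by (simp add: len)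
  assume eq: "2 * card (set c) = length c" and x: "x \<in> set c"
  have "(\<Sum>x\<in>set c. count_list c x - 2) = (\<Sum>x\<in>set c. count_list c x) - (\<Sum>x\<in>set c. 2)"
    using ge by (intro sum_subtractf_nat) auto
  also have "\<dots> = 0" using eq len by simp
  finally have "count_list c x - 2 = 0" using x by simp
  then show "count_list c x = 2" using ge[OF x] by simp
qed

lemma blockwise_const_map_inj:
  assumes "inj_on f (set c)" "P \<in> NC2 (length c)"
  shows "blockwise_const P (map f c) \<longleftrightarrow> blockwise_const P c"
proof -
  have "i - 1 < length c" if "B \<in> P" "i \<in> B" for B i
    using NC2_memD(2)[OF assms(2) that(1)] that(2) by fastforce
  then have "map f c ! (i - 1) = map f c ! (j - 1) \<longleftrightarrow> c ! (i - 1) = c ! (j - 1)"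
    if "B \<in> P" "i \<in> B" "j \<in> B" for B i j
    using that inj_on_eq_iff[OF assms(1)] by simp
  then show ?thesis unfolding blockwise_const_def by blast
qed

lemma nc_count_map_inj: "inj_on f (set c) \<Longrightarrow> nc_count (map f c) = nc_count c"
  unfolding nc_count_def by (intro arg_cong[where f=card]) (auto simp: blockwise_const_map_inj)

section \<open>Moments of the semicircle law\<close>

text \<open>Noncrossing and the absence of unmatched points under an arc in one condition: any block
  with a point strictly below an arc is a pair lying entirely below it.\<close>

definition nested :: "nat set set \<Rightarrow> bool" where
  "nested P \<longleftrightarrow> (\<forall>B\<in>P. \<forall>i\<in>B. \<forall>j\<in>B. \<forall>C\<in>P. \<forall>k\<in>C. i < k \<and> k < j \<longrightarrow> card C = 2 \<and> (\<forall>l\<in>C. i < l \<and> l < j))"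

lemma nestedD:
  assumes "nested P" "B \<in> P" "i \<in> B" "j \<in> B" "C \<in> P" "k \<in> C" "i < k" "k < j"
  shows "card C = 2" "l \<in> C \<Longrightarrow> i < l \<and> l < j"
  using assms unfolding nested_def by blast+

text \<open>Noncrossing partial pairings of \<open>{1..m}\<close> with \<open>h\<close> unmatched points, none of which lies below an arc:
  a noncrossing pairing read from left to right after \<open>m\<close> steps, with \<open>h\<close> arcs still open.\<close>

definition open_pairings :: "nat \<Rightarrow> nat \<Rightarrow> nat set set set" where
  "open_pairings m h = {P. partition_on {1..m} P \<and> (\<forall>B\<in>P. card B = 1 \<or> card B = 2) \<and> nested P \<and>
     card {B \<in> P. card B = 1} = h}"

text \<open>Nonnegative lattice paths of length \<open>m\<close> from 0 to \<open>h\<close>, split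
  by the last step: a step up opens an arc, a step down closes one.\<close>

fun walks :: "nat \<Rightarrow> nat \<Rightarrow> nat" where
  "walks 0 h = (if h = 0 then 1 else 0)"
| "walks (Suc m) h = (if h = 0 then 0 else walks m (h - 1)) + walks m (Suc h)"

lemma open_pairings_subset: "open_pairings m h \<subseteq> Pow (Pow {1..m})"
  by (auto simp: open_pairings_def partition_on_def)

lemma finite_open_pairings: "finite (open_pairings m h)"
  by (rule finite_subset[OF open_pairings_subset]) simp

lemma partition_on_block_unique:
  "partition_on A P \<Longrightarrow> B \<in> P \<Longrightarrow> C \<in> P \<Longrightarrow> x \<in> B \<Longrightarrow> x \<in> C \<Longrightarrow> B = C"
  unfolding partition_on_def disjoint_def by blast

lemma partition_on_atLeastAtMost_mem:
  assumes "partition_on {a..b} P" "B \<in> P" "i \<in> B" shows "a \<le> i \<and> i \<le> b"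
proof -
  have "i \<in> {a..b}" using assms partition_onD1[OF assms(1)] by blast
  then show ?thesis by simp
qed

lemma open_pairings_0: "open_pairings 0 h = (if h = 0 then {{}} else {})"
proof -
  have e: "partition_on {1..0} P \<longleftrightarrow> P = {}" for P :: "nat set set"
    using partition_on_empty[of P] by simp
  show ?thesis unfolding open_pairings_def e by (auto simp: nested_def)
qed

lemma finite_open_pairing:
  assumes "P \<in> open_pairings m h" shows "finite P"
proof (rule finite_elements)
  show "partition_on {1..m} P" using assms unfolding open_pairings_def by blast
qed simp

lemma open_pairings_add_singleton:
  assumes P: "P \<in> open_pairings m h"
  shows "insert {Suc m} P \<in> open_pairings (Suc m) (Suc h)" "{Suc m} \<notin> P"
proof -
  have part: "partition_on {1..m} P" and sz: "\<And>B. B \<in> P \<Longrightarrow> card B = 1 \<or> card B = 2" and nest: "nested P"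
    and h: "card {B \<in> P. card B = 1} = h"
    using P unfolding open_pairings_def by blast+
  have le: "i \<le> m" if "B \<in> P" "i \<in> B" for B i using partition_on_atLeastAtMost_mem[OF part that] by blast
  show notin: "{Suc m} \<notin> P" using le[of "{Suc m}" "Suc m"] by auto
  have "partition_on {1..Suc m} (insert {Suc m} P)"
  proof (rule partition_on_insert[THEN iffD2])
    show "disjnt {Suc m} (\<Union>P)" using le[of _ "Suc m"] by (auto simp: disjnt_def)
    have "{1..Suc m} - {Suc m} = {1..m}" by auto
    then show "partition_on ({1..Suc m} - {Suc m}) P \<and> {Suc m} \<subseteq> {1..Suc m} \<and> {Suc m} \<noteq> {}" using part by simp
  qed
  moreover have "nested (insert {Suc m} P)"
    unfolding nested_def
  proof (intro ballI impI)
    fix B i j C k assume *: "B \<in> insert {Suc m} P" "i \<in> B" "j \<in> B" "C \<in> insert {Suc m} P" "k \<in> C" "i < k \<and> k < j"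
    have "B \<noteq> {Suc m}" using * by auto
    then have B: "B \<in> P" using * by blast
    then have "j \<le> m" using le * by blast
    then have "C \<noteq> {Suc m}" using * by auto
    then have C: "C \<in> P" using * by blast
    show "card C = 2 \<and> (\<forall>l\<in>C. i < l \<and> l < j)"
      using nestedD[OF nest B *(2,3) C *(5)] *(6) by blast
  qed
  moreover have "card {B \<in> insert {Suc m} P. card B = 1} = Suc h"
  proof -
    have "{B \<in> insert {Suc m} P. card B = 1} = insert {Suc m} {B \<in> P. card B = 1}" by auto
    then show ?thesis using notin h finite_open_pairing[OF P] by simp
  qed
  ultimately show "insert {Suc m} P \<in> open_pairings (Suc m) (Suc h)"
    using sz unfolding open_pairings_def by auto
qed

lemma open_pairings_del_singleton:
  assumes P: "P \<in> open_pairings (Suc m) h" and mem: "{Suc m} \<in> P"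
  shows "0 < h" "P - {{Suc m}} \<in> open_pairings m (h - 1)"
proof -
  have part: "partition_on {1..Suc m} P" and sz: "\<And>B. B \<in> P \<Longrightarrow> card B = 1 \<or> card B = 2" and nest: "nested P"
    and h: "card {B \<in> P. card B = 1} = h"
    using P unfolding open_pairings_def by blast+
  let ?Q = "P - {{Suc m}}"
  have fin: "finite P" by (rule finite_open_pairing[OF P])
  have eq: "{B \<in> P. card B = 1} = insert {Suc m} {B \<in> ?Q. card B = 1}" using mem by auto
  have cQ: "card {B \<in> P. card B = 1} = Suc (card {B \<in> ?Q. card B = 1})"
    unfolding eq using fin by (intro card_insert_disjoint) auto
  then show "0 < h" using h by simp
  have disj: "disjnt {Suc m} (\<Union>?Q)"
    using partition_on_block_unique[OF part mem] unfolding disjnt_def by blast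
  have "partition_on {1..Suc m} (insert {Suc m} ?Q)" using part mem by (simp add: insert_absorb)
  then have "partition_on ({1..Suc m} - {Suc m}) ?Q" unfolding partition_on_insert[OF disj] by blast
  moreover have "{1..Suc m} - {Suc m} = {1..m}" by auto
  ultimately have "partition_on {1..m} ?Q" by simp
  moreover have "nested ?Q" using nest unfolding nested_def by blast
  moreover have "\<forall>B\<in>?Q. card B = 1 \<or> card B = 2" using sz by blast
  moreover have "card {B \<in> ?Q. card B = 1} = h - 1" using cQ h by simp
  ultimately show "?Q \<in> open_pairings m (h - 1)" unfolding open_pairings_def by blast
qed

text \<open>The only admissible partner for a closing point: an earlier open point would leave this
  one unmatched below the new arc.\<close>

definition last_open :: "nat set set \<Rightarrow> nat" where
  "last_open P = Max {i. {i} \<in> P}"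

definition close_last :: "nat \<Rightarrow> nat set set \<Rightarrow> nat set set" where
  "close_last m P = insert {last_open P, Suc m} (P - {{last_open P}})"

text \<open>In a partition the union extracts the unique block containing \<open>Suc m\<close>;
  deleting \<open>Suc m\<close> from it leaves its partner unmatched.\<close>

definition reopen :: "nat \<Rightarrow> nat set set \<Rightarrow> nat set set" where
  "reopen m P = insert (\<Union>{B \<in> P. Suc m \<in> B} - {Suc m}) {B \<in> P. Suc m \<notin> B}"

lemma last_open_eqI:
  assumes "finite {i. {i} \<in> P}" "{j} \<in> P" "\<And>k. {k} \<in> P \<Longrightarrow> k \<le> j"
  shows "last_open P = j"
  unfolding last_open_def using assms by (intro Max_eqI) auto

lemma close_last_props:
  assumes P: "P \<in> open_pairings m (Suc h)"
  shows "close_last m P \<in> open_pairings (Suc m) h" "{Suc m} \<notin> close_last m P" "reopen m (close_last m P) = P"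
proof -
  have part: "partition_on {1..m} P" and sz: "\<And>B. B \<in> P \<Longrightarrow> card B = 1 \<or> card B = 2" and nest: "nested P"
    and h: "card {B \<in> P. card B = 1} = Suc h"
    using P unfolding open_pairings_def by blast+
  have le: "1 \<le> i \<and> i \<le> m" if "B \<in> P" "i \<in> B" for B i using partition_on_atLeastAtMost_mem[OF part that] by blast
  have fin: "finite P" by (rule finite_open_pairing[OF P])
  have "{i. {i} \<in> P} \<subseteq> {1..m}"
  proof
    fix i assume "i \<in> {i. {i} \<in> P}"
    then show "i \<in> {1..m}" using le[of "{i}" i] by simp
  qed
  then have finS: "finite {i. {i} \<in> P}" by (rule finite_subset) simp
  have "{B \<in> P. card B = 1} \<noteq> {}"
  proof
    assume "{B \<in> P. card B = 1} = {}"
    then show False using h by (simp only: card.empty)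
  qed
  then have ne: "{i. {i} \<in> P} \<noteq> {}" by (auto simp: card_1_singleton_iff)
  define j where "j = last_open P"
  have j: "{j} \<in> P" and jmax: "\<And>k. {k} \<in> P \<Longrightarrow> k \<le> j"
    using Max_in[OF finS ne] Max_ge[OF finS] unfolding j_def last_open_def by auto
  have jm: "1 \<le> j" "j \<le> m" using le[OF j] by auto
  let ?D = "{j, Suc m}"
  let ?Q = "P - {{j}}"
  have cl: "close_last m P = insert ?D ?Q" by (simp add: close_last_def j_def)
  have jQ: "j \<notin> B" if "B \<in> ?Q" for B using partition_on_block_unique[OF part j, of B j] that by blast
  have mQ: "Suc m \<notin> B" if "B \<in> ?Q" for B using le[of B "Suc m"] that by auto
  show "{Suc m} \<notin> close_last m P" 
  proof -
    have "{Suc m} \<notin> ?Q" using mQ[of "{Suc m}"] by blast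
    moreover have "{Suc m} \<noteq> ?D" using jm by auto
    ultimately show ?thesis unfolding cl by blast
  qed
  have "partition_on {1..Suc m} (insert ?D ?Q)"
  proof (rule partition_on_insert[THEN iffD2])
    show "disjnt ?D (\<Union>?Q)" using jQ mQ unfolding disjnt_def by blast
    have "partition_on {1..m} (insert {j} ?Q)" using part j by (simp add: insert_absorb)
    moreover have "disjnt {j} (\<Union>?Q)" using jQ unfolding disjnt_def by blast
    ultimately have "partition_on ({1..m} - {j}) ?Q" using partition_on_insert by blast
    moreover have "{1..m} - {j} = {1..Suc m} - ?D" by auto
    ultimately show "partition_on ({1..Suc m} - ?D) ?Q \<and> ?D \<subseteq> {1..Suc m} \<and> ?D \<noteq> {}" using jm by auto
  qed
  moreover have "\<forall>B\<in>insert ?D ?Q. card B = 1 \<or> card B = 2" using sz jm by (auto simp: card_insert_if)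
  moreover have "nested (insert ?D ?Q)"
    unfolding nested_def
  proof (intro ballI impI)
    fix B a b C k assume *: "B \<in> insert ?D ?Q" "a \<in> B" "b \<in> B" "C \<in> insert ?D ?Q" "k \<in> C" "a < k \<and> k < b"
    show "card C = 2 \<and> (\<forall>l\<in>C. a < l \<and> l < b)"
    proof (cases "B = ?D")
      case True
      then have ab: "a = j" "b = Suc m" using * jm by auto
      have "C \<noteq> ?D" using * ab by auto
      then have C: "C \<in> P" "C \<in> ?Q" using *(4) by blast+
      have "k \<noteq> j" using jQ[OF C(2)] *(5) by blast
      \<comment> \<open>A member of \<open>C\<close> to the left of \<open>j\<close> would form,
        together with \<open>k\<close>, an arc above the unmatched point \<open>j\<close>.\<close>
      have l: "j < l \<and> l \<le> m" if l: "l \<in> C" for l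
      proof -
        have "l \<noteq> j" using jQ[OF C(2)] l by blast
        moreover have "\<not> l < j"
        proof
          assume "l < j"
          then have "card {j} = 2" using nestedD(1)[OF nest C(1) l *(5) j] *(6) ab by blast
          then show False by simp
        qed
        ultimately show ?thesis using le[OF C(1) l] by linarith
      qed
      \<comment> \<open>An unmatched point to the right of \<open>j\<close> contradicts the choice
        of \<open>j\<close> as the last one.\<close>
      have "card C \<noteq> 1"
      proof
        assume "card C = 1"
        then obtain c where "C = {c}" by (rule card_1_singletonE)
        then have "k \<le> j" using jmax[of k] C(1) *(5) by simp
        then show False using * ab by simp
      qed
      then have "card C = 2" using sz[OF C(1)] by blast
      then show ?thesis using l ab by (auto simp: less_Suc_eq_le)
    next
      case False
      then have B: "B \<in> P" "B \<in> ?Q" using *(1) by blast+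
      have "b \<le> m" using le[OF B(1) *(3)] by blast
      have "C \<noteq> ?D"
      proof
        assume "C = ?D"
        then have "k = j" using *(5,6) \<open>b \<le> m\<close> by auto
        then have "card {j} = 2" using nestedD(1)[OF nest B(1) *(2,3) j] *(6) by blast
        then show False by simp
      qed
      then have "C \<in> P" using *(4) by blast
      from nestedD[OF nest B(1) *(2,3) this *(5)] show ?thesis using *(6) by blast
    qed
  qed
  moreover have "card {B \<in> insert ?D ?Q. card B = 1} = h"
  proof -
    have "card ?D = 2" using jm by simp
    then have "{B \<in> insert ?D ?Q. card B = 1} = {B \<in> P. card B = 1} - {{j}}" by auto
    then show ?thesis using h fin j by simp
  qed
  ultimately show "close_last m P \<in> open_pairings (Suc m) h" unfolding cl open_pairings_def by blast
  have "{B \<in> insert ?D ?Q. Suc m \<in> B} = {?D}" using mQ by blast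
  moreover have "{B \<in> insert ?D ?Q. Suc m \<notin> B} = ?Q" using mQ by blast
  moreover have "?D - {Suc m} = {j}" using jm by auto
  ultimately have "reopen m (insert ?D ?Q) = insert {j} ?Q" unfolding reopen_def by simp
  then show "reopen m (close_last m P) = P" unfolding cl using j by (simp add: insert_absorb)
qed

lemma reopen_props:
  assumes P: "P \<in> open_pairings (Suc m) h" and notin: "{Suc m} \<notin> P"
  shows "reopen m P \<in> open_pairings m (Suc h)" "close_last m (reopen m P) = P"
proof -
  have part: "partition_on {1..Suc m} P" and sz: "\<And>B. B \<in> P \<Longrightarrow> card B = 1 \<or> card B = 2" and nest: "nested P"
    and h: "card {B \<in> P. card B = 1} = h"
    using P unfolding open_pairings_def by blast+
  have le: "1 \<le> i \<and> i \<le> Suc m" if "B \<in> P" "i \<in> B" for B i using partition_on_atLeastAtMost_mem[OF part that] by blast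
  have fin: "finite P" by (rule finite_open_pairing[OF P])
  have "Suc m \<in> \<Union>P" using part unfolding partition_on_def by auto
  then obtain D where D: "D \<in> P" "Suc m \<in> D" by blast
  have "card D \<noteq> 1"
  proof
    assume "card D = 1"
    then obtain c where "D = {c}" by (rule card_1_singletonE)
    then show False using D notin by simp
  qed
  then have "card D = 2" using sz[OF D(1)] by blast
  then obtain x y where "D = {x, y}" "x \<noteq> y" unfolding card_2_iff by blast
  then obtain j where j: "D = {j, Suc m}" "j \<noteq> Suc m" using D(2) by blast
  have jm: "1 \<le> j" "j \<le> m" using le[OF D(1), of j] j by auto
  define Q where "Q = P - {D}"
  have uniq: "B = D" if "B \<in> P" "x \<in> B" "x \<in> D" for B x using partition_on_block_unique[OF part that(1) D(1) that(2,3)] .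
  have jQ: "j \<notin> B" "Suc m \<notin> B" if "B \<in> Q" for B
    using uniq[of B j] uniq[of B "Suc m"] that j unfolding Q_def by blast+
  have "{B \<in> P. Suc m \<in> B} = {D}" using D uniq by blast
  moreover have "{B \<in> P. Suc m \<notin> B} = Q" using D uniq unfolding Q_def by blast
  moreover have "D - {Suc m} = {j}" using j by auto
  ultimately have re: "reopen m P = insert {j} Q" unfolding reopen_def by simp
  have jnQ: "{j} \<notin> Q" using jQ by blast
  have "partition_on {1..m} (insert {j} Q)"
  proof (rule partition_on_insert[THEN iffD2])
    show "disjnt {j} (\<Union>Q)" using jQ unfolding disjnt_def by blast
    have "partition_on {1..Suc m} (insert D Q)" using part D by (simp add: insert_absorb Q_def)
    moreover have "disjnt D (\<Union>Q)" using jQ j unfolding disjnt_def by blast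
    ultimately have "partition_on ({1..Suc m} - D) Q" using partition_on_insert by blast
    moreover have "{1..m} - {j} = {1..Suc m} - D" using j by auto
    ultimately show "partition_on ({1..m} - {j}) Q \<and> {j} \<subseteq> {1..m} \<and> {j} \<noteq> {}" using jm by auto
  qed
  moreover have "\<forall>B\<in>insert {j} Q. card B = 1 \<or> card B = 2" using sz unfolding Q_def by simp
  moreover have "nested (insert {j} Q)"
    unfolding nested_def
  proof (intro ballI impI)
    fix B a b C k assume *: "B \<in> insert {j} Q" "a \<in> B" "b \<in> B" "C \<in> insert {j} Q" "k \<in> C" "a < k \<and> k < b"
    have "B \<noteq> {j}" using * by auto
    then have B: "B \<in> P" "B \<in> Q" using *(1) unfolding Q_def by blast+
    have b: "b \<le> m" using le[OF B(1) *(3)] jQ(2)[OF B(2)] *(3) by (metis le_Suc_eq)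
    \<comment> \<open>If the reopened point lay below an arc ending at \<open>b \<le> m\<close>,
      nesting of \<open>P\<close> would put its old partner \<open>Suc m\<close> below that arc as
      well.\<close>
    have "C \<noteq> {j}"
    proof
      assume "C = {j}"
      then have "a < j" "j < b" using *(5,6) by auto
      moreover have "j \<in> D" "Suc m \<in> D" using j(1) by blast+
      ultimately have "Suc m < b" using nestedD(2)[OF nest B(1) *(2,3) D(1)] by blast
      then show False using b by simp
    qed
    then have "C \<in> P" using *(4) unfolding Q_def by blast
    from nestedD[OF nest B(1) *(2,3) this *(5)]
    show "card C = 2 \<and> (\<forall>l\<in>C. a < l \<and> l < b)" using *(6) by blast
  qed
  moreover have "card {B \<in> insert {j} Q. card B = 1} = Suc h"
  proof -
    have "{B \<in> insert {j} Q. card B = 1} = insert {j} {B \<in> P. card B = 1}"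
      using \<open>card D = 2\<close> unfolding Q_def by auto
    moreover have "{j} \<notin> P" using uniq[of "{j}" j] j by auto
    ultimately show ?thesis using h fin by simp
  qed
  ultimately show "reopen m P \<in> open_pairings m (Suc h)" unfolding re open_pairings_def by blast
  have "last_open (insert {j} Q) = j"
  proof (rule last_open_eqI)
    show "finite {i. {i} \<in> insert {j} Q}"
    proof (rule finite_subset)
      show "{i. {i} \<in> insert {j} Q} \<subseteq> {1..Suc m}"
      proof
        fix i assume "i \<in> {i. {i} \<in> insert {j} Q}"
        then have "i = j \<or> {i} \<in> P" unfolding Q_def by auto
        then show "i \<in> {1..Suc m}" using le[of "{i}" i] jm by auto
      qed
    qed simp
    fix k assume k: "{k} \<in> insert {j} Q"
    \<comment> \<open>A later unmatched point would lie below the arc of \<open>P\<close> from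
      \<open>j\<close> to \<open>Suc m\<close>.\<close>
    show "k \<le> j"
    proof (rule ccontr)
      assume "\<not> k \<le> j"
      then have kQ: "{k} \<in> Q" "j < k" using k by auto
      then have "{k} \<in> P" "k \<noteq> Suc m" using jQ(2)[of "{k}"] unfolding Q_def by auto
      then have "k < Suc m" using le[of "{k}" k] by auto
      moreover have "j \<in> D" "Suc m \<in> D" using j(1) by blast+
      ultimately have "card {k} = 2" using nestedD(1)[OF nest D(1) _ _ \<open>{k} \<in> P\<close>] kQ(2) by blast
      then show False by simp
    qed
  qed simp
  then have "close_last m (insert {j} Q) = insert D (insert {j} Q - {{j}})" unfolding close_last_def j(1) by simp
  also have "\<dots> = P" using jnQ D(1) unfolding Q_def by auto
  finally show "close_last m (reopen m P) = P" unfolding re .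
qed

text \<open>The last point is either unmatched and can be removed, or closes an arc and can be
  detached from its partner; these are the two steps of the recursion.\<close>

lemma card_open_pairings: "card (open_pairings m h) = walks m h"
proof (induction m arbitrary: h)
  case 0
  then show ?case by (simp add: open_pairings_0)
next
  case (Suc m)
  let ?S = "open_pairings (Suc m) h"
  let ?A = "{P \<in> ?S. {Suc m} \<in> P}" and ?B = "{P \<in> ?S. {Suc m} \<notin> P}"
  have A: "card ?A = (if h = 0 then 0 else walks m (h - 1))"
  proof (cases h)
    case 0
    then have "?A = {}" using open_pairings_del_singleton(1)[of _ m h] by blast
    then show ?thesis unfolding 0 by (metis card.empty)
  next
    case (Suc g)
    have "bij_betw (insert {Suc m}) (open_pairings m g) ?A"
    proof (rule bij_betw_byWitness[where f'="\<lambda>P. P - {{Suc m}}"])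
      show "\<forall>P\<in>open_pairings m g. insert {Suc m} P - {{Suc m}} = P"
        using open_pairings_add_singleton(2) by blast
      show "\<forall>P\<in>?A. insert {Suc m} (P - {{Suc m}}) = P" by blast
      show "insert {Suc m} ` open_pairings m g \<subseteq> ?A"
        using open_pairings_add_singleton(1) unfolding Suc by blast
      show "(\<lambda>P. P - {{Suc m}}) ` ?A \<subseteq> open_pairings m g"
        using open_pairings_del_singleton(2)[of _ m h] unfolding Suc by auto
    qed
    then show ?thesis using Suc.IH[of g] by (simp add: Suc bij_betw_same_card)
  qed
  have "bij_betw (close_last m) (open_pairings m (Suc h)) ?B"
  proof (rule bij_betw_byWitness[where f'="reopen m"])
    show "\<forall>P\<in>open_pairings m (Suc h). reopen m (close_last m P) = P" using close_last_props(3) by blast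
    show "\<forall>P\<in>?B. close_last m (reopen m P) = P" using reopen_props(2) by blast
    show "close_last m ` open_pairings m (Suc h) \<subseteq> ?B" using close_last_props(1,2) by blast
    show "reopen m ` ?B \<subseteq> open_pairings m (Suc h)" using reopen_props(1) by blast
  qed
  then have B: "card ?B = walks m (Suc h)" using Suc.IH[of "Suc h"] by (simp add: bij_betw_same_card)
  have "?S = ?A \<union> ?B" by blast
  then have "card ?S = card ?A + card ?B"
  proof -
    have "finite ?A" "finite ?B" using finite_open_pairings[of "Suc m" h] by simp_all
    moreover have "?A \<inter> ?B = {}" by blast
    ultimately have "card (?A \<union> ?B) = card ?A + card ?B" by (rule card_Un_disjoint)
    then show ?thesis using \<open>?S = ?A \<union> ?B\<close> by (metis (no_types, lifting))
  qed
  then show ?case using A B by simp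
qed

text \<open>Without unmatched points nesting reduces to noncrossing: if one end of a pair lies below
  an arc, the other can be neither outside the arc nor at its ends.\<close>

lemma NC2_eq_open_pairings: "NC2 p = open_pairings p 0"
proof (intro equalityI subsetI)
  fix P assume P: "P \<in> NC2 p"
  then have part: "partition_on {1..p} P" and two: "\<And>B. B \<in> P \<Longrightarrow> card B = 2" unfolding NC2_def by blast+
  have nc: False if "B1 \<in> P" "B2 \<in> P" "B1 = {i, j}" "B2 = {k, l}" "i < k" "k < j" "j < l" for B1 B2 i j k l
    using P that unfolding NC2_def by blast
  have "nested P"
    unfolding nested_def
  proof (intro ballI impI conjI)
    fix B i j C k l assume *: "B \<in> P" "i \<in> B" "j \<in> B" "C \<in> P" "k \<in> C" "i < k \<and> k < j"
    show "card C = 2" using two *(4) .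
    have pair: "D = {x, y}" if "D \<in> P" "x \<in> D" "y \<in> D" "x \<noteq> y" for D x y
    proof -
      from two[OF that(1)] obtain a b where "D = {a, b}" unfolding card_2_iff by blast
      then show ?thesis using that(2-4) by blast
    qed
    have B: "B = {i, j}" using pair[OF *(1-3)] *(6) by simp
    have ne: "B \<noteq> C" using B *(5,6) by auto
    assume l: "l \<in> C"
    have li: "l \<noteq> i" "l \<noteq> j" using partition_on_block_unique[OF part *(1) *(4)] ne l *(2,3) by blast+
    have C: "C = {k, l}" if "l \<noteq> k" using pair[OF *(4) *(5) l] that by simp
    have 1: "\<not> j < l"
    proof
      assume "j < l"
      then show False using nc[OF *(1) *(4) B C] *(6) by simp
    qed
    have 2: "\<not> l < i"
    proof
      assume a: "l < i"
      then have "C = {l, k}" using C *(6) by auto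
      from nc[OF *(4) *(1) this B a] show False using *(6) by blast
    qed
    show "i < l" "l < j" using 1 2 li by linarith+
  qed
  moreover have "card {B \<in> P. card B = 1} = 0"
  proof -
    have "{B \<in> P. card B = 1} = {}" using two by force
    then show ?thesis by (simp only: card.empty)
  qed
  ultimately show "P \<in> open_pairings p 0" using part two unfolding open_pairings_def by blast
next
  fix P assume P: "P \<in> open_pairings p 0"
  then have part: "partition_on {1..p} P" and sz: "\<And>B. B \<in> P \<Longrightarrow> card B = 1 \<or> card B = 2" and nest: "nested P"
    and h: "card {B \<in> P. card B = 1} = 0"
    unfolding open_pairings_def by blast+
  have "{B \<in> P. card B = 1} = {}" using h finite_open_pairing[OF P] by simp
  then have two: "card B = 2" if "B \<in> P" for B using sz[OF that] that by blast
  have False if "B1 \<in> P" "B2 \<in> P" "B1 = {i, j}" "B2 = {k, l}" "i < k" "k < j" "j < l" for B1 B2 i j k l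
  proof -
    have "i \<in> B1" "j \<in> B1" "k \<in> B2" "l \<in> B2" using that(3,4) by blast+
    then have "l < j" using nestedD(2)[OF nest that(1) _ _ that(2)] that(5,6) by blast
    then show False using that by simp
  qed
  then show "P \<in> NC2 p" using part two unfolding NC2_def by blast
qed

lemma card_NC2: "card (NC2 p) = walks p 0"
  by (simp add: NC2_eq_open_pairings card_open_pairings)

text \<open>The moments of \<open>mu_sc\<close> against the Chebyshev polynomials of the second kind
  (after \<open>x = - 2 cos t\<close>) satisfy the recursion of \<open>walks\<close>.\<close>

definition cheb_moment :: "nat \<Rightarrow> nat \<Rightarrow> real" where
  "cheb_moment m h = 2 / pi * integral {0..pi} (\<lambda>t. (- 2 * cos t) ^ m * sin t * ((- 1) ^ h * sin (real (Suc h) * t)))"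

lemma cheb_moment_integrable:
  "(\<lambda>t. (- 2 * cos t) ^ m * sin t * ((- 1) ^ h * sin (real k * t))) integrable_on {0..pi}"
  by (intro integrable_continuous_real continuous_intros)

text \<open>Orthogonality of the second-kind polynomials to the constant one: for positive integers
  \<open>k\<close>, \<open>sin t * sin (k t)\<close> integrates to zero over \<open>{0..pi}\<close>
  unless \<open>k = 1\<close>.\<close>

lemma cheb_moment_0: "cheb_moment 0 h = (if h = 0 then 1 else 0)"
proof (cases "h = 0")
  case True
  have "((\<lambda>t. sin t * sin t) has_integral ((pi - sin pi * cos pi) / 2 - (0 - sin 0 * cos 0) / 2)) {0..pi}"
  proof (rule fundamental_theorem_of_calculus)
    fix x :: real
    have "sin x * sin x = (1 - (cos x * cos x - sin x * sin x)) / 2"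
      using sin_cos_squared_add[of x] by (simp add: power2_eq_square)
    note eq = this
    have "((\<lambda>t. (t - sin t * cos t) / 2) has_real_derivative (1 - (cos x * cos x - sin x * sin x)) / 2) (at x within {0..pi})"
      by (auto intro!: derivative_eq_intros)
    then show "((\<lambda>t. (t - sin t * cos t) / 2) has_vector_derivative sin x * sin x) (at x within {0..pi})"
      unfolding eq[symmetric] has_real_derivative_iff_has_vector_derivative .
  qed simp
  then have "integral {0..pi} (\<lambda>t. sin t * sin t) = pi / 2" by (simp add: integral_unique)
  then show ?thesis using True by (simp add: cheb_moment_def)
next
  case False
  let ?F = "\<lambda>t. (sin (real h * t) / real h - sin (real (h + 2) * t) / real (h + 2)) / 2"
  have "((\<lambda>t. sin t * sin (real (Suc h) * t)) has_integral (?F pi - ?F 0)) {0..pi}"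
  proof (rule fundamental_theorem_of_calculus)
    fix x :: real
    have e1: "real h * x = real (Suc h) * x - x" "real (h + 2) * x = real (Suc h) * x + x"
      by (simp_all add: algebra_simps)
    have d: "sin x * sin (real (Suc h) * x) = (cos (real h * x) - cos (real (h + 2) * x)) / 2"
      unfolding e1 cos_diff cos_add by simp
    show "(?F has_vector_derivative sin x * sin (real (Suc h) * x)) (at x within {0..pi})"
      unfolding has_real_derivative_iff_has_vector_derivative[symmetric] d using False
      by (auto intro!: derivative_eq_intros simp del: of_nat_add)
  qed simp
  moreover have "?F pi - ?F 0 = 0" using sin_npi[of h] sin_npi[of "h + 2"] by (simp del: of_nat_add)
  ultimately have "integral {0..pi} (\<lambda>t. sin t * sin (real (Suc h) * t)) = 0"
    by (simp only: integral_unique)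
  moreover have "(\<lambda>t. (- 2 * cos t) ^ 0 * sin t * ((- 1) ^ h * sin (real (Suc h) * t)))
      = (\<lambda>t::real. (- 1) ^ h * (sin t * sin (real (Suc h) * t)))"
    by (simp add: fun_eq_iff)
  ultimately show ?thesis using False unfolding cheb_moment_def by (simp only: integral_mult_right) simp
qed

text \<open>The recurrence \<open>x U_h = U_(h-1) + U_(h+1)\<close> with \<open>U_(-1) = 0\<close>,
  read off from the addition formulas for the sine. The sign \<open>(- 1) ^ h\<close> in
  \<open>cheb_moment\<close> comes from evaluation at \<open>x = 2 cos (pi - t)\<close>.\<close>

lemma cheb_moment_Suc:
  "cheb_moment (Suc m) h = (if h = 0 then 0 else cheb_moment m (h - 1)) + cheb_moment m (Suc h)"
proof -
  let ?f = "\<lambda>h t. (- 2 * cos t) ^ m * sin t * ((- 1) ^ h * sin (real (Suc h) * t))"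
  let ?g = "\<lambda>t. (- 2 * cos t) ^ m * sin t * ((- 1) ^ Suc h * sin (real h * t))"
  have "(- 2 * cos t) ^ Suc m * sin t * ((- 1) ^ h * sin (real (Suc h) * t)) = ?g t + ?f (Suc h) t" for t :: real
  proof -
    have e1: "real h * t = real (Suc h) * t - t" "real (Suc (Suc h)) * t = real (Suc h) * t + t"
      by (simp_all add: algebra_simps)
    have "sin (real h * t) + sin (real (Suc (Suc h)) * t) = 2 * cos t * sin (real (Suc h) * t)"
      unfolding e1 sin_diff sin_add by simp
    then have "?g t + ?f (Suc h) t = (- 2 * cos t) ^ m * sin t * ((- 1) ^ Suc h * (2 * cos t * sin (real (Suc h) * t)))"
      by (metis distrib_left)
    then show ?thesis by simp
  qed
  then have *: "cheb_moment (Suc m) h = 2 / pi * integral {0..pi} ?g + cheb_moment m (Suc h)"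
    unfolding cheb_moment_def
    by (simp only: integral_add[OF cheb_moment_integrable cheb_moment_integrable] distrib_left)
  have "2 / pi * integral {0..pi} ?g = (if h = 0 then 0 else cheb_moment m (h - 1))"
    by (cases h) (simp_all add: cheb_moment_def)
  with * show ?thesis by simp
qed

lemma cheb_momentries_eq_walks: "cheb_moment m h = real (walks m h)"
  by (induction m arbitrary: h) (simp_all add: cheb_moment_0 cheb_moment_Suc)

lemma moment_mu_sc: "moment mu_sc p = real (card (NC2 p))"
proof -
  let ?f = "\<lambda>x. f_sc x * x ^ p"
  let ?h = "\<lambda>x. sqrt (4 - x\<^sup>2) / (2 * pi) * x ^ p"
  have meas: "f_sc \<in> borel_measurable borel"
    unfolding f_sc_def[abs_def] by measurable
  have nonneg: "0 \<le> f_sc x" for x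
  proof -
    have "x\<^sup>2 \<le> 4" if "\<bar>x\<bar> \<le> 2" using that abs_le_square_iff[of x 2] by simp
    then show ?thesis by (simp add: f_sc_def)
  qed
  have cont: "continuous_on {-2..2} ?h" by (intro continuous_intros) auto
  have "moment mu_sc p = integral\<^sup>L lborel (\<lambda>x. f_sc x *\<^sub>R x ^ p)"
    unfolding moment_def mu_sc_def using meas nonneg by (intro integral_density) auto
  also have "\<dots> = integral\<^sup>L lborel (\<lambda>x. indicator {-2..2} x *\<^sub>R ?h x)"
    by (intro Bochner_Integration.integral_cong) (auto simp: f_sc_def indicator_def abs_le_iff)
  also have "\<dots> = integral {-2..2} ?h"
    using set_borel_integral_eq_integral(2)[OF borel_integrable_atLeastAtMost'[OF cont]]
    by (simp add: set_lebesgue_integral_def)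
  \<comment> \<open>The sign in \<open>x = - 2 * cos t\<close> makes the substitution increasing; on
    \<open>{0..pi}\<close> the sine is nonnegative, which afterwards resolves the square
    root.\<close>
  also have "\<dots> = integral {0..pi} (\<lambda>t. (2 * sin t) *\<^sub>R ?h (- 2 * cos t))"
  proof (rule sym, rule integral_unique)
    have "((\<lambda>t. (2 * sin t) *\<^sub>R ?h (- 2 * cos t)) has_integral integral {- 2 * cos 0..- 2 * cos pi} ?h) {0..pi}"
    proof (rule has_integral_substitution[where c="-2" and d=2])
      show "(\<lambda>t. - 2 * cos t) ` {0..pi} \<subseteq> {- 2..2}" 
      proof
        fix x assume "x \<in> (\<lambda>t. - 2 * cos t) ` {0..pi}"
        then obtain t where "x = - 2 * cos t" by blast
        then show "x \<in> {- 2..2}" using cos_le_one[of t] cos_ge_minus_one[of t]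
          unfolding atLeastAtMost_iff by linarith
      qed
      show "((\<lambda>t. - 2 * cos t) has_real_derivative 2 * sin x) (at x within {0..pi})" for x
        by (auto intro!: derivative_eq_intros)
    qed (use cont in auto)
    then show "((\<lambda>t. (2 * sin t) *\<^sub>R ?h (- 2 * cos t)) has_integral integral {- 2..2} ?h) {0..pi}" by simp
  qed
  also have "\<dots> = integral {0..pi} (\<lambda>t. 2 / pi * ((- 2 * cos t) ^ p * sin t * ((- 1) ^ 0 * sin (real (Suc 0) * t))))"
  proof (rule integral_cong)
    fix t assume t: "t \<in> {0..pi}"
    have "4 - (- 2 * cos t)\<^sup>2 = (2 * sin t)\<^sup>2" 
    proof -
      have "(- 2 * cos t)\<^sup>2 = 4 * (cos t)\<^sup>2" "(2 * sin t)\<^sup>2 = 4 * (sin t)\<^sup>2" by (simp_all add: power_mult_distrib)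
      then show ?thesis using sin_cos_squared_add[of t] by linarith
    qed
    moreover have "0 \<le> sin t" using t by (intro sin_ge_zero) auto
    ultimately have "sqrt (4 - (- 2 * cos t)\<^sup>2) = 2 * sin t" by (simp only: real_sqrt_abs)
    then show "(2 * sin t) *\<^sub>R ?h (- 2 * cos t) = 2 / pi * ((- 2 * cos t) ^ p * sin t * ((- 1) ^ 0 * sin (real (Suc 0) * t)))"
      by (simp only:) (simp add: field_simps)
  qed
  also have "\<dots> = cheb_moment p 0" unfolding cheb_moment_def by (rule integral_mult_right)
  finally show ?thesis by (simp add: cheb_momentries_eq_walks card_NC2)
qed

section \<open>Traces of words in asymptotically free matrices\<close>

lemma mpow_add: "r < N \<Longrightarrow> mpow N A (a + b) r c = mmult N (mpow N A a) (mpow N A b) r c"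
  unfolding mpow_eq_mlist_prod replicate_add by (rule mlist_prod_append)

lemma mpow_mpow: "r < N \<Longrightarrow> mpow N (mpow N A k) q r c = mpow N A (k * q) r c"
proof (induction q arbitrary: r)
  case (Suc q)
  have "mpow N (mpow N A k) (Suc q) r c = mmult N (mpow N A k) (mpow N A (k * q)) r c"
    unfolding mpow.simps by (rule mmult_cong) (use Suc.IH in simp_all)
  also have "\<dots> = mpow N A (k * Suc q) r c"
    using mpow_add[OF Suc.prems, of A k "k * q" c] by simp
  finally show ?case .
qed simp

lemma tau_mpow_mpow: "tau N (mpow N (mpow N A k) q) = tau N (mpow N A (k * q))"
  by (intro tau_cong mpow_mpow)

lemma hermitian_mpow:
  assumes "hermitian_mat N A" shows "hermitian_mat N (mpow N A k)"
  unfolding hermitian_mat_def mpow_eq_mlist_prod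
proof (intro allI impI)
  fix i j assume "i < N" "j < N"
  then show "mlist_prod N (replicate k A) j i = cnj (mlist_prod N (replicate k A) i j)"
    using mlist_prod_rev_hermitian[of "replicate k A" N j i] assms by simp
qed

lemma mpow_1: "r < N \<Longrightarrow> c < N \<Longrightarrow> mpow N A 1 r c = A r c"
  by (simp add: mmult_def mone_def if_distrib cong: if_cong)

lemma tau_mpow_scale: "tau N (mpow N (\<lambda>r c. s * A r c) q) = s ^ q * tau N (mpow N A q)"
  using ttr_scale[of N "\<lambda>_. s" "\<lambda>_. A" "replicate q ()"]
  by (simp add: mpow_eq_mlist_prod prod_list_replicate)

lemma chessboard_map:
  assumes "\<And>x. x \<in> set w \<Longrightarrow> hermitian_mat N (f x)" "w \<noteq> []"
  shows "(cmod (ttr N (map f w)))\<^sup>2 \<le> (\<Sum>x\<in>set w. cmod (tau N (mpow N (f x) (2 * length w))))"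
proof -
  have "(cmod (ttr N (map f w)))\<^sup>2 \<le> (\<Sum>A\<in>f ` set w. cmod (tau N (mpow N A (2 * length w))))"
  proof (rule chessboard)
    show "map f w \<in> words (f ` set w) (length w)" by (simp add: words_def)
    show "1 \<le> length w" using assms(2) by (cases w) auto
  qed (use assms(1) in auto)
  also have "\<dots> \<le> (\<Sum>x\<in>set w. cmod (tau N (mpow N (f x) (2 * length w))))"
    by (rule sum_image_le[where g="\<lambda>A. cmod (tau N (mpow N A (2 * length w)))", unfolded o_def]) auto
  finally show ?thesis .
qed

context prob_seq
begin

lemma null_deterministic:
  assumes "c \<longlonglongrightarrow> 0" shows "null (\<lambda>n \<omega>. c n)"
  unfolding null_def
proof (intro conjI allI impI)
  interpret prob_space "M n" for n by (rule prob)
  show "all_moments (M n) (\<lambda>_. c n)" for n by simp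
  fix q :: nat assume q: "1 \<le> q"
  have "(\<lambda>n. cmod (c n) ^ q) \<longlonglongrightarrow> cmod 0 ^ q" using assms by (intro tendsto_intros)
  then show "(\<lambda>n. integral\<^sup>L (M n) (\<lambda>\<omega>. cmod (c n) ^ q)) \<longlonglongrightarrow> 0"
    using q by (simp add: prob_space power_0_left)
qed

lemma conv_deterministic: "c \<longlonglongrightarrow> a \<Longrightarrow> conv (\<lambda>n \<omega>. c n) a"
  unfolding conv_def by (intro null_deterministic) (simp add: LIM_zero)

end

text \<open>A letter \<open>(i, k, b)\<close> stands for the power \<open>W\<^sub>i\<^sup>k\<close>, centred if \<open>b\<close> holds.\<close>

type_synonym letter = "nat \<times> nat \<times> bool"

text \<open>Powers are unfolded into single factors, so that counting an index in the result gives
  the total degree of the word in that matrix.\<close>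

definition spread :: "letter list \<Rightarrow> nat list" where
  "spread w = concat (map (\<lambda>(i, k, b). replicate k i) w)"

lemma spread_simps [simp]:
  "spread [] = []" "spread ((i, k, b) # w) = replicate k i @ spread w" "spread (u @ v) = spread u @ spread v"
  by (simp_all add: spread_def)

lemma count_list_replicate: "count_list (replicate k i) x = (if x = i then k else 0)"
  by (induction k) auto

text \<open>The invariant of the induction on words: plain letters are first powers, centred letters
  are the squares created by merging neighbours, and no matrix has total degree above two.\<close>

definition reduced :: "letter list \<Rightarrow> bool" where
  "reduced w \<longleftrightarrow> (\<forall>(i, k, b)\<in>set w. k = (if b then 2 else 1)) \<and> (\<forall>x. count_list (spread w) x \<le> 2)"

definition word_limit :: "letter list \<Rightarrow> complex" where
  "word_limit w = (if (\<exists>x\<in>set w. snd (snd x)) \<or> \<not> nc_word (map fst w) then 0 else 1)"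

text \<open>Entrywise moments and hermiticity are demanded for all indices and points, so the limit
  calculus carries no side conditions; truncated matrices meet this.\<close>

locale tensor_clt = prob_seq M for M :: "nat \<Rightarrow> 'a measure" +
  fixes W :: "nat \<Rightarrow> nat \<Rightarrow> 'a \<Rightarrow> cmat"
  assumes all_moments_W: "\<And>n i r c. all_moments (M n) (\<lambda>\<omega>. W n i \<omega> r c)"
    and herm_W: "\<And>n i \<omega>. hermitian_mat n (W n i \<omega>)"
    and conv_moments: "\<And>i p. 1 \<le> p \<Longrightarrow> convergent (\<lambda>n. integral\<^sup>L (M n) (\<lambda>\<omega>. tau n (mpow n (W n i \<omega>) p)))"
    and mean: "\<And>i. conv_in_prob M (\<lambda>n \<omega>. tau n (mpow n (W n i \<omega>) 1)) 0"
    and variance: "\<And>i. conv_in_prob M (\<lambda>n \<omega>. tau n (mpow n (W n i \<omega>) 2)) 1"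
    and free: "\<And>k. asym_free_in_prob M (\<lambda>n. n) W k"
    and tensor_mean: "\<And>i p. 1 \<le> p \<Longrightarrow>
      (\<lambda>n. tau (n\<^sup>2) (mpow (n\<^sup>2) (mexp (M n) (n\<^sup>2) (\<lambda>\<omega>. kron_conj n (W n i \<omega>))) p)) \<longlonglongrightarrow> 0"
begin

lemma all_moments_tau_mpow: "all_moments (M n) (\<lambda>\<omega>. tau n (mpow n (W n i \<omega>) p))"
proof -
  interpret prob_space "M n" by (rule prob)
  have "all_moments (M n) (\<lambda>\<omega>. ttr n (map (\<lambda>_. W n i \<omega>) (replicate p ())))"
    by (intro all_moments_ttr all_moments_W)
  then show ?thesis by (simp add: mpow_eq_mlist_prod)
qed

text \<open>For positive \<open>q\<close> the order is raised from \<open>q\<close> to the even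
  number \<open>2 ^ q\<close>, after which a single trace moment of order \<open>p * 2 ^ q\<close>
  dominates; its expectation converges in \<open>n\<close> and is therefore bounded.\<close>

lemma bdd_tau_mpow:
  assumes p: "1 \<le> p"
  shows "bdd (\<lambda>n \<omega>. tau n (mpow n (W n i \<omega>) p))"
proof -
  interpret prob_space "M n" for n by (rule prob)
  let ?t = "\<lambda>p n \<omega>. tau n (mpow n (W n i \<omega>) p)"
  have "\<exists>C. \<forall>n. integral\<^sup>L (M n) (\<lambda>\<omega>. Re (?t q n \<omega>)) \<le> C" if "1 \<le> q" for q
  proof -
    from convergent_imp_Bseq[OF conv_moments[OF that, of i]] obtain C
      where C: "\<And>n. norm (integral\<^sup>L (M n) (?t q n)) \<le> C" unfolding Bseq_def by blast
    have "integral\<^sup>L (M n) (\<lambda>\<omega>. Re (?t q n \<omega>)) \<le> C" for n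
    proof -
      have "integral\<^sup>L (M n) (\<lambda>\<omega>. Re (?t q n \<omega>)) = Re (integral\<^sup>L (M n) (?t q n))"
        using all_moments_integrable[OF all_moments_tau_mpow] by (rule integral_Re)
      also have "\<dots> \<le> norm (integral\<^sup>L (M n) (?t q n))" by (rule complex_Re_le_cmod)
      finally show ?thesis using C[of n] by linarith
    qed
    then show ?thesis by blast
  qed
  then obtain C where C: "\<And>q n. 1 \<le> q \<Longrightarrow> integral\<^sup>L (M n) (\<lambda>\<omega>. Re (?t q n \<omega>)) \<le> C q"
    by metis
  let ?g = "\<lambda>n q \<omega>. if q = 0 then 1 else 1 + Re (?t (p * 2 ^ q) n \<omega>)"
  have int: "integrable (M n) (\<lambda>\<omega>. Re (?t q n \<omega>))" for q n
    using all_moments_integrable[OF all_moments_tau_mpow] by (rule integrable_Re)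
  show ?thesis
  proof (rule bddI_bound)
    show "?t p n \<in> borel_measurable (M n)" for n using all_moments_measurable[OF all_moments_tau_mpow] .
    show "integrable (M n) (?g n q)" for n q using int by (cases "q = 0") simp_all
    show "integral\<^sup>L (M n) (?g n q) \<le> (if q = 0 then 1 else 1 + C (p * 2 ^ q))" for n q
    proof (cases "q = 0")
      case False
      then have "integral\<^sup>L (M n) (?g n q) = 1 + integral\<^sup>L (M n) (\<lambda>\<omega>. Re (?t (p * 2 ^ q) n \<omega>))"
        using int by (simp add: prob_space)
      moreover have "1 \<le> p * 2 ^ q" using p by simp
      ultimately show ?thesis using C[of "p * 2 ^ q" n] False by simp
    qed (simp add: prob_space)
    fix n q \<omega>
    show "cmod (?t p n \<omega>) ^ q \<le> ?g n q \<omega>"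
    proof (cases "q = 0")
      case False
      then have q: "1 \<le> q" by simp
      have "cmod (?t p n \<omega>) ^ q \<le> 1 + cmod (?t p n \<omega>) ^ (2 ^ q)"
      proof (cases "cmod (?t p n \<omega>) \<le> 1")
        case True
        then have "cmod (?t p n \<omega>) ^ q \<le> 1" by (simp add: power_le_one)
        moreover have "0 \<le> cmod (?t p n \<omega>) ^ (2 ^ q)" by simp
        ultimately show ?thesis by linarith
      next
        case False
        have "q \<le> 2 ^ q" by (simp add: less_imp_le)
        then have "cmod (?t p n \<omega>) ^ q \<le> cmod (?t p n \<omega>) ^ (2 ^ q)"
          using False by (intro power_increasing) auto
        then show ?thesis by linarith
      qed
      then show ?thesis using tau_mpow_power_le[OF herm_W[of n i \<omega>] q, of p] False by simp
    qed simp
  qed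
qed

text \<open>The value is 1 except at \<open>n = 0\<close>, where division by zero gives 0.\<close>

lemma bdd_tau_mone: "bdd (\<lambda>n \<omega>. tau n mone)"
proof -
  interpret prob_space "M n" for n by (rule prob)
  show ?thesis
    by (rule bddI_bound[where g="\<lambda>_ _ _. 1" and C="\<lambda>_. 1"])
       (auto simp: prob_space tau_def mtrace_def mone_def power_le_one)
qed

lemma conv_tau_mone: "conv (\<lambda>n \<omega>. tau n mone) 1"
proof (rule conv_deterministic)
  have "eventually (\<lambda>n. tau n mone = 1) sequentially"
    using eventually_gt_at_top[of 0] by eventually_elim (simp add: tau_def mtrace_def mone_def)
  then show "(\<lambda>n. tau n mone) \<longlonglongrightarrow> 1" by (rule tendsto_eventually)
qed

lemma bdd_norm_sum_tau:
  assumes "\<And>x. x \<in> A \<Longrightarrow> bdd (f x)"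
  shows "bdd (\<lambda>n \<omega>. complex_of_real (\<Sum>x\<in>A. cmod (f x n \<omega>)))"
  unfolding of_real_sum by (intro bdd_sum bdd_norm assms)

lemma all_moments_mpow: "all_moments (M n) (\<lambda>\<omega>. mpow n (W n i \<omega>) k r c)"
proof -
  interpret prob_space "M n" by (rule prob)
  have "all_moments (M n) (\<lambda>\<omega>. mlist_prod n (map (\<lambda>A. A \<omega>) (replicate k (W n i))) r c)"
    by (rule all_moments_mlist_prod) (auto simp: all_moments_W)
  then show ?thesis by (simp add: mpow_eq_mlist_prod)
qed

definition letter_mat :: "nat \<Rightarrow> 'a \<Rightarrow> letter \<Rightarrow> cmat" where
  "letter_mat n \<omega> = (\<lambda>(i, k, b) r c. mpow n (W n i \<omega>) k r c - (if b then tau n (mpow n (W n i \<omega>) k) else 0) * mone r c)"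

definition letter_trace :: "letter list \<Rightarrow> nat \<Rightarrow> 'a \<Rightarrow> complex" where
  "letter_trace w n \<omega> = ttr n (map (letter_mat n \<omega>) w)"

lemma letter_mat_False: "letter_mat n \<omega> (i, k, False) = mpow n (W n i \<omega>) k"
  by (simp add: letter_mat_def)

lemma all_moments_letter_trace: "all_moments (M n) (letter_trace w n)"
proof -
  interpret prob_space "M n" by (rule prob)
  have "all_moments (M n) (\<lambda>\<omega>. letter_mat n \<omega> x r c)" for x r c
  proof -
    obtain i k b where x: "x = (i, k, b)" by (cases x)
    show ?thesis unfolding x letter_mat_def prod.case
      by (cases b) (auto intro!: all_moments_diff all_moments_mult all_moments_mpow all_moments_tau_mpow)
  qed
  then show ?thesis unfolding letter_trace_def by (intro all_moments_ttr)
qed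

lemma letter_trace_centre: "letter_trace (u @ (i, k, True) # v) n \<omega> = letter_trace (u @ (i, k, False) # v) n \<omega> - tau n (mpow n (W n i \<omega>) k) * letter_trace (u @ v) n \<omega>"
proof -
  have "ttr n (map (letter_mat n \<omega>) u @ letter_mat n \<omega> (i, k, True) # map (letter_mat n \<omega>) v)
      = ttr n (map (letter_mat n \<omega>) u @ letter_mat n \<omega> (i, k, False) # map (letter_mat n \<omega>) v)
       + (- tau n (mpow n (W n i \<omega>) k)) * ttr n (map (letter_mat n \<omega>) u @ mone # map (letter_mat n \<omega>) v)"
    by (rule ttr_lin) (simp add: letter_mat_def)
  then show ?thesis by (simp add: letter_trace_def ttr_mone)
qed

text \<open>The chessboard estimate reduces a mixed word to trace moments of its single letters, and
  powers of powers of one matrix are again powers.\<close>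

lemma bdd_letter_trace_raw:
  assumes k: "\<And>i k b. (i, k, b) \<in> set w \<Longrightarrow> 1 \<le> k \<and> \<not> b"
  shows "bdd (letter_trace w)"
proof (cases "w = []")
  case True
  have "letter_trace [] = (\<lambda>n \<omega>. tau n mone)" by (simp add: letter_trace_def fun_eq_iff)
  then show ?thesis using bdd_tau_mone True by simp
next
  case False
  interpret prob_space "M n" for n by (rule prob)
  let ?f = "\<lambda>x n \<omega>. tau n (mpow n (W n (fst x) \<omega>) (fst (snd x) * (2 * length w)))"
  show ?thesis
  proof (rule bdd_sqrt_dom)
    show "letter_trace w n \<in> borel_measurable (M n)" for n by (rule all_moments_measurable[OF all_moments_letter_trace])
    show "bdd (\<lambda>n \<omega>. complex_of_real (\<Sum>x\<in>set w. cmod (?f x n \<omega>)))"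
    proof (rule bdd_norm_sum_tau)
      fix x assume x: "x \<in> set w"
      obtain i k b where [simp]: "x = (i, k, b)" by (cases x)
      have "1 \<le> k" using x assms by simp
      then have "1 \<le> k * (2 * length w)" using False by (cases "length w") auto
      then show "bdd (?f x)" unfolding \<open>x = (i, k, b)\<close> fst_conv snd_conv by (rule bdd_tau_mpow)
    qed
    fix n \<omega>
    have h: "hermitian_mat n (letter_mat n \<omega> x)" "tau n (mpow n (letter_mat n \<omega> x) (2 * length w)) = ?f x n \<omega>" if x: "x \<in> set w" for x
    proof -
      obtain i k b where e: "x = (i, k, b)" by (cases x)
      have "\<not> b" using assms x e by blast
      then have "letter_mat n \<omega> x = mpow n (W n i \<omega>) k" using e by (simp add: letter_mat_def)
      then show "hermitian_mat n (letter_mat n \<omega> x)" "tau n (mpow n (letter_mat n \<omega> x) (2 * length w)) = ?f x n \<omega>"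
        using hermitian_mpow[OF herm_W] by (simp_all add: e tau_mpow_mpow)
    qed
    have "(cmod (letter_trace w n \<omega>))\<^sup>2 \<le> (\<Sum>x\<in>set w. cmod (tau n (mpow n (letter_mat n \<omega> x) (2 * length w))))"
      unfolding letter_trace_def by (rule chessboard_map[OF h(1) False])
    also have "\<dots> = (\<Sum>x\<in>set w. cmod (?f x n \<omega>))" by (intro sum.cong refl) (simp only: h(2))
    also have "\<dots> \<le> cmod (complex_of_real (\<Sum>x\<in>set w. cmod (?f x n \<omega>)))"
      unfolding norm_of_real by (rule abs_ge_self)
    finally show "(cmod (letter_trace w n \<omega>))\<^sup>2 \<le> cmod (complex_of_real (\<Sum>x\<in>set w. cmod (?f x n \<omega>)))" .
  qed
qed

text \<open>Centrings are removed one at a time from the left: each costs a scalar trace times the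
  trace of a shorter word, both bounded. The prefix \<open>u\<close> collects the letters that are
  already plain.\<close>

lemma bdd_letter_trace:
  assumes "\<And>i k b. (i, k, b) \<in> set w \<Longrightarrow> 1 \<le> k"
  shows "bdd (letter_trace w)"
proof -
  have "bdd (letter_trace (u @ v))" if "\<And>i k b. (i, k, b) \<in> set u \<Longrightarrow> 1 \<le> k \<and> \<not> b" "\<And>i k b. (i, k, b) \<in> set v \<Longrightarrow> 1 \<le> k" for u v
    using that
  proof (induction v arbitrary: u)
    case Nil
    have "bdd (letter_trace u)" by (rule bdd_letter_trace_raw) (rule Nil.prems(1))
    then show ?case by simp
  next
    case (Cons x v)
    obtain i k b where x: "x = (i, k, b)" by (cases x)
    have k: "1 \<le> k" using Cons.prems(2)[of i k b] x by simp
    have raw: "bdd (letter_trace (u @ (i, k, False) # v))"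
    proof -
      have "bdd (letter_trace ((u @ [(i, k, False)]) @ v))"
      proof (rule Cons.IH)
        show "1 \<le> k' \<and> \<not> b'" if "(i', k', b') \<in> set (u @ [(i, k, False)])" for i' k' b'
          using that Cons.prems(1)[of i' k' b'] k by auto
        show "1 \<le> k'" if "(i', k', b') \<in> set v" for i' k' b' using that Cons.prems(2)[of i' k' b'] by simp
      qed
      then show ?thesis by simp
    qed
    show ?case
    proof (cases b)
      case True
      have "bdd (letter_trace (u @ v))" by (rule Cons.IH) (use Cons.prems in \<open>meson list.set_intros(2)\<close>)+
      then have "bdd (\<lambda>n \<omega>. letter_trace (u @ (i, k, False) # v) n \<omega> + (- 1) * (tau n (mpow n (W n i \<omega>) k) * letter_trace (u @ v) n \<omega>))"
        by (intro bdd_add bdd_mult bdd_const raw bdd_tau_mpow k)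
      moreover have "letter_trace (u @ x # v) = (\<lambda>n \<omega>. letter_trace (u @ (i, k, False) # v) n \<omega> + (- 1) * (tau n (mpow n (W n i \<omega>) k) * letter_trace (u @ v) n \<omega>))"
        using True by (simp add: x letter_trace_centre fun_eq_iff)
      ultimately show ?thesis by simp
    next
      case False
      then show ?thesis using raw x by simp
    qed
  qed
  from this[of "[]" w] show ?thesis using assms by simp
qed

lemma null_mean: "null (\<lambda>n \<omega>. tau n (mpow n (W n i \<omega>) 1))"
  using conv_in_prob_imp_conv[OF mean bdd_tau_mpow] by (simp only: conv_def diff_zero order_refl)

lemma conv_variance: "conv (\<lambda>n \<omega>. tau n (mpow n (W n i \<omega>) 2)) 1"
  by (rule conv_in_prob_imp_conv[OF variance bdd_tau_mpow]) simp

text \<open>Centring a first power changes the trace by the normalised trace of that matrix, which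
  is null, times a bounded trace. The prefix \<open>u\<close> holds the letters already
  treated.\<close>

lemma null_centre_all:
  assumes "\<forall>(i, k, b)\<in>set u. 1 \<le> k" "\<forall>(i, k, b)\<in>set v. k = (if b then 2 else 1)"
  shows "null (\<lambda>n \<omega>. letter_trace (u @ v) n \<omega> - letter_trace (u @ map (\<lambda>(i, k, b). (i, k, True)) v) n \<omega>)"
  using assms
proof (induction v arbitrary: u)
  case (Cons x v)
  obtain i k b where x: "x = (i, k, b)" by (cases x)
  let ?c = "\<lambda>(i, k, b). (i, k, True)"
  have k: "k = (if b then 2 else 1)" using Cons.prems(2) x by simp
  have v: "\<forall>(i, k, b)\<in>set v. k = (if b then 2 else 1)" using Cons.prems(2) by simp
  have u': "\<forall>(i, k, b)\<in>set (u @ [(i, k, True)]). 1 \<le> k" using Cons.prems(1) k by auto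
  have IH: "null (\<lambda>n \<omega>. letter_trace (u @ (i, k, True) # v) n \<omega> - letter_trace (u @ (i, k, True) # map ?c v) n \<omega>)"
    using Cons.IH[OF u' v] by simp
  show ?case
  proof (cases b)
    case True
    then show ?thesis using IH x by simp
  next
    case False
    have "bdd (letter_trace (u @ v))"
    proof (rule bdd_letter_trace)
      fix i' k' b' assume "(i', k', b') \<in> set (u @ v)"
      then consider "(i', k', b') \<in> set u" | "(i', k', b') \<in> set v" by auto
      then show "1 \<le> k'"
      proof cases
        case 1
        then show ?thesis using Cons.prems(1) by blast
      next
        case 2
        then have "k' = (if b' then 2 else 1)" using v by blast
        then show ?thesis by simp
      qed
    qed
    from null_add[OF IH null_bdd_mult[OF null_mean[of i] this]]
    show ?thesis using False k by (simp add: x letter_trace_centre algebra_simps)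
  qed
qed simp

lemma letter_trace_merge:
  "letter_trace (u @ (i, 1, False) # (i, 1, False) # v) n \<omega>
    = letter_trace (u @ (i, 2, True) # v) n \<omega> + tau n (mpow n (W n i \<omega>) 2) * letter_trace (u @ v) n \<omega>"
proof -
  let ?u = "map (letter_mat n \<omega>) u" and ?v = "map (letter_mat n \<omega>) v"
  let ?A = "mpow n (W n i \<omega>) 1"
  have "letter_trace (u @ (i, 1, False) # (i, 1, False) # v) n \<omega> = ttr n (?u @ ?A # ?A # ?v)"
    unfolding letter_trace_def map_append list.map letter_mat_False ..
  also have "\<dots> = ttr n (?u @ mmult n ?A ?A # ?v)" by (rule ttr_mmult[symmetric])
  \<comment> \<open>\<open>ttr_lin\<close> with coefficient zero serves as a congruence rule: the
    product and the power are only known to agree on rows below \<open>n\<close>.\<close>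
  also have "\<dots> = ttr n (?u @ mpow n (W n i \<omega>) 2 # ?v) + 0 * ttr n (?u @ mpow n (W n i \<omega>) 2 # ?v)"
  proof (rule ttr_lin)
    fix r c assume "r < n" "c < n"
    then show "mmult n ?A ?A r c = mpow n (W n i \<omega>) 2 r c + 0 * mpow n (W n i \<omega>) 2 r c"
      using mpow_add[of r n "W n i \<omega>" 1 1 c] by (simp only: one_add_one mult_zero_left add_0_right)
  qed
  also have "\<dots> = letter_trace (u @ (i, 2, False) # v) n \<omega>"
    unfolding letter_trace_def map_append list.map letter_mat_False by simp
  finally show ?thesis by (simp only: letter_trace_centre) simp
qed

lemma conv_centred:
  assumes ne: "w \<noteq> []" and k: "\<forall>(i, k, b)\<in>set w. 1 \<le> k"
    and adj: "\<And>j. Suc j < length w \<Longrightarrow> fst (w ! j) \<noteq> fst (w ! Suc j)"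
  shows "conv (letter_trace (map (\<lambda>(i, k, b). (i, k, True)) w)) 0"
proof (rule conv_in_prob_imp_conv)
  let ?c = "\<lambda>(i, k, b). (i, k, True)"
  show "bdd (letter_trace (map ?c w))" by (rule bdd_letter_trace) (use k in auto)
  let ?is = "map fst w" and ?ps = "map (fst \<circ> snd) w"
  \<comment> \<open>Any strict bound on the indices in \<open>w\<close> will do: it selects a finite
    family to which freeness applies.\<close>
  define K where "K = Suc (Max (set ?is))"
  have "admissible_word K ?is ?ps"
    unfolding admissible_word_def
  proof (intro conjI allI impI)
    show "set ?is \<subseteq> {..<K}"
    proof
      fix x assume "x \<in> set ?is"
      then have "x \<le> Max (set ?is)" by (intro Max_ge) auto
      then show "x \<in> {..<K}" by (simp add: K_def less_Suc_eq_le)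
    qed
    show "?is ! j \<noteq> ?is ! Suc j" if "Suc j < length ?is" for j using adj that by simp
    show "\<forall>p\<in>set ?ps. 1 \<le> p" using k by auto
  qed (use ne in auto)
  with free[of K] have "conv_in_prob M (\<lambda>n \<omega>. ttr n (map (\<lambda>(i, p). centered_prob n (W n i \<omega>) p) (zip ?is ?ps))) 0"
    unfolding asym_free_in_prob_def by blast
  moreover have "map (\<lambda>(i, p). centered_prob n (W n i \<omega>) p) (zip ?is ?ps) = map (letter_mat n \<omega>) (map ?c w)" for n \<omega>
    by (induction w) (auto simp: letter_mat_def centered_prob_def fun_eq_iff)
  ultimately show "conv_in_prob M (letter_trace (map ?c w)) 0" unfolding letter_trace_def by (simp only:)
qed

text \<open>Induction on the length. If no neighbours share an index, all letters may be centred and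
  freeness gives zero, in agreement with the fact that a nonempty noncrossing word pairs some
  neighbours. Otherwise two first powers meet; they split into a centred square, whose word has
  limit zero, and a scalar tending to one in front of the word with the pair deleted.\<close>

lemma conv_letter_trace: "reduced w \<Longrightarrow> conv (letter_trace w) (word_limit w)"
proof (induction "length w" arbitrary: w rule: less_induct)
  case less
  have deg: "\<forall>(i, k, b)\<in>set w. k = (if b then 2 else 1)" and cnt: "\<And>x. count_list (spread w) x \<le> 2"
    using less.prems unfolding reduced_def by blast+
  show ?case
  proof (cases "w = []")
    case True
    have "letter_trace [] = (\<lambda>n \<omega>. tau n mone)" by (simp add: letter_trace_def fun_eq_iff)
    then show ?thesis using conv_tau_mone True by (simp add: word_limit_def)
  next
    case ne: False
    show ?thesis
    proof (cases "\<exists>j. Suc j < length w \<and> fst (w ! j) = fst (w ! Suc j)")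
      case False
      have "1 \<le> k" if "(i, k, b) \<in> set w" for i k b
      proof -
        have "k = (if b then 2 else 1)" using deg that by blast
        then show ?thesis by simp
      qed
      then have k: "\<forall>(i, k, b)\<in>set w. 1 \<le> k" by blast
      have "conv (letter_trace (map (\<lambda>(i, k, b). (i, k, True)) w)) 0"
        by (rule conv_centred[OF ne k]) (use False in blast)
      moreover have "null (\<lambda>n \<omega>. letter_trace w n \<omega> - letter_trace (map (\<lambda>(i, k, b). (i, k, True)) w) n \<omega>)"
        using null_centre_all[of "[]" w] deg by simp
      ultimately have "conv (letter_trace w) 0" by (rule conv_null_cong)
      moreover have "\<not> nc_word (map fst w)"
        by (rule not_nc_word_if_no_neighbours) (use ne False in auto)
      ultimately show ?thesis by (simp add: word_limit_def)
    next
      case True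
      then obtain j where j: "Suc j < length w" "fst (w ! j) = fst (w ! Suc j)" by blast
      define u where "u = take j w"
      define v where "v = drop (Suc (Suc j)) w"
      obtain i k b k' b' where xy: "w ! j = (i, k, b)" "w ! Suc j = (i, k', b')"
        using j(2) by (metis fst_conv prod.collapse)
      have w: "w = u @ (i, k, b) # (i, k', b') # v"
        using j(1) xy id_take_nth_drop[of j w] Cons_nth_drop_Suc[of "Suc j" w] by (simp add: u_def v_def)
      have kk: "k = (if b then 2 else 1)" "k' = (if b' then 2 else 1)" using deg unfolding w by simp_all
      have "count_list (spread w) i = count_list (spread u) i + (k + (k' + count_list (spread v) i))"
        by (simp add: w count_list_replicate)
      \<comment> \<open>Two equal neighbours exhaust the total degree two, so neither is a square
        and the index occurs nowhere else.\<close>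
      then have cc: "count_list (spread u) i = 0" "count_list (spread v) i = 0" "\<not> b" "\<not> b'"
        using cnt[of i] kk by (auto split: if_splits)
      have w': "w = u @ (i, 1, False) # (i, 1, False) # v" using w kk cc by simp
      have notin: "i \<notin> set (map fst z)" if z: "count_list (spread z) i = 0" "set z \<subseteq> set w" for z
      proof
        assume "i \<in> set (map fst z)"
        then obtain k b where x: "(i, k, b) \<in> set z" by auto
        then have "k = (if b then 2 else 1)" using deg z(2) by blast
        moreover obtain z1 z2 where "z = z1 @ (i, k, b) # z2" using split_list[OF x] by blast
        ultimately have "count_list (spread z) i \<noteq> 0" by (simp add: count_list_replicate split: if_splits)
        then show False using z(1) by simp
      qed
      have "set u \<subseteq> set w" "set v \<subseteq> set w" unfolding w' by auto
      then have iuv: "i \<notin> set (map fst u)" "i \<notin> set (map fst v)" using notin cc by blast+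
      have red1: "reduced (u @ (i, 2, True) # v)"
      proof -
        have "count_list (spread (u @ (i, 2, True) # v)) x = count_list (spread w) x" for x
          unfolding w' by (simp add: numeral_2_eq_2)
        then show ?thesis using deg cnt unfolding reduced_def w' by simp
      qed
      have red2: "reduced (u @ v)"
      proof -
        have "count_list (spread (u @ v)) x \<le> 2" for x
          using cnt[of x] unfolding w' by (simp split: if_splits)
        then show ?thesis using deg unfolding reduced_def w' by simp
      qed
      have "conv (letter_trace (u @ (i, 2, True) # v)) (word_limit (u @ (i, 2, True) # v))"
        by (rule less.hyps[OF _ red1]) (simp add: w')
      moreover have "conv (letter_trace (u @ v)) (word_limit (u @ v))"
        by (rule less.hyps[OF _ red2]) (simp add: w')
      ultimately have "conv (\<lambda>n \<omega>. letter_trace (u @ (i, 2, True) # v) n \<omega> + tau n (mpow n (W n i \<omega>) 2) * letter_trace (u @ v) n \<omega>)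
          (word_limit (u @ (i, 2, True) # v) + 1 * word_limit (u @ v))"
        by (intro conv_add conv_mult conv_variance)
      moreover have "letter_trace w = (\<lambda>n \<omega>. letter_trace (u @ (i, 2, True) # v) n \<omega> + tau n (mpow n (W n i \<omega>) 2) * letter_trace (u @ v) n \<omega>)"
        unfolding w' by (intro ext letter_trace_merge)
      moreover have "word_limit (u @ (i, 2, True) # v) + 1 * word_limit (u @ v) = word_limit w"
        using nc_word_collapse[OF iuv] unfolding word_limit_def w' by simp
      ultimately show ?thesis by simp
    qed
  qed
qed

lemma letter_trace_W: "letter_trace (map (\<lambda>i. (i, 1, False)) w) = (\<lambda>n \<omega>. ttr n (map (\<lambda>i. W n i \<omega>) w))"
proof (intro ext)
  fix n \<omega>
  have "ttr n (map (\<lambda>i. letter_mat n \<omega> (i, 1, False)) w) = ttr n (map (\<lambda>i. W n i \<omega>) w)"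
    by (rule ttr_map_cong) (unfold letter_mat_False entries_eq_def, blast intro: mpow_1)
  then show "letter_trace (map (\<lambda>i. (i, 1, False)) w) n \<omega> = ttr n (map (\<lambda>i. W n i \<omega>) w)" by (simp add: letter_trace_def o_def)
qed

lemma conv_ttr_W:
  assumes "\<And>x. count_list w x \<le> 2"
  shows "conv (\<lambda>n \<omega>. ttr n (map (\<lambda>i. W n i \<omega>) w)) (of_nat (nc_count w))"
proof -
  let ?w = "map (\<lambda>i. (i, 1, False)) w"
  have sp: "spread ?w = w" by (induction w) simp_all
  have "reduced ?w" unfolding reduced_def sp using assms by auto
  then have "conv (letter_trace ?w) (word_limit ?w)" by (rule conv_letter_trace)
  moreover have "word_limit ?w = of_nat (nc_count w)"
    using nc_count_eq_nc_word[OF assms] by (simp add: word_limit_def o_def)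
  ultimately show ?thesis unfolding letter_trace_W by simp
qed

lemma bdd_ttr_W: "bdd (\<lambda>n \<omega>. ttr n (map (\<lambda>i. W n i \<omega>) w))"
  unfolding letter_trace_W[symmetric] by (rule bdd_letter_trace) auto

section \<open>Centred tensors and the removal of their mean\<close>

definition T :: "nat \<Rightarrow> nat \<Rightarrow> cmat" where
  "T n i = mexp (M n) (n\<^sup>2) (\<lambda>\<omega>. kron_conj n (W n i \<omega>))"

definition X :: "nat \<Rightarrow> nat \<Rightarrow> 'a \<Rightarrow> cmat" where
  "X n i \<omega> = (\<lambda>r c. kron_conj n (W n i \<omega>) r c - T n i r c)"

lemma hermitian_T: "hermitian_mat (n\<^sup>2) (T n i)"
  unfolding hermitian_mat_def
proof (intro allI impI)
  fix r c assume rc: "r < n\<^sup>2" "c < n\<^sup>2"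
  have "T n i c r = integral\<^sup>L (M n) (\<lambda>\<omega>. kron_conj n (W n i \<omega>) c r)" using rc by (simp add: T_def mexp_def)
  also have "\<dots> = integral\<^sup>L (M n) (\<lambda>\<omega>. cnj (kron_conj n (W n i \<omega>) r c))"
    using hermitian_kron_conj[OF herm_W] rc unfolding hermitian_mat_def
    by (intro Bochner_Integration.integral_cong refl) blast
  also have "\<dots> = cnj (T n i r c)" using rc by (simp add: T_def mexp_def)
  finally show "T n i c r = cnj (T n i r c)" .
qed

text \<open>The flag chooses between the two summands of \<open>X\<close>; \<open>True\<close> marks
  a factor \<open>T\<close>, and the sign is kept inside that summand.\<close>

definition summand :: "nat \<Rightarrow> 'a \<Rightarrow> bool \<Rightarrow> nat \<Rightarrow> cmat" where
  "summand n \<omega> b i = (\<lambda>r c. if b then - T n i r c else kron_conj n (W n i \<omega>) r c)"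

lemma all_moments_summand: "all_moments (M n) (\<lambda>\<omega>. summand n \<omega> b i r c)"
proof -
  interpret prob_space "M n" by (rule prob)
  show ?thesis unfolding summand_def by (cases b) (auto intro!: all_moments_kron_conj all_moments_W)
qed

text \<open>Rescaling the factors \<open>T\<close> by a large constant \<open>s\<close> does not spoil the chessboard bound in the limit, since
  the normalised trace moments of \<open>T\<close> vanish; but it gains a factor \<open>1 / s\<close>.\<close>

lemma null_word_with_T:
  assumes t: "(True, i0) \<in> set z"
  shows "null (\<lambda>n \<omega>. ttr (n\<^sup>2) (map (\<lambda>(b, i). summand n \<omega> b i) z))"
proof -
  interpret prob_space "M n" for n by (rule prob)
  let ?q = "2 * length z"
  have zne: "z \<noteq> []" using t by auto
  then have q: "1 \<le> ?q" by (cases z) auto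
  let ?k = "\<lambda>x n \<omega>. tau (n\<^sup>2) (mpow (n\<^sup>2) (kron_conj n (W n (snd x) \<omega>)) ?q)"
  let ?S = "\<lambda>n \<omega>. complex_of_real (\<Sum>x\<in>set z. cmod (?k x n \<omega>))"
  show ?thesis
  proof (rule null_squeeze[where S="?S"])
    show "all_moments (M n) (\<lambda>\<omega>. ttr (n\<^sup>2) (map (\<lambda>(b, i). summand n \<omega> b i) z))" for n
      by (rule all_moments_ttr) (auto simp: all_moments_summand)
    show "bdd ?S"
    proof (rule bdd_norm_sum_tau)
      fix x
      let ?t = "\<lambda>n \<omega>. tau n (mpow n (W n (snd x) \<omega>) ?q)"
      have "bdd (\<lambda>n \<omega>. ?t n \<omega> * cnj (?t n \<omega>))" by (intro bdd_mult bdd_cnj bdd_tau_mpow q)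
      then show "bdd (?k x)" unfolding tau_mpow_kron_conj by (simp only: complex_norm_square)
    qed
    fix \<delta> :: real assume d: "0 < \<delta>"
    \<comment> \<open>One rescaled factor gains \<open>1 / s\<^sup>2 \<le> \<delta>\<close> after
      squaring; the lower bound 1 ensures that further factors \<open>T\<close> do not lose it
      again.\<close>
    define s where "s = max 1 (1 / sqrt \<delta>)"
    have s: "1 \<le> s" "1 / s\<^sup>2 \<le> \<delta>"
    proof -
      show "1 \<le> s" by (simp add: s_def)
      have "1 / sqrt \<delta> \<le> s" by (simp add: s_def)
      then have "(1 / sqrt \<delta>)\<^sup>2 \<le> s\<^sup>2" using d by (intro power_mono) auto
      then have "1 / \<delta> \<le> s\<^sup>2" using d by (simp add: power_divide)
      then show "1 / s\<^sup>2 \<le> \<delta>" using d \<open>1 \<le> s\<close> by (simp add: field_simps)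
    qed
    define sc where "sc = (\<lambda>x::bool \<times> nat. if fst x then complex_of_real s else 1)"
    \<comment> \<open>The deterministic part of the chessboard bound. For fixed \<open>s\<close> it
      tends to zero, however large \<open>s ^ ?q\<close> is.\<close>
    define a where "a = (\<lambda>n. \<Sum>x\<in>set z. s ^ ?q * cmod (tau (n\<^sup>2) (mpow (n\<^sup>2) (T n (snd x)) ?q)))"
    have "a \<longlonglongrightarrow> (\<Sum>x\<in>set z. s ^ ?q * cmod 0)"
      unfolding a_def T_def by (intro tendsto_sum tendsto_mult tendsto_const tendsto_norm tensor_mean q)
    then have a0: "a \<longlonglongrightarrow> 0" by simp
    have an: "0 \<le> a n" for n unfolding a_def using s by (intro sum_nonneg) auto
    have main: "(cmod (ttr (n\<^sup>2) (map (\<lambda>(b, i). summand n \<omega> b i) z)))\<^sup>2 \<le> \<delta> * cmod (?S n \<omega>) + \<delta> * a n" for n \<omega>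
    proof -
      let ?Y = "\<lambda>x r c. sc x * summand n \<omega> (fst x) (snd x) r c"
      have herm: "hermitian_mat (n\<^sup>2) (?Y x)" for x
        unfolding hermitian_mat_def
      proof (intro allI impI)
        fix r c assume rc: "r < n\<^sup>2" "c < n\<^sup>2"
        have t: "T n (snd x) c r = cnj (T n (snd x) r c)"
          using hermitian_T[of n "snd x"] rc unfolding hermitian_mat_def by blast
        have k: "kron_conj n (W n (snd x) \<omega>) c r = cnj (kron_conj n (W n (snd x) \<omega>) r c)"
          using hermitian_kron_conj[OF herm_W[of n "snd x" \<omega>]] rc unfolding hermitian_mat_def by blast
        show "?Y x c r = cnj (?Y x r c)"
          unfolding summand_def sc_def t k by (cases "fst x") simp_all
      qed
      have "cmod (\<Prod>x\<leftarrow>z. sc x) \<ge> s"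
      proof -
        have ge1: "1 \<le> cmod (\<Prod>x\<leftarrow>y. sc x)" for y
        proof (induction y)
          case (Cons x y)
          have "1 \<le> cmod (sc x)" using s by (simp add: sc_def)
          then have "1 * 1 \<le> cmod (sc x) * cmod (\<Prod>x\<leftarrow>y. sc x)" using Cons.IH by (intro mult_mono) auto
          then show ?case by (simp add: norm_mult)
        qed simp
        obtain y1 y2 where z: "z = y1 @ (True, i0) # y2" using split_list[OF t] by blast
        have "s * (1 * 1) \<le> s * (cmod (\<Prod>x\<leftarrow>y1. sc x) * cmod (\<Prod>x\<leftarrow>y2. sc x))"
          using ge1 s by (intro mult_left_mono mult_mono) auto
        also have "\<dots> = cmod (\<Prod>x\<leftarrow>z. sc x)" using s by (simp add: z norm_mult sc_def)
        finally show ?thesis by simp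
      qed
      then have "s * cmod (ttr (n\<^sup>2) (map (\<lambda>(b, i). summand n \<omega> b i) z))
          \<le> cmod (\<Prod>x\<leftarrow>z. sc x) * cmod (ttr (n\<^sup>2) (map (\<lambda>(b, i). summand n \<omega> b i) z))"
        by (rule mult_right_mono) simp
      also have "\<dots> = cmod (ttr (n\<^sup>2) (map ?Y z))"
        unfolding ttr_scale norm_mult case_prod_beta' ..
      finally have "(s * cmod (ttr (n\<^sup>2) (map (\<lambda>(b, i). summand n \<omega> b i) z)))\<^sup>2 \<le> (cmod (ttr (n\<^sup>2) (map ?Y z)))\<^sup>2"
        using s by (intro power_mono) auto
      also have "\<dots> \<le> (\<Sum>x\<in>set z. cmod (tau (n\<^sup>2) (mpow (n\<^sup>2) (?Y x) ?q)))"
        by (rule chessboard_map[OF herm zne])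
      also have "\<dots> \<le> (\<Sum>x\<in>set z. cmod (?k x n \<omega>) + s ^ ?q * cmod (tau (n\<^sup>2) (mpow (n\<^sup>2) (T n (snd x)) ?q)))"
      proof (rule sum_mono)
        fix x :: "bool \<times> nat"
        have pos: "0 \<le> s ^ ?q * cmod (tau (n\<^sup>2) (mpow (n\<^sup>2) (T n (snd x)) ?q))" using s by simp
        show "cmod (tau (n\<^sup>2) (mpow (n\<^sup>2) (?Y x) ?q))
            \<le> cmod (?k x n \<omega>) + s ^ ?q * cmod (tau (n\<^sup>2) (mpow (n\<^sup>2) (T n (snd x)) ?q))"
        proof (cases "fst x")
          case True
          have "?Y x = (\<lambda>r c. (- complex_of_real s) * T n (snd x) r c)"
            using True by (simp add: fun_eq_iff sc_def summand_def)
          then have "cmod (tau (n\<^sup>2) (mpow (n\<^sup>2) (?Y x) ?q)) = s ^ ?q * cmod (tau (n\<^sup>2) (mpow (n\<^sup>2) (T n (snd x)) ?q))"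
            using s by (simp only: tau_mpow_scale norm_mult norm_power norm_minus_cancel norm_of_real)
          then show ?thesis by simp
        next
          case False
          have "?Y x = kron_conj n (W n (snd x) \<omega>)"
            using False by (simp add: fun_eq_iff sc_def summand_def)
          then show ?thesis using pos by (simp only:)
        qed
      qed
      also have "\<dots> = cmod (?S n \<omega>) + a n"
        unfolding a_def sum.distrib norm_of_real by (simp add: sum_nonneg)
      finally have "s\<^sup>2 * (cmod (ttr (n\<^sup>2) (map (\<lambda>(b, i). summand n \<omega> b i) z)))\<^sup>2 \<le> cmod (?S n \<omega>) + a n"
        by (simp only: power_mult_distrib)
      moreover have "x \<le> 1 / s\<^sup>2 * y" if "s\<^sup>2 * x \<le> y" for x y
      proof -
        have "0 < s\<^sup>2" using s by simp
        then show ?thesis using that by (simp add: field_simps)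
      qed
      ultimately have "(cmod (ttr (n\<^sup>2) (map (\<lambda>(b, i). summand n \<omega> b i) z)))\<^sup>2 \<le> 1 / s\<^sup>2 * (cmod (?S n \<omega>) + a n)"
        by blast
      also have "\<dots> \<le> \<delta> * (cmod (?S n \<omega>) + a n)"
        using s an by (intro mult_right_mono) auto
      finally show ?thesis by (simp only: distrib_left)
    qed
    have "(\<lambda>n. \<delta> * a n) \<longlonglongrightarrow> \<delta> * 0" by (intro tendsto_mult tendsto_const a0)
    then show "\<exists>a. a \<longlonglongrightarrow> 0 \<and> (\<forall>n. \<forall>\<omega>\<in>space (M n).
        (cmod (ttr (n\<^sup>2) (map (\<lambda>(b, i). summand n \<omega> b i) z)))\<^sup>2 \<le> \<delta> * cmod (?S n \<omega>) + a n)"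
      using main by (intro exI[of _ "\<lambda>n. \<delta> * a n"]) simp
  qed
qed

text \<open>When every \<open>X\<close> is expanded into tensor and mean, the choice without
  \<open>T\<close> gives the squared modulus and each of the finitely many others contains
  \<open>T\<close>.\<close>

lemma null_ttr_X:
  "null (\<lambda>n \<omega>. ttr (n\<^sup>2) (map (\<lambda>i. X n i \<omega>) w) - complex_of_real ((cmod (ttr n (map (\<lambda>i. W n i \<omega>) w)))\<^sup>2))"
proof -
  let ?B = "words (UNIV :: bool set) (length w)"
  let ?F = "replicate (length w) False"
  have "ttr (n\<^sup>2) (map (\<lambda>i. X n i \<omega>) w)
      = complex_of_real ((cmod (ttr n (map (\<lambda>i. W n i \<omega>) w)))\<^sup>2)
       + (\<Sum>bs\<in>?B - {?F}. ttr (n\<^sup>2) (map (\<lambda>(b, i). summand n \<omega> b i) (zip bs w)))" for n \<omega>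
  proof -
    have "ttr (n\<^sup>2) (map (\<lambda>i. X n i \<omega>) w) = ttr (n\<^sup>2) (map (\<lambda>i r c. \<Sum>b\<in>UNIV. summand n \<omega> b i r c) w)"
      by (simp add: X_def summand_def UNIV_bool)
    also have "\<dots> = (\<Sum>bs\<in>?B. ttr (n\<^sup>2) (map2 (summand n \<omega>) bs w))" by (rule ttr_sum) simp
    also have "\<dots> = ttr (n\<^sup>2) (map2 (summand n \<omega>) ?F w) + (\<Sum>bs\<in>?B - {?F}. ttr (n\<^sup>2) (map2 (summand n \<omega>) bs w))"
    proof (rule sum.remove)
      show "?F \<in> ?B" by (simp add: words_def)
    qed (rule finite_words, simp)
    also have "map2 (summand n \<omega>) ?F w = map (\<lambda>i. kron_conj n (W n i \<omega>)) w"
      by (induction w) (simp_all add: summand_def fun_eq_iff)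
    finally show ?thesis by (simp only: ttr_kron_conj)
  qed
  then have "(\<lambda>n \<omega>. ttr (n\<^sup>2) (map (\<lambda>i. X n i \<omega>) w) - complex_of_real ((cmod (ttr n (map (\<lambda>i. W n i \<omega>) w)))\<^sup>2))
      = (\<lambda>n \<omega>. \<Sum>bs\<in>?B - {?F}. ttr (n\<^sup>2) (map (\<lambda>(b, i). summand n \<omega> b i) (zip bs w)))"
    by (simp only: add_diff_cancel_left')
  moreover have "null (\<lambda>n \<omega>. \<Sum>bs\<in>?B - {?F}. ttr (n\<^sup>2) (map (\<lambda>(b, i). summand n \<omega> b i) (zip bs w)))"
  proof (rule null_sum)
    fix bs assume "bs \<in> ?B - {?F}"
    then have len: "length bs = length w" and ne: "bs \<noteq> ?F" by (auto simp: words_def)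
    have "\<exists>j<length bs. bs ! j"
    proof (rule ccontr)
      assume "\<not> ?thesis"
      then have "bs = ?F" using len by (intro nth_equalityI) auto
      then show False using ne by simp
    qed
    then obtain j where "j < length bs" "bs ! j" by blast
    then have "(True, w ! j) \<in> set (zip bs w)" using len by (auto simp: set_zip)
    then show "null (\<lambda>n \<omega>. ttr (n\<^sup>2) (map (\<lambda>(b, i). summand n \<omega> b i) (zip bs w)))" by (rule null_word_with_T)
  qed
  ultimately show ?thesis by simp
qed

lemma conv_ttr_X:
  assumes "\<And>x. count_list w x \<le> 2"
  shows "conv (\<lambda>n \<omega>. ttr (n\<^sup>2) (map (\<lambda>i. X n i \<omega>) w)) (of_nat (nc_count w))"
proof -
  \<comment> \<open>Here the count is 0 or 1 and hence equals its square, so the tensor square does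
    not change the limit.\<close>
  have "complex_of_real ((cmod (of_nat (nc_count w)))\<^sup>2) = of_nat (nc_count w)"
    unfolding nc_count_eq_nc_word[OF assms] by simp
  then show ?thesis
    using conv_null_cong[OF conv_norm_sq[OF conv_ttr_W[OF assms]] null_ttr_X] by (simp only:)
qed

text \<open>Holds for arbitrary words: those with a letter occurring three times or more have no
  limit identified, yet their contribution must be bounded.\<close>

lemma bdd_ttr_X: "bdd (\<lambda>n \<omega>. ttr (n\<^sup>2) (map (\<lambda>i. X n i \<omega>) w))"
proof -
  let ?t = "\<lambda>n \<omega>. ttr n (map (\<lambda>i. W n i \<omega>) w)"
  have "bdd (\<lambda>n \<omega>. ?t n \<omega> * cnj (?t n \<omega>))" by (intro bdd_mult bdd_cnj bdd_ttr_W)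
  then have "bdd (\<lambda>n \<omega>. complex_of_real ((cmod (?t n \<omega>))\<^sup>2))" by (simp only: complex_norm_square)
  from bdd_add[OF null_imp_bdd[OF null_ttr_X[of w]] this] show ?thesis by simp
qed

end

section \<open>Mixed moments of independent identically distributed matrices\<close>

text \<open>The index set, coefficients and entry positions depend on \<open>p\<close> and
  \<open>N\<close> alone; the word only decides from which matrix each entry is taken. This is what
  lets patterns determine moments.\<close>

lemma ttr_expand:
  "\<exists>(I :: (nat \<times> nat list) set) c \<alpha> \<beta>. finite I \<and> (\<forall>\<kappa>\<in>I. \<forall>t<p. \<alpha> \<kappa> t < N \<and> \<beta> \<kappa> t < N) \<and>
     (\<forall>(f :: nat \<Rightarrow> cmat) w. length w = p \<longrightarrow>
        ttr N (map f w) = (\<Sum>\<kappa>\<in>I. c \<kappa> * (\<Prod>t<p. f (w ! t) (\<alpha> \<kappa> t) (\<beta> \<kappa> t))))"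
proof (intro exI conjI ballI allI impI)
  let ?I = "{..<N} \<times> words {..<N} p"
  let ?c = "\<lambda>\<kappa>. mone ((fst \<kappa> # snd \<kappa>) ! p) (fst \<kappa>) / of_nat N"
  let ?\<alpha> = "\<lambda>\<kappa> t. (fst \<kappa> # snd \<kappa>) ! t" and ?\<beta> = "\<lambda>\<kappa> t. snd \<kappa> ! t"
  show "finite ?I" by simp
  fix \<kappa> t assume k: "\<kappa> \<in> ?I" and t: "t < p"
  have s: "set (snd \<kappa>) \<subseteq> {..<N}" "length (snd \<kappa>) = p" "fst \<kappa> < N" using k by (auto simp: words_def)
  have "(fst \<kappa> # snd \<kappa>) ! t \<in> set (fst \<kappa> # snd \<kappa>)" using s t by (intro nth_mem) simp
  then show "?\<alpha> \<kappa> t < N" using s by auto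
  have "snd \<kappa> ! t \<in> set (snd \<kappa>)" using s t by (intro nth_mem) simp
  then show "?\<beta> \<kappa> t < N" using s by auto
next
  let ?I = "{..<N} \<times> words {..<N} p"
  let ?c = "\<lambda>\<kappa>. mone ((fst \<kappa> # snd \<kappa>) ! p) (fst \<kappa>) / of_nat N"
  fix f :: "nat \<Rightarrow> cmat" and w :: "nat list" assume w: "length w = p"
  have "ttr N (map f w) = (\<Sum>r<N. \<Sum>ks\<in>words {..<N} p.
      (\<Prod>t<p. f (w ! t) ((r # ks) ! t) (ks ! t)) * mone ((r # ks) ! p) r) / of_nat N"
    unfolding tau_def mtrace_def mlist_prod_indices using w by simp
  also have "\<dots> = (\<Sum>r<N. \<Sum>ks\<in>words {..<N} p.
      (mone ((r # ks) ! p) r / of_nat N) * (\<Prod>t<p. f (w ! t) ((r # ks) ! t) (ks ! t)))"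
    by (simp add: sum_divide_distrib mult.commute)
  also have "\<dots> = (\<Sum>\<kappa>\<in>?I. ?c \<kappa> * (\<Prod>t<p. f (w ! t) ((fst \<kappa> # snd \<kappa>) ! t) (snd \<kappa> ! t)))"
    unfolding sum.cartesian_product by (intro sum.cong) auto
  finally show "ttr N (map f w) = (\<Sum>\<kappa>\<in>?I. ?c \<kappa> * (\<Prod>t<p. f (w ! t) ((fst \<kappa> # snd \<kappa>) ! t) (snd \<kappa> ! t)))" .
qed

text \<open>A tensor entry as a function on \<open>mat_space\<close>, the form in which independence
  and equality in law can be applied.\<close>

definition kron_entry :: "nat \<Rightarrow> (nat \<times> nat \<Rightarrow> complex) \<Rightarrow> nat \<Rightarrow> nat \<Rightarrow> complex" where
  "kron_entry n m r c = m (r div n, c div n) * cnj (m (r mod n, c mod n))"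

lemma div_mod_less_square: "r < n\<^sup>2 \<Longrightarrow> r div n < n \<and> r mod n < (n::nat)"
  by (cases "n = 0") (auto simp: power2_eq_square less_mult_imp_div_less)

lemma kron_conj_eq_kron_entry: "r < n\<^sup>2 \<Longrightarrow> c < n\<^sup>2 \<Longrightarrow> kron_conj n A r c = kron_entry n (mat_rv n A) r c"
  using div_mod_less_square[of r n] div_mod_less_square[of c n]
  by (simp add: kron_conj_def kron_def mconj_def kron_entry_def mat_rv_def)

lemma measurable_kron_entry:
  assumes "r < n\<^sup>2" "c < n\<^sup>2"
  shows "(\<lambda>m. kron_entry n m r c) \<in> borel_measurable (mat_space n)"
proof -
  have comp: "(\<lambda>m. m x) \<in> borel_measurable (mat_space n)" if "x \<in> {..<n} \<times> {..<n}" for x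
    unfolding mat_space_def using that by (rule measurable_component_singleton)
  have cnj: "(cnj :: complex \<Rightarrow> complex) \<in> borel_measurable borel"
    by (intro borel_measurable_continuous_onI continuous_on_cnj continuous_on_id)
  show ?thesis
    unfolding kron_entry_def using div_mod_less_square[OF assms(1)] div_mod_less_square[OF assms(2)]
    by (intro borel_measurable_times comp measurable_compose[OF comp cnj]) auto
qed

text \<open>One fixed dimension, with the matrices as given: independence and equality in law are
  statements about these, and the consequences are transferred to truncated matrices later.\<close>

locale iid_mats = prob_space M for M :: "'a measure" +
  fixes W :: "nat \<Rightarrow> 'a \<Rightarrow> cmat" and n d :: nat
  assumes all_moments_W: "\<And>i r c. i < d \<Longrightarrow> r < n \<Longrightarrow> c < n \<Longrightarrow> all_moments M (\<lambda>\<omega>. W i \<omega> r c)"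
    and indep: "indep_vars (\<lambda>_. mat_space n) (\<lambda>i \<omega>. mat_rv n (W i \<omega>)) {..<d}"
    and ident: "\<And>i. i < d \<Longrightarrow> distr M (mat_space n) (\<lambda>\<omega>. mat_rv n (W i \<omega>))
                          = distr M (mat_space n) (\<lambda>\<omega>. mat_rv n (W 0 \<omega>))"
begin

definition mean_kron_conj :: "nat \<Rightarrow> cmat" where
  "mean_kron_conj i = mexp M (n\<^sup>2) (\<lambda>\<omega>. kron_conj n (W i \<omega>))"

definition Xc :: "nat \<Rightarrow> 'a \<Rightarrow> cmat" where
  "Xc i \<omega> = (\<lambda>r c. kron_conj n (W i \<omega>) r c - mean_kron_conj i r c)"

lemma measurable_mat_rv: "i < d \<Longrightarrow> (\<lambda>\<omega>. mat_rv n (W i \<omega>)) \<in> measurable M (mat_space n)"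
  using indep unfolding indep_vars_def by blast

lemma expectation_ident:
  fixes g :: "(nat \<times> nat \<Rightarrow> complex) \<Rightarrow> complex"
  assumes "i < d" "g \<in> borel_measurable (mat_space n)"
  shows "expectation (\<lambda>\<omega>. g (mat_rv n (W i \<omega>))) = expectation (\<lambda>\<omega>. g (mat_rv n (W 0 \<omega>)))"
proof -
  have "0 < d" using assms(1) by simp
  have "expectation (\<lambda>\<omega>. g (mat_rv n (W i \<omega>))) = integral\<^sup>L (distr M (mat_space n) (\<lambda>\<omega>. mat_rv n (W i \<omega>))) g"
    by (rule integral_distr[symmetric, OF measurable_mat_rv[OF assms(1)] assms(2)])
  also have "\<dots> = expectation (\<lambda>\<omega>. g (mat_rv n (W 0 \<omega>)))"
    unfolding ident[OF assms(1)] by (rule integral_distr[OF measurable_mat_rv[OF \<open>0 < d\<close>] assms(2)])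
  finally show ?thesis .
qed

lemma all_moments_kron_conj_W: "i < d \<Longrightarrow> r < n\<^sup>2 \<Longrightarrow> c < n\<^sup>2 \<Longrightarrow> all_moments M (\<lambda>\<omega>. kron_conj n (W i \<omega>) r c)"
  unfolding kron_conj_def kron_def mconj_def
  using div_mod_less_square[of r n] div_mod_less_square[of c n]
  by (intro all_moments_mult all_moments_cnj all_moments_W) auto

lemma mean_kron_conj_ident: "i < d \<Longrightarrow> mean_kron_conj i = mean_kron_conj 0"
proof (intro ext)
  fix r c assume i: "i < d"
  show "mean_kron_conj i r c = mean_kron_conj 0 r c"
  proof (cases "r < n\<^sup>2 \<and> c < n\<^sup>2")
    case True
    then have "kron_conj n (W j \<omega>) r c = kron_entry n (mat_rv n (W j \<omega>)) r c" for j \<omega> using kron_conj_eq_kron_entry by blast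
    then show ?thesis
      using expectation_ident[OF i measurable_kron_entry[of r n c]] True by (simp add: mean_kron_conj_def mexp_def)
  qed (auto simp: mean_kron_conj_def mexp_def)
qed

lemma all_moments_Xc: "i < d \<Longrightarrow> r < n\<^sup>2 \<Longrightarrow> c < n\<^sup>2 \<Longrightarrow> all_moments M (\<lambda>\<omega>. Xc i \<omega> r c)"
  unfolding Xc_def by (intro all_moments_diff all_moments_kron_conj_W all_moments_const)

lemma expectation_Xc: "i < d \<Longrightarrow> r < n\<^sup>2 \<Longrightarrow> c < n\<^sup>2 \<Longrightarrow> expectation (\<lambda>\<omega>. Xc i \<omega> r c) = 0"
  unfolding Xc_def using all_moments_integrable[OF all_moments_kron_conj_W]
  by (simp add: mean_kron_conj_def mexp_def prob_space)

text \<open>The contribution of the positions \<open>S\<close> of one letter; index 0 represents the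
  common law.\<close>

definition block_mean :: "(nat \<Rightarrow> nat) \<Rightarrow> (nat \<Rightarrow> nat) \<Rightarrow> nat set \<Rightarrow> complex" where
  "block_mean \<alpha> \<beta> S = expectation (\<lambda>\<omega>. \<Prod>t\<in>S. Xc 0 \<omega> (\<alpha> t) (\<beta> t))"

definition occ :: "nat list \<Rightarrow> nat \<Rightarrow> nat set" where
  "occ l i = {t. t < length l \<and> l ! t = i}"

text \<open>Factors are grouped by letter; independence splits the expectation over letters, and
  equality in law replaces each matrix by the one with index 0. Of the word only the position sets
  \<open>occ l i\<close> remain.\<close>

lemma expectation_monomial:
  assumes l: "set l \<subseteq> {..<d}" and ab: "\<And>t. t < length l \<Longrightarrow> \<alpha> t < n\<^sup>2 \<and> \<beta> t < n\<^sup>2"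
  shows "expectation (\<lambda>\<omega>. \<Prod>t<length l. Xc (l ! t) \<omega> (\<alpha> t) (\<beta> t)) = (\<Prod>i\<in>set l. block_mean \<alpha> \<beta> (occ l i))"
proof -
  let ?Y = "\<lambda>i m. \<Prod>t\<in>occ l i. kron_entry n m (\<alpha> t) (\<beta> t) - mean_kron_conj 0 (\<alpha> t) (\<beta> t)"
  let ?Z = "\<lambda>i \<omega>. \<Prod>t\<in>occ l i. Xc i \<omega> (\<alpha> t) (\<beta> t)"
  have occ: "\<alpha> t < n\<^sup>2" "\<beta> t < n\<^sup>2" if "t \<in> occ l i" for t i
    using that ab unfolding occ_def by blast+
  have Z: "?Z i \<omega> = ?Y i (mat_rv n (W i \<omega>))" if "i < d" for i \<omega>
    using occ by (intro prod.cong refl) (simp add: Xc_def kron_conj_eq_kron_entry mean_kron_conj_ident[OF that])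
  have Ym: "?Y i \<in> borel_measurable (mat_space n)" for i
    using occ by (intro borel_measurable_prod borel_measurable_diff measurable_kron_entry borel_measurable_const)
  have "expectation (\<lambda>\<omega>. \<Prod>t<length l. Xc (l ! t) \<omega> (\<alpha> t) (\<beta> t)) = expectation (\<lambda>\<omega>. \<Prod>i\<in>set l. ?Z i \<omega>)"
  proof (intro Bochner_Integration.integral_cong refl)
    fix \<omega>
    have "(\<Prod>t<length l. Xc (l ! t) \<omega> (\<alpha> t) (\<beta> t)) = (\<Prod>i\<in>set l. \<Prod>t | t \<in> {..<length l} \<and> l ! t = i. Xc (l ! t) \<omega> (\<alpha> t) (\<beta> t))"
      by (rule prod.group[symmetric]) auto
    also have "\<dots> = (\<Prod>i\<in>set l. ?Z i \<omega>)"
      by (intro prod.cong) (auto simp: occ_def)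
    finally show "(\<Prod>t<length l. Xc (l ! t) \<omega> (\<alpha> t) (\<beta> t)) = (\<Prod>i\<in>set l. ?Z i \<omega>)" .
  qed
  also have "\<dots> = (\<Prod>i\<in>set l. expectation (?Z i))"
  proof (rule indep_vars_lebesgue_integral)
    have "indep_vars (\<lambda>_. borel) (\<lambda>i \<omega>. ?Y i (mat_rv n (W i \<omega>))) {..<d}"
      by (rule indep_vars_compose2[OF indep]) (rule Ym)
    then have "indep_vars (\<lambda>_. borel) (\<lambda>i \<omega>. ?Y i (mat_rv n (W i \<omega>))) (set l)"
      using l by (rule indep_vars_subset)
    then show "indep_vars (\<lambda>_. borel) ?Z (set l)"
      by (rule indep_vars_cong[THEN iffD1, rotated -1]) (use l Z in auto)
    show "integrable M (?Z i)" if "i \<in> set l" for i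
      using that l occ by (intro all_moments_integrable all_moments_prod all_moments_Xc) auto
  qed simp
  also have "\<dots> = (\<Prod>i\<in>set l. block_mean \<alpha> \<beta> (occ l i))"
  proof (intro prod.cong refl)
    fix i assume "i \<in> set l"
    then have i: "i < d" using l by auto
    then have d: "0 < d" by simp
    have "expectation (?Z i) = expectation (\<lambda>\<omega>. ?Y i (mat_rv n (W 0 \<omega>)))"
      unfolding Z[OF i] by (rule expectation_ident[OF i Ym])
    also have "\<dots> = block_mean \<alpha> \<beta> (occ l i)"
      unfolding block_mean_def using occ
      by (intro Bochner_Integration.integral_cong prod.cong refl) (simp add: Xc_def kron_conj_eq_kron_entry)
    finally show "expectation (?Z i) = block_mean \<alpha> \<beta> (occ l i)" .
  qed
  finally show ?thesis .
qed

definition mixed :: "nat list \<Rightarrow> nat list \<Rightarrow> complex" where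
  "mixed w v = expectation (\<lambda>\<omega>. ttr (n\<^sup>2) (map (\<lambda>i. Xc i \<omega>) w) * ttr (n\<^sup>2) (map (\<lambda>i. Xc i \<omega>) v))"

text \<open>A mixed moment depends on the word \<open>w @ v\<close> only through the sets of positions of its letters.\<close>

lemma mixed_expand:
  "\<exists>(K :: ((nat \<times> nat list) \<times> (nat \<times> nat list)) set) c \<alpha> \<beta>. finite K \<and> (\<forall>\<kappa>\<in>K. \<forall>t<p + q. \<alpha> \<kappa> t < n\<^sup>2 \<and> \<beta> \<kappa> t < n\<^sup>2) \<and>
    (\<forall>w v. length w = p \<longrightarrow> length v = q \<longrightarrow> set (w @ v) \<subseteq> {..<d} \<longrightarrow>
      mixed w v = (\<Sum>\<kappa>\<in>K. c \<kappa> * (\<Prod>i\<in>set (w @ v). block_mean (\<alpha> \<kappa>) (\<beta> \<kappa>) (occ (w @ v) i))))"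
proof -
  obtain I :: "(nat \<times> nat list) set" and c \<alpha> \<beta> where I: "finite I" "\<forall>\<kappa>\<in>I. \<forall>t<p. \<alpha> \<kappa> t < n\<^sup>2 \<and> \<beta> \<kappa> t < n\<^sup>2"
    "\<And>(f :: nat \<Rightarrow> cmat) w. length w = p \<Longrightarrow>
        ttr (n\<^sup>2) (map f w) = (\<Sum>\<kappa>\<in>I. c \<kappa> * (\<Prod>t<p. f (w ! t) (\<alpha> \<kappa> t) (\<beta> \<kappa> t)))"
    using ttr_expand[of p "n\<^sup>2"] by blast
  obtain J :: "(nat \<times> nat list) set" and c' \<alpha>' \<beta>' where J: "finite J" "\<forall>\<kappa>\<in>J. \<forall>t<q. \<alpha>' \<kappa> t < n\<^sup>2 \<and> \<beta>' \<kappa> t < n\<^sup>2"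
    "\<And>(f :: nat \<Rightarrow> cmat) w. length w = q \<Longrightarrow>
        ttr (n\<^sup>2) (map f w) = (\<Sum>\<kappa>\<in>J. c' \<kappa> * (\<Prod>t<q. f (w ! t) (\<alpha>' \<kappa> t) (\<beta>' \<kappa> t)))"
    using ttr_expand[of q "n\<^sup>2"] by blast
  let ?c = "\<lambda>\<kappa>. c (fst \<kappa>) * c' (snd \<kappa>)"
  \<comment> \<open>Positions below \<open>p\<close> belong to the first trace, the others to the
    second after a shift by \<open>p\<close>.\<close>
  let ?a = "\<lambda>\<kappa> t. if t < p then \<alpha> (fst \<kappa>) t else \<alpha>' (snd \<kappa>) (t - p)"
  let ?b = "\<lambda>\<kappa> t. if t < p then \<beta> (fst \<kappa>) t else \<beta>' (snd \<kappa>) (t - p)"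
  have ab: "?a \<kappa> t < n\<^sup>2 \<and> ?b \<kappa> t < n\<^sup>2" if "\<kappa> \<in> I \<times> J" "t < p + q" for \<kappa> t
  proof (cases "t < p")
    case True
    then show ?thesis using I(2) that(1) by auto
  next
    case False
    then have "t - p < q" using that(2) by linarith
    then show ?thesis using J(2) that(1) False by auto
  qed
  have "mixed w v = (\<Sum>\<kappa>\<in>I \<times> J. ?c \<kappa> * (\<Prod>i\<in>set (w @ v). block_mean (?a \<kappa>) (?b \<kappa>) (occ (w @ v) i)))"
    if wv: "length w = p" "length v = q" "set (w @ v) \<subseteq> {..<d}" for w v
  proof -
    let ?m = "\<lambda>\<kappa> \<omega>. \<Prod>t<length (w @ v). Xc ((w @ v) ! t) \<omega> (?a \<kappa> t) (?b \<kappa> t)"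
    have ab': "?a \<kappa> t < n\<^sup>2 \<and> ?b \<kappa> t < n\<^sup>2" if "\<kappa> \<in> I \<times> J" "t < length (w @ v)" for \<kappa> t
      using ab[OF that(1)] that(2) wv by simp
    have int: "integrable M (?m \<kappa>)" if "\<kappa> \<in> I \<times> J" for \<kappa>
    proof (intro all_moments_integrable all_moments_prod all_moments_Xc)
      fix t assume t: "t \<in> {..<length (w @ v)}"
      then have "(w @ v) ! t \<in> set (w @ v)" by (intro nth_mem) simp
      then show "(w @ v) ! t < d" using wv(3) by blast
      show "?a \<kappa> t < n\<^sup>2" "?b \<kappa> t < n\<^sup>2" using ab'[OF that] t by blast+
    qed
    have "ttr (n\<^sup>2) (map (\<lambda>i. Xc i \<omega>) w) * ttr (n\<^sup>2) (map (\<lambda>i. Xc i \<omega>) v) = (\<Sum>\<kappa>\<in>I \<times> J. ?c \<kappa> * ?m \<kappa> \<omega>)" for \<omega>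
    proof -
      have split: "?m (\<kappa>, \<mu>) \<omega> = (\<Prod>t<p. Xc (w ! t) \<omega> (\<alpha> \<kappa> t) (\<beta> \<kappa> t)) * (\<Prod>t<q. Xc (v ! t) \<omega> (\<alpha>' \<mu> t) (\<beta>' \<mu> t))" for \<kappa> \<mu>
      proof -
        have un: "{..<length (w @ v)} = {..<p} \<union> {p..<p + q}" using wv(1,2) by auto
        have "?m (\<kappa>, \<mu>) \<omega> = (\<Prod>t<p. Xc ((w @ v) ! t) \<omega> (?a (\<kappa>, \<mu>) t) (?b (\<kappa>, \<mu>) t))
            * (\<Prod>t\<in>{p..<p + q}. Xc ((w @ v) ! t) \<omega> (?a (\<kappa>, \<mu>) t) (?b (\<kappa>, \<mu>) t))"
          unfolding un by (rule prod.union_disjoint) auto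
        also have "(\<Prod>t\<in>{p..<p + q}. Xc ((w @ v) ! t) \<omega> (?a (\<kappa>, \<mu>) t) (?b (\<kappa>, \<mu>) t))
            = (\<Prod>t\<in>{0..<q}. Xc ((w @ v) ! (t + p)) \<omega> (?a (\<kappa>, \<mu>) (t + p)) (?b (\<kappa>, \<mu>) (t + p)))"
          using prod.shift_bounds_nat_ivl[of "\<lambda>t. Xc ((w @ v) ! t) \<omega> (?a (\<kappa>, \<mu>) t) (?b (\<kappa>, \<mu>) t)" 0 p q]
          unfolding add_0_left add.commute[of q p] .
        also have "\<dots> = (\<Prod>t<q. Xc (v ! t) \<omega> (\<alpha>' \<mu> t) (\<beta>' \<mu> t))"
          using wv(1,2) by (intro prod.cong) (auto simp: nth_append)
        also have "(\<Prod>t<p. Xc ((w @ v) ! t) \<omega> (?a (\<kappa>, \<mu>) t) (?b (\<kappa>, \<mu>) t)) = (\<Prod>t<p. Xc (w ! t) \<omega> (\<alpha> \<kappa> t) (\<beta> \<kappa> t))"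
          using wv(1,2) by (intro prod.cong) (auto simp: nth_append)
        finally show ?thesis .
      qed
      show ?thesis
        unfolding I(3)[OF wv(1)] J(3)[OF wv(2)] sum_product sum.cartesian_product
      proof (intro sum.cong refl)
        fix x assume "x \<in> I \<times> J"
        obtain \<kappa> \<mu> where x: "x = (\<kappa>, \<mu>)" by (cases x)
        show "(case x of (\<kappa>, \<mu>) \<Rightarrow> (c \<kappa> * (\<Prod>t<p. Xc (w ! t) \<omega> (\<alpha> \<kappa> t) (\<beta> \<kappa> t)))
            * (c' \<mu> * (\<Prod>t<q. Xc (v ! t) \<omega> (\<alpha>' \<mu> t) (\<beta>' \<mu> t)))) = ?c x * ?m x \<omega>"
          unfolding x split by (simp only: prod.case fst_conv snd_conv mult_ac)
      qed
    qed
    then have "mixed w v = (\<Sum>\<kappa>\<in>I \<times> J. ?c \<kappa> * expectation (?m \<kappa>))"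
      unfolding mixed_def using int by simp
    also have "\<dots> = (\<Sum>\<kappa>\<in>I \<times> J. ?c \<kappa> * (\<Prod>i\<in>set (w @ v). block_mean (?a \<kappa>) (?b \<kappa>) (occ (w @ v) i)))"
      using expectation_monomial[OF wv(3) ab'] by (intro sum.cong refl) simp
    finally show ?thesis .
  qed
  then show ?thesis
    using I(1) J(1) ab by (intro exI[of _ "I \<times> J"] exI[of _ ?c] exI[of _ ?a] exI[of _ ?b]) blast
qed

text \<open>In every term of the expansion the block of \<open>x\<close> is a single position, so
  its factor is the mean of one centred entry.\<close>

lemma mixed_eq_0:
  assumes "set (w @ v) \<subseteq> {..<d}" "x \<in> set (w @ v)" "count_list (w @ v) x = 1"
  shows "mixed w v = 0"
proof -
  obtain K :: "((nat \<times> nat list) \<times> (nat \<times> nat list)) set" and c \<alpha> \<beta>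
    where K: "\<forall>\<kappa>\<in>K. \<forall>t<length w + length v. \<alpha> \<kappa> t < n\<^sup>2 \<and> \<beta> \<kappa> t < n\<^sup>2"
      "mixed w v = (\<Sum>\<kappa>\<in>K. c \<kappa> * (\<Prod>i\<in>set (w @ v). block_mean (\<alpha> \<kappa>) (\<beta> \<kappa>) (occ (w @ v) i)))"
    using mixed_expand[of "length w" "length v"] assms(1) by blast
  have "card (occ (w @ v) x) = 1"
    using assms(3) unfolding count_list_eq_length_filter length_filter_conv_card occ_def by (simp add: eq_commute)
  then obtain t where t: "occ (w @ v) x = {t}" by (rule card_1_singletonE)
  then have "t \<in> occ (w @ v) x" by simp
  then have tl: "t < length w + length v" by (simp add: occ_def)
  have d: "0 < d" using assms(1,2) by auto
  have "(\<Prod>i\<in>set (w @ v). block_mean (\<alpha> \<kappa>) (\<beta> \<kappa>) (occ (w @ v) i)) = 0" if "\<kappa> \<in> K" for \<kappa>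
  proof (rule prod_zero)
    have "block_mean (\<alpha> \<kappa>) (\<beta> \<kappa>) (occ (w @ v) x) = 0"
      unfolding block_mean_def t using K(1) that tl d by (simp add: expectation_Xc)
    then show "\<exists>i\<in>set (w @ v). block_mean (\<alpha> \<kappa>) (\<beta> \<kappa>) (occ (w @ v) i) = 0" using assms(2) by blast
  qed simp
  then show ?thesis unfolding K(2) by (intro sum.neutral ballI) simp
qed

text \<open>An injective relabelling permutes the factors of each term of the expansion and leaves
  every position set unchanged.\<close>

lemma mixed_map_inj:
  assumes "inj_on \<sigma> (set (w @ v))" "set (w @ v) \<subseteq> {..<d}" "set (map \<sigma> (w @ v)) \<subseteq> {..<d}"
  shows "mixed (map \<sigma> w) (map \<sigma> v) = mixed w v"
proof -
  obtain K :: "((nat \<times> nat list) \<times> (nat \<times> nat list)) set" and c \<alpha> \<beta>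
    where K: "\<And>w' v'. length w' = length w \<Longrightarrow> length v' = length v \<Longrightarrow> set (w' @ v') \<subseteq> {..<d} \<Longrightarrow>
      mixed w' v' = (\<Sum>\<kappa>\<in>K. c \<kappa> * (\<Prod>i\<in>set (w' @ v'). block_mean (\<alpha> \<kappa>) (\<beta> \<kappa>) (occ (w' @ v') i)))"
    using mixed_expand[of "length w" "length v"] by blast
  have occ: "occ (map \<sigma> (w @ v)) (\<sigma> i) = occ (w @ v) i" if i: "i \<in> set (w @ v)" for i
  proof -
    have "\<sigma> ((w @ v) ! t) = \<sigma> i \<longleftrightarrow> (w @ v) ! t = i" if "t < length (w @ v)" for t
      using inj_on_eq_iff[OF assms(1) nth_mem[OF that] i] .
    then show ?thesis unfolding occ_def by (auto simp del: map_append simp: nth_map)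
  qed
  have "(\<Prod>i\<in>set (map \<sigma> (w @ v)). block_mean (\<alpha> \<kappa>) (\<beta> \<kappa>) (occ (map \<sigma> (w @ v)) i))
      = (\<Prod>i\<in>set (w @ v). block_mean (\<alpha> \<kappa>) (\<beta> \<kappa>) (occ (w @ v) i))" for \<kappa>
    unfolding set_map prod.reindex[OF assms(1)] o_def by (intro prod.cong refl) (simp only: occ)
  then show ?thesis
    using K[of "map \<sigma> w" "map \<sigma> v"] K[of w v] assms(2,3) by (simp only: length_map map_append[symmetric])
qed

end

section \<open>The limit theorem\<close>

text \<open>\<open>single\<close> and \<open>exchangeable\<close> isolate what the limit argument
  takes from independence and equality in law, so that they can be proved for the given matrices and
  used for the truncated ones.\<close>

locale tensor_clt_iid = tensor_clt M W for M :: "nat \<Rightarrow> 'a measure" and W +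
  fixes d :: "nat \<Rightarrow> nat"
  assumes d_inf: "filterlim d at_top sequentially"
    and single: "\<And>n w v x. set (w @ v) \<subseteq> {..<d n} \<Longrightarrow> x \<in> set (w @ v) \<Longrightarrow> count_list (w @ v) x = 1 \<Longrightarrow>
      integral\<^sup>L (M n) (\<lambda>\<omega>. ttr (n\<^sup>2) (map (\<lambda>i. X n i \<omega>) w) * ttr (n\<^sup>2) (map (\<lambda>i. X n i \<omega>) v)) = 0"
    and exchangeable: "\<And>n w v \<sigma>. inj_on \<sigma> (set (w @ v)) \<Longrightarrow> set (w @ v) \<subseteq> {..<d n} \<Longrightarrow> set (map \<sigma> (w @ v)) \<subseteq> {..<d n} \<Longrightarrow>
      integral\<^sup>L (M n) (\<lambda>\<omega>. ttr (n\<^sup>2) (map (\<lambda>i. X n i \<omega>) (map \<sigma> w)) * ttr (n\<^sup>2) (map (\<lambda>i. X n i \<omega>) (map \<sigma> v)))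
      = integral\<^sup>L (M n) (\<lambda>\<omega>. ttr (n\<^sup>2) (map (\<lambda>i. X n i \<omega>) w) * ttr (n\<^sup>2) (map (\<lambda>i. X n i \<omega>) v))"
begin

abbreviation word_trace :: "nat list \<Rightarrow> nat \<Rightarrow> 'a \<Rightarrow> complex" where
  "word_trace w n \<omega> \<equiv> ttr (n\<^sup>2) (map (\<lambda>i. X n i \<omega>) w)"

definition mixed :: "nat \<Rightarrow> nat list \<Rightarrow> nat list \<Rightarrow> complex" where
  "mixed n w v = integral\<^sup>L (M n) (\<lambda>\<omega>. word_trace w n \<omega> * word_trace v n \<omega>)"

definition inv_sqrt_d :: "nat \<Rightarrow> real" where
  "inv_sqrt_d n = 1 / sqrt (real (d n))"

definition centred_sum :: "nat \<Rightarrow> 'a \<Rightarrow> cmat" where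
  "centred_sum n \<omega> = (\<lambda>r c. complex_of_real (inv_sqrt_d n) * (\<Sum>i<d n. X n i \<omega> r c))"

definition sum_trace :: "nat \<Rightarrow> nat \<Rightarrow> 'a \<Rightarrow> complex" where
  "sum_trace p n \<omega> = tau (n\<^sup>2) (mpow (n\<^sup>2) (centred_sum n \<omega>) p)"

lemma sum_trace_expand: "sum_trace p n \<omega> = complex_of_real (inv_sqrt_d n) ^ p * (\<Sum>w\<in>words {..<d n} p. word_trace w n \<omega>)"
proof -
  have "tau (n\<^sup>2) (mpow (n\<^sup>2) (\<lambda>r c. \<Sum>i<d n. X n i \<omega> r c) p)
      = ttr (n\<^sup>2) (map (\<lambda>j r c. \<Sum>i<d n. X n i \<omega> r c) (replicate p ()))"
    by (simp add: mpow_eq_mlist_prod)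
  also have "\<dots> = (\<Sum>w\<in>words {..<d n} (length (replicate p ())). ttr (n\<^sup>2) (map2 (\<lambda>i _. X n i \<omega>) w (replicate p ())))"
    by (rule ttr_sum) simp
  also have "\<dots> = (\<Sum>w\<in>words {..<d n} p. word_trace w n \<omega>)"
  proof (intro sum.cong)
    fix w assume "w \<in> words {..<d n} p"
    then have "length w = p" by (simp add: words_def)
    then have "map2 (\<lambda>i _. X n i \<omega>) w (replicate p ()) = map (\<lambda>i. X n i \<omega>) w"
      by (intro nth_equalityI) simp_all
    then show "ttr (n\<^sup>2) (map2 (\<lambda>i _. X n i \<omega>) w (replicate p ())) = word_trace w n \<omega>" by (simp only:)
  qed simp
  finally show ?thesis unfolding sum_trace_def centred_sum_def tau_mpow_scale by (simp only:)
qed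

lemma all_moments_word_trace: "all_moments (M n) (word_trace w n)"
  by (rule bdd_all_moments[OF bdd_ttr_X])

lemma all_moments_sum_trace: "all_moments (M n) (sum_trace p n)"
proof -
  interpret prob_space "M n" by (rule prob)
  have "all_moments (M n) (\<lambda>\<omega>. complex_of_real (inv_sqrt_d n) ^ p * (\<Sum>w\<in>words {..<d n} p. word_trace w n \<omega>))"
    by (intro all_moments_cmult all_moments_sum all_moments_word_trace)
  then show ?thesis by (simp add: sum_trace_expand[abs_def] fun_eq_iff)
qed

lemma expectation_sum_trace_mult:
  "integral\<^sup>L (M n) (\<lambda>\<omega>. sum_trace p n \<omega> * sum_trace q n \<omega>)
    = complex_of_real (inv_sqrt_d n) ^ (p + q) * (\<Sum>l\<in>words {..<d n} (p + q). mixed n (take p l) (drop p l))"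
proof -
  interpret prob_space "M n" by (rule prob)
  have int: "integrable (M n) (\<lambda>\<omega>. word_trace w n \<omega> * word_trace v n \<omega>)" for w v
    by (intro all_moments_integrable all_moments_mult all_moments_word_trace)
  have "sum_trace p n \<omega> * sum_trace q n \<omega>
      = complex_of_real (inv_sqrt_d n) ^ (p + q) * (\<Sum>w\<in>words {..<d n} p. \<Sum>v\<in>words {..<d n} q. word_trace w n \<omega> * word_trace v n \<omega>)" for \<omega>
    unfolding sum_trace_expand power_add sum_product[symmetric] by (simp only: mult_ac)
  then have "integral\<^sup>L (M n) (\<lambda>\<omega>. sum_trace p n \<omega> * sum_trace q n \<omega>)
      = complex_of_real (inv_sqrt_d n) ^ (p + q) * (\<Sum>w\<in>words {..<d n} p. \<Sum>v\<in>words {..<d n} q. mixed n w v)"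
    using int by (simp add: mixed_def)
  then show ?thesis by (simp only: sum_words_append)
qed

lemma eventually_d_ge: "eventually (\<lambda>n. k \<le> d n) sequentially"
  using d_inf by (simp add: filterlim_at_top)

lemma inv_sqrt_d_tendsto: "inv_sqrt_d \<longlonglongrightarrow> 0"
proof -
  have "filterlim (\<lambda>n. sqrt (real (d n))) at_top sequentially"
    by (intro filterlim_compose[OF sqrt_at_top] filterlim_compose[OF filterlim_real_sequentially] d_inf)
  then have "(\<lambda>n. inverse (sqrt (real (d n)))) \<longlonglongrightarrow> 0" by (rule tendsto_inverse_0_at_top)
  then show ?thesis by (simp add: inv_sqrt_d_def[abs_def] inverse_eq_divide)
qed

lemma inv_sqrt_d_power:
  assumes "2 * b \<le> m" "0 < d n"
  shows "inv_sqrt_d n ^ m * real (d n) ^ b = inv_sqrt_d n ^ (m - 2 * b)"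
proof -
  have "inv_sqrt_d n ^ m = inv_sqrt_d n ^ (m - 2 * b) * ((inv_sqrt_d n)\<^sup>2) ^ b"
    using assms(1) by (simp flip: power_mult power_add)
  moreover have "(inv_sqrt_d n)\<^sup>2 = 1 / real (d n)" by (simp add: inv_sqrt_d_def power_divide)
  ultimately show ?thesis using assms(2) by (simp add: power_divide)
qed

text \<open>The counts subtracted here sum, after scaling, exactly to the limit; convergence thus
  reduces to showing that the scaled sum of defects vanishes.\<close>

definition limit_defect :: "nat \<Rightarrow> nat \<Rightarrow> nat list \<Rightarrow> complex" where
  "limit_defect p n l = mixed n (take p l) (drop p l) - of_nat (nc_count (take p l) * nc_count (drop p l))"

text \<open>The word is its pattern under an injective relabelling, which preserves mixed moments
  and counts. Letters of the pattern lie below \<open>m\<close>, so \<open>m \<le> d n\<close> makes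
  them legitimate indices.\<close>

lemma limit_defect_canon:
  assumes "l \<in> words {..<d n} m" "m \<le> d n"
  shows "limit_defect p n l = limit_defect p n (canon l)"
proof -
  let ?c = "canon l" and ?\<sigma> = "(!) l"
  have l: "set l \<subseteq> {..<d n}" "length l = m" using assms(1) by (auto simp: words_def)
  have c: "set ?c \<subseteq> {..<d n}" using canon_props(2)[of l] l(2) assms(2) by (auto simp: words_def)
  have inj: "inj_on ?\<sigma> (set ?c)" by (rule canon_props(3))
  have eq: "take p l = map ?\<sigma> (take p ?c)" "drop p l = map ?\<sigma> (drop p ?c)"
    using canon_props(1)[of l] by (metis take_map, metis drop_map)
  have "mixed n (map ?\<sigma> (take p ?c)) (map ?\<sigma> (drop p ?c)) = mixed n (take p ?c) (drop p ?c)"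
    unfolding mixed_def
  proof (rule exchangeable)
    show "inj_on ?\<sigma> (set (take p ?c @ drop p ?c))" "set (take p ?c @ drop p ?c) \<subseteq> {..<d n}"
      unfolding append_take_drop_id by (fact inj, fact c)
    show "set (map ?\<sigma> (take p ?c @ drop p ?c)) \<subseteq> {..<d n}"
      unfolding append_take_drop_id canon_props(1) by (fact l)
  qed
  moreover have "nc_count (map ?\<sigma> (take p ?c)) = nc_count (take p ?c)" "nc_count (map ?\<sigma> (drop p ?c)) = nc_count (drop p ?c)"
    using inj set_take_subset[of p ?c] set_drop_subset[of p ?c] by (auto intro!: nc_count_map_inj elim: inj_on_subset)
  ultimately show ?thesis unfolding limit_defect_def eq by (simp only:)
qed

text \<open>The mixed moment vanishes by centring. The letter is single in one of the two halves, so
  the count of that half vanishes as well.\<close>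

lemma limit_defect_single:
  assumes "set c \<subseteq> {..<d n}" "x \<in> set c" "count_list c x = 1"
  shows "limit_defect p n c = 0"
proof -
  have "mixed n (take p c) (drop p c) = 0"
    unfolding mixed_def by (rule single[where x=x]) (use assms in \<open>simp_all only: append_take_drop_id\<close>)
  moreover have "nc_count (take p c) * nc_count (drop p c) = 0"
  proof -
    have "count_list (take p c) x + count_list (drop p c) x = 1"
      using assms(3) by (simp flip: count_list_append)
    then consider "count_list (take p c) x = 1" | "count_list (drop p c) x = 1" by linarith
    then show ?thesis
    proof cases
      case 1
      then have "x \<in> set (take p c)" by (metis count_notin zero_neq_one)
      from nc_count_eq_0_if_single[OF this 1] show ?thesis by simp
    next
      case 2
      then have "x \<in> set (drop p c)" by (metis count_notin zero_neq_one)
      from nc_count_eq_0_if_single[OF this 2] show ?thesis by simp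
    qed
  qed
  ultimately show ?thesis unfolding limit_defect_def by (simp only:) simp
qed

lemma limit_defect_bounded: "\<exists>C. \<forall>n. cmod (limit_defect p n c) \<le> C"
proof -
  interpret prob_space "M n" for n by (rule prob)
  let ?P = "\<lambda>n \<omega>. word_trace (take p c) n \<omega> * word_trace (drop p c) n \<omega>"
  have "bdd ?P" by (intro bdd_mult bdd_ttr_X)
  then obtain C where C: "\<And>n. integral\<^sup>L (M n) (\<lambda>\<omega>. cmod (?P n \<omega>) ^ 1) \<le> C" using bddE by blast
  have "cmod (limit_defect p n c) \<le> C + cmod (of_nat (nc_count (take p c) * nc_count (drop p c)))" for n
  proof -
    have "cmod (mixed n (take p c) (drop p c)) \<le> integral\<^sup>L (M n) (\<lambda>\<omega>. cmod (?P n \<omega>))"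
      unfolding mixed_def by (rule integral_norm_bound)
    also have "\<dots> \<le> C" using C[of n] by simp
    finally show ?thesis unfolding limit_defect_def by (rule norm_triangle_le_diff[OF add_right_mono])
  qed
  then show ?thesis by blast
qed

text \<open>Each half contains any letter at most twice, so both traces converge, and so does the
  expectation of their product. A letter shared by the halves is single in each and makes both
  limits zero.\<close>

lemma limit_defect_pairing:
  assumes "\<And>x. x \<in> set c \<Longrightarrow> count_list c x = 2"
  shows "(\<lambda>n. limit_defect p n c) \<longlonglongrightarrow> 0"
proof -
  have "count_list c x \<le> 2" for x using assms[of x] by (cases "x \<in> set c") auto
  then have le: "count_list (take p c) x + count_list (drop p c) x \<le> 2" for x
    by (simp flip: count_list_append)
  have "conv (\<lambda>n \<omega>. word_trace (take p c) n \<omega> * word_trace (drop p c) n \<omega>) (of_nat (nc_count (take p c)) * of_nat (nc_count (drop p c)))"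
    by (intro conv_mult conv_ttr_X) (use le add_leD1 add_leD2 in blast)+
  from conv_expectation[OF this] show ?thesis
    unfolding limit_defect_def mixed_def by (simp add: LIM_zero)
qed

text \<open>Patterns in which some letter occurs once have zero defect as soon as \<open>d n\<close>
  reaches their length. Pairings have weight one and vanishing defect. All others have too few
  letters: their weight is a positive power of \<open>inv_sqrt_d n\<close>, against a bounded
  defect.\<close>

lemma tendsto_expectation_sum_trace_mult:
  "(\<lambda>n. integral\<^sup>L (M n) (\<lambda>\<omega>. sum_trace p n \<omega> * sum_trace q n \<omega>)) \<longlonglongrightarrow> of_nat (card (NC2 p) * card (NC2 q))"
proof -
  let ?m = "p + q"
  let ?E = "\<lambda>n. integral\<^sup>L (M n) (\<lambda>\<omega>. sum_trace p n \<omega> * sum_trace q n \<omega>)"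
  let ?L = "of_nat (card (NC2 p) * card (NC2 q)) :: complex"
  let ?R = "\<lambda>n. \<Sum>c\<in>words {..<?m} ?m. inv_sqrt_d n ^ ?m * real (d n) ^ card (set c) * cmod (limit_defect p n c)"
  have inv_sqrt_d0: "0 \<le> inv_sqrt_d n" for n by (simp add: inv_sqrt_d_def)
  have main: "norm (?E n - ?L) \<le> ?R n" if n: "?m \<le> d n" "0 < d n" for n
  proof -
    let ?s = "complex_of_real (inv_sqrt_d n)"
    have "?L = ?s ^ ?m * (\<Sum>w\<in>words {..<d n} p. \<Sum>v\<in>words {..<d n} q. of_nat (nc_count w * nc_count v))"
    proof -
      have e: "of_nat (card (NC2 k)) = ?s ^ k * (\<Sum>w\<in>words {..<d n} k. of_nat (nc_count w))" for k
        using arg_cong[OF sum_nc_count[OF n(2), of k], of complex_of_real]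
        by (simp add: inv_sqrt_d_def mult.commute)
      show ?thesis
        unfolding of_nat_mult e power_add sum_product[symmetric] by (simp only: mult_ac)
    qed
    also have "\<dots> = ?s ^ ?m * (\<Sum>l\<in>words {..<d n} ?m. of_nat (nc_count (take p l) * nc_count (drop p l)))"
      by (simp only: sum_words_append[where f="\<lambda>w v. of_nat (nc_count w * nc_count v)"])
    finally have "?E n - ?L = ?s ^ ?m * (\<Sum>l\<in>words {..<d n} ?m. limit_defect p n l)"
      unfolding expectation_sum_trace_mult limit_defect_def by (simp only: sum_subtractf right_diff_distrib)
    then have "norm (?E n - ?L) = inv_sqrt_d n ^ ?m * norm (\<Sum>l\<in>words {..<d n} ?m. limit_defect p n l)"
      using inv_sqrt_d0[of n] by (simp add: norm_mult norm_power)
    also have "\<dots> \<le> inv_sqrt_d n ^ ?m * (\<Sum>c\<in>words {..<?m} ?m. real (d n) ^ card (set c) * cmod (limit_defect p n c))"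
      using limit_defect_canon[of _ n ?m p] n(1) inv_sqrt_d0[of n]
      by (intro mult_left_mono norm_sum_words_le) auto
    also have "\<dots> = ?R n" by (simp add: sum_distrib_left mult.assoc)
    finally show ?thesis .
  qed
  have "?R \<longlonglongrightarrow> (\<Sum>c\<in>words {..<?m} ?m. 0)"
  proof (rule tendsto_sum)
    fix c assume c: "c \<in> words {..<?m} ?m"
    let ?f = "\<lambda>n. inv_sqrt_d n ^ ?m * real (d n) ^ card (set c) * cmod (limit_defect p n c)"
    show "?f \<longlonglongrightarrow> 0"
    proof (cases "\<exists>x\<in>set c. count_list c x = 1")
      case True
      then obtain x where x: "x \<in> set c" "count_list c x = 1" by blast
      have "eventually (\<lambda>n. ?f n = 0) sequentially"
        using eventually_d_ge[of ?m]
      proof eventually_elim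
        case (elim n)
        then have "set c \<subseteq> {..<d n}" using c by (auto simp: words_def)
        from limit_defect_single[OF this x] show ?case by simp
      qed
      then show ?thesis by (rule tendsto_eventually)
    next
      case False
      then have nosingle: "count_list c x \<noteq> 1" if "x \<in> set c" for x using that by blast
      have len: "length c = ?m" using c by (simp add: words_def)
      have b: "2 * card (set c) \<le> ?m" using length_ge_twice_card(1)[OF nosingle] len by simp
      have ev: "eventually (\<lambda>n. ?f n = inv_sqrt_d n ^ (?m - 2 * card (set c)) * cmod (limit_defect p n c)) sequentially"
        using eventually_d_ge[of 1] by eventually_elim (use inv_sqrt_d_power[OF b] in simp)
      have "(\<lambda>n. inv_sqrt_d n ^ (?m - 2 * card (set c)) * cmod (limit_defect p n c)) \<longlonglongrightarrow> 0"
      proof (cases "2 * card (set c) = ?m")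
        case True
        have "(\<lambda>n. limit_defect p n c) \<longlonglongrightarrow> 0"
        proof (rule limit_defect_pairing)
          fix x assume x: "x \<in> set c"
          have eq: "2 * card (set c) = length c" using True len by simp
          show "count_list c x = 2" by (rule length_ge_twice_card(2)[OF nosingle eq x])
        qed
        then show ?thesis using True by (simp add: tendsto_norm_zero)
      next
        case False
        then have pos: "?m - 2 * card (set c) \<noteq> 0" using b by simp
        obtain C where C: "\<And>n. cmod (limit_defect p n c) \<le> C" using limit_defect_bounded by blast
        have "(\<lambda>n. inv_sqrt_d n ^ (?m - 2 * card (set c)) * C) \<longlonglongrightarrow> 0 ^ (?m - 2 * card (set c)) * C"
          by (intro tendsto_intros inv_sqrt_d_tendsto)
        then have "(\<lambda>n. inv_sqrt_d n ^ (?m - 2 * card (set c)) * C) \<longlonglongrightarrow> 0" using pos by (simp add: power_0_left)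
        moreover have le: "norm (inv_sqrt_d n ^ (?m - 2 * card (set c)) * cmod (limit_defect p n c)) \<le> inv_sqrt_d n ^ (?m - 2 * card (set c)) * C" for n
          using C[of n] inv_sqrt_d0[of n] by (simp add: mult_left_mono)
        ultimately show ?thesis by (intro Lim_null_comparison[OF always_eventually[OF allI[OF le]]])
      qed
      then show ?thesis using tendsto_cong[OF ev] by blast
    qed
  qed
  then have "?R \<longlonglongrightarrow> 0" by simp
  moreover have "eventually (\<lambda>n. norm (?E n - ?L) \<le> ?R n) sequentially"
    using eventually_d_ge[of ?m] eventually_d_ge[of 1] by eventually_elim (rule main, simp_all)
  ultimately have "(\<lambda>n. ?E n - ?L) \<longlonglongrightarrow> 0" by (rule Lim_null_comparison[rotated])
  then show ?thesis by (rule LIM_zero_cancel)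
qed

lemma card_NC2_0: "card (NC2 0) = 1"
  by (simp add: card_NC2)

lemma tendsto_expectation_sum_trace:
  "(\<lambda>n. integral\<^sup>L (M n) (sum_trace p n)) \<longlonglongrightarrow> of_nat (card (NC2 p))"
proof -
  \<comment> \<open>The empty product has normalised trace 1 only for \<open>n > 0\<close>; at
    \<open>n = 0\<close> division by zero gives 0.\<close>
  have "eventually (\<lambda>n. integral\<^sup>L (M n) (\<lambda>\<omega>. sum_trace p n \<omega> * sum_trace 0 n \<omega>) = integral\<^sup>L (M n) (sum_trace p n)) sequentially"
    using eventually_gt_at_top[of 0]
  proof eventually_elim
    case (elim n)
    then have "sum_trace 0 n \<omega> = 1" for \<omega> by (simp add: sum_trace_def tau_def mtrace_def mone_def)
    then show ?case by simp
  qed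
  from tendsto_cong[OF this] show ?thesis
    using tendsto_expectation_sum_trace_mult[of p 0] by (simp add: card_NC2_0)
qed

lemma hermitian_X: "hermitian_mat (n\<^sup>2) (X n i \<omega>)"
  unfolding hermitian_mat_def
proof (intro allI impI)
  fix r c assume rc: "r < n\<^sup>2" "c < n\<^sup>2"
  have t: "T n i c r = cnj (T n i r c)"
    using hermitian_T[of n i] rc unfolding hermitian_mat_def by blast
  have k: "kron_conj n (W n i \<omega>) c r = cnj (kron_conj n (W n i \<omega>) r c)"
    using hermitian_kron_conj[OF herm_W[of n i \<omega>]] rc unfolding hermitian_mat_def by blast
  show "X n i \<omega> c r = cnj (X n i \<omega> r c)" unfolding X_def t k by simp
qed

text \<open>Traces of powers of a hermitian matrix are real, so the squared deviation from the limit
  is a polynomial in \<open>sum_trace\<close> and its expectation follows from the first and second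
  moments.\<close>

lemma cnj_sum_trace: "cnj (sum_trace p n \<omega>) = sum_trace p n \<omega>"
proof -
  have "hermitian_mat (n\<^sup>2) (centred_sum n \<omega>)"
    unfolding hermitian_mat_def
  proof (intro allI impI)
    fix r c assume rc: "r < n\<^sup>2" "c < n\<^sup>2"
    have "X n i \<omega> c r = cnj (X n i \<omega> r c)" for i using hermitian_X rc unfolding hermitian_mat_def by blast
    then show "centred_sum n \<omega> c r = cnj (centred_sum n \<omega> r c)" unfolding centred_sum_def by simp
  qed
  from hermitian_mpow[OF this, of p] have "mpow (n\<^sup>2) (centred_sum n \<omega>) p i i = cnj (mpow (n\<^sup>2) (centred_sum n \<omega>) p i i)" if "i < n\<^sup>2" for i
    using that unfolding hermitian_mat_def by blast
  then have "(\<Sum>i<n\<^sup>2. mpow (n\<^sup>2) (centred_sum n \<omega>) p i i) = (\<Sum>i<n\<^sup>2. cnj (mpow (n\<^sup>2) (centred_sum n \<omega>) p i i))"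
    by (intro sum.cong refl) blast
  then show ?thesis unfolding sum_trace_def tau_def mtrace_def by simp
qed

text \<open>The second moment tends to the square of the limit of the first, so the mean squared
  deviation vanishes and Chebyshev's inequality applies.\<close>

lemma conv_in_prob_sum_trace: "conv_in_prob M (sum_trace p) (of_nat (card (NC2 p)))"
proof (rule conv_in_probI_L2[OF all_moments_sum_trace])
  interpret prob_space "M n" for n by (rule prob)
  let ?L = "of_nat (card (NC2 p)) :: complex"
  have eq: "complex_of_real (integral\<^sup>L (M n) (\<lambda>\<omega>. (cmod (sum_trace p n \<omega> - ?L))\<^sup>2))
      = integral\<^sup>L (M n) (\<lambda>\<omega>. sum_trace p n \<omega> * sum_trace p n \<omega>) - 2 * ?L * integral\<^sup>L (M n) (sum_trace p n) + ?L * ?L" for n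
  proof -
    have pt: "complex_of_real ((cmod (sum_trace p n \<omega> - ?L))\<^sup>2) = sum_trace p n \<omega> * sum_trace p n \<omega> - 2 * ?L * sum_trace p n \<omega> + ?L * ?L" for \<omega>
      unfolding complex_norm_square complex_cnj_diff cnj_sum_trace by (simp add: algebra_simps)
    have int: "integrable (M n) (\<lambda>\<omega>. sum_trace p n \<omega> * sum_trace p n \<omega>)" "integrable (M n) (sum_trace p n)"
      by (intro all_moments_integrable all_moments_mult all_moments_sum_trace)+
    have "complex_of_real (integral\<^sup>L (M n) (\<lambda>\<omega>. (cmod (sum_trace p n \<omega> - ?L))\<^sup>2))
        = integral\<^sup>L (M n) (\<lambda>\<omega>. complex_of_real ((cmod (sum_trace p n \<omega> - ?L))\<^sup>2))"
      by (rule integral_complex_of_real[symmetric])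
    also have "\<dots> = integral\<^sup>L (M n) (\<lambda>\<omega>. sum_trace p n \<omega> * sum_trace p n \<omega> - 2 * ?L * sum_trace p n \<omega> + ?L * ?L)"
      unfolding pt ..
    also have "\<dots> = integral\<^sup>L (M n) (\<lambda>\<omega>. sum_trace p n \<omega> * sum_trace p n \<omega>) - 2 * ?L * integral\<^sup>L (M n) (sum_trace p n) + ?L * ?L"
      using int by (simp add: prob_space)
    finally show ?thesis .
  qed
  have "(\<lambda>n. complex_of_real (integral\<^sup>L (M n) (\<lambda>\<omega>. (cmod (sum_trace p n \<omega> - ?L))\<^sup>2)))
      \<longlonglongrightarrow> of_nat (card (NC2 p) * card (NC2 p)) - 2 * ?L * ?L + ?L * ?L"
    unfolding eq by (intro tendsto_intros tendsto_expectation_sum_trace_mult tendsto_expectation_sum_trace)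
  then have "(\<lambda>n. complex_of_real (integral\<^sup>L (M n) (\<lambda>\<omega>. (cmod (sum_trace p n \<omega> - ?L))\<^sup>2))) \<longlonglongrightarrow> complex_of_real 0"
    by (simp add: algebra_simps)
  then show "(\<lambda>n. integral\<^sup>L (M n) (\<lambda>\<omega>. (cmod (sum_trace p n \<omega> - ?L))\<^sup>2)) \<longlonglongrightarrow> 0"
    by (simp only: tendsto_of_real_iff)
qed

end

section \<open>Passage between given and truncated matrices, and the conclusion\<close>

lemma conv_in_prob_cong:
  assumes "eventually (\<lambda>n. \<forall>\<omega>\<in>space (M n). X n \<omega> = Y n \<omega>) sequentially"
  shows "conv_in_prob M X c \<longleftrightarrow> conv_in_prob M Y c"
proof -
  have "((\<lambda>n. measure (M n) {\<omega> \<in> space (M n). \<epsilon> < norm (X n \<omega> - c)}) \<longlonglongrightarrow> 0) \<longleftrightarrow>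
        ((\<lambda>n. measure (M n) {\<omega> \<in> space (M n). \<epsilon> < norm (Y n \<omega> - c)}) \<longlonglongrightarrow> 0)" for \<epsilon>
  proof (rule tendsto_cong)
    show "eventually (\<lambda>n. measure (M n) {\<omega> \<in> space (M n). \<epsilon> < norm (X n \<omega> - c)}
        = measure (M n) {\<omega> \<in> space (M n). \<epsilon> < norm (Y n \<omega> - c)}) sequentially"
      using assms
    proof eventually_elim
      case (elim n)
      then have "{\<omega> \<in> space (M n). \<epsilon> < norm (X n \<omega> - c)} = {\<omega> \<in> space (M n). \<epsilon> < norm (Y n \<omega> - c)}"
        by (intro Collect_cong conj_cong refl) simp
      then show ?case by (simp only:)
    qed
  qed
  then show ?thesis unfolding conv_in_prob_def by (simp only:)
qed

lemma tau_mpow_cong: "entries_eq N A B \<Longrightarrow> tau N (mpow N A p) = tau N (mpow N B p)"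
  using ttr_map_cong[of "replicate p ()" N "\<lambda>_. A" "\<lambda>_. B"] by (simp add: mpow_eq_mlist_prod)

lemma mpow_cong: "entries_eq N A B \<Longrightarrow> r < N \<Longrightarrow> mpow N A p r c = mpow N B p r c"
  unfolding mpow_eq_mlist_prod by (rule mlist_prod_cong) (simp add: list_all2_conv_all_nth)

lemma centered_prob_cong: "entries_eq N A B \<Longrightarrow> entries_eq N (centered_prob N A p) (centered_prob N B p)"
proof -
  assume AB: "entries_eq N A B"
  show ?thesis
    unfolding entries_eq_def
  proof (intro allI impI)
    fix r c assume "r < N"
    then show "centered_prob N A p r c = centered_prob N B p r c"
      unfolding centered_prob_def tau_mpow_cong[OF AB] by (simp only: mpow_cong[OF AB])
  qed
qed

lemma entries_eq_kron_conj:
  assumes "entries_eq n A B" shows "entries_eq (n\<^sup>2) (kron_conj n A) (kron_conj n B)"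
  unfolding entries_eq_def
proof (intro allI impI)
  fix r c assume "r < n\<^sup>2" "c < n\<^sup>2"
  then show "kron_conj n A r c = kron_conj n B r c"
    using div_mod_less_square[of r n] div_mod_less_square[of c n] assms
    by (simp add: kron_conj_def kron_def mconj_def entries_eq_def)
qed

theorem theorem2p1:
  fixes M :: "nat \<Rightarrow> 'a measure"
    and d :: "nat \<Rightarrow> nat"
    and W :: "nat \<Rightarrow> nat \<Rightarrow> 'a \<Rightarrow> cmat"
  assumes d_inf: "filterlim d at_top sequentially"
    and prob: "\<And>n. prob_space (M n)"
    and meas: "\<And>n i r c. i < d n \<Longrightarrow> r < n \<Longrightarrow> c < n \<Longrightarrow>
                  (\<lambda>\<omega>. W n i \<omega> r c) \<in> borel_measurable (M n)"
    and moments: "\<And>n i r c q. i < d n \<Longrightarrow> r < n \<Longrightarrow> c < n \<Longrightarrow>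
                  integrable (M n) (\<lambda>\<omega>. norm (W n i \<omega> r c) ^ q)"
    and herm: "\<And>n i \<omega>. i < d n \<Longrightarrow> \<omega> \<in> space (M n) \<Longrightarrow> hermitian_mat n (W n i \<omega>)"
    and mean0: "\<And>n i r c. i < d n \<Longrightarrow> r < n \<Longrightarrow> c < n \<Longrightarrow>
                  integral\<^sup>L (M n) (\<lambda>\<omega>. W n i \<omega> r c) = 0"
    and norm1: "\<And>n i. i < d n \<Longrightarrow> integral\<^sup>L (M n) (\<lambda>\<omega>. tau n (W n i \<omega>)) = 0"
    and norm2: "\<And>n i. i < d n \<Longrightarrow> integral\<^sup>L (M n) (\<lambda>\<omega>. tau n (mpow n (W n i \<omega>) 2)) = 1"
    and A1: "\<And>i. \<exists>\<mu>. moment_measure \<mu> \<and>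
                  weak_conv_in_prob M (\<lambda>n. n) (\<lambda>n. W n i) \<mu> \<and>
                  weak_conv_in_exp M (\<lambda>n. n) (\<lambda>n. W n i) \<mu>"
    and A2: "\<And>k. asym_free_in_prob M (\<lambda>n. n) W k \<and> asym_free_in_exp M (\<lambda>n. n) W k"
    and A3: "\<And>i p. 1 \<le> p \<Longrightarrow>
               (\<lambda>n. tau (n\<^sup>2) (mpow (n\<^sup>2)
                   (mexp (M n) (n\<^sup>2) (\<lambda>\<omega>. kron n (W n i \<omega>) (mconj (W n i \<omega>)))) p))
               \<longlonglongrightarrow> 0"
    and A4_indep: "\<And>n. prob_space.indep_vars (M n) (\<lambda>_. mat_space n)
                    (\<lambda>i \<omega>. mat_rv n (W n i \<omega>)) {..<d n}"
    and A4_ident: "\<And>n i. i < d n \<Longrightarrow>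
                    distr (M n) (mat_space n) (\<lambda>\<omega>. mat_rv n (W n i \<omega>))
                  = distr (M n) (mat_space n) (\<lambda>\<omega>. mat_rv n (W n 0 \<omega>))"
  shows "weak_conv_in_prob M (\<lambda>n. n\<^sup>2) (\<lambda>n. Delta (M n) n (d n) (W n)) mu_sc
       \<and> weak_conv_in_exp M (\<lambda>n. n\<^sup>2) (\<lambda>n. Delta (M n) n (d n) (W n)) mu_sc
       \<and> (\<forall>p\<ge>1. conv_in_prob M (\<lambda>n \<omega>. tau (n\<^sup>2) (mpow (n\<^sup>2) (Delta (M n) n (d n) (W n) \<omega>) p))
                    (of_nat (card (NC2 p)))
              \<and> (\<lambda>n. integral\<^sup>L (M n) (\<lambda>\<omega>. tau (n\<^sup>2) (mpow (n\<^sup>2) (Delta (M n) n (d n) (W n) \<omega>) p)))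
                    \<longlonglongrightarrow> of_nat (card (NC2 p)))"
proof -
  \<comment> \<open>Truncating \<open>W\<close> makes measurability, integrability and hermiticity hold for all indices and points;
    every limit concerns fixed indices, which are eventually below \<open>d n\<close>.\<close>
  define W' where "W' = (\<lambda>n i \<omega> r c. if i < d n \<and> \<omega> \<in> space (M n) \<and> r < n \<and> c < n then W n i \<omega> r c else 0)"
  have ev_d: "eventually (\<lambda>n. k < d n) sequentially" for k
  proof -
    have "eventually (\<lambda>n. Suc k \<le> d n) sequentially" using d_inf unfolding filterlim_at_top by blast
    then show ?thesis by (simp only: Suc_le_eq)
  qed
  have W': "entries_eq n (W' n i \<omega>) (W n i \<omega>)" if "i < d n" "\<omega> \<in> space (M n)" for n i \<omega>
    using that by (simp add: entries_eq_def W'_def)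
  have tau_W': "tau n (mpow n (W' n i \<omega>) p) = tau n (mpow n (W n i \<omega>) p)" if "i < d n" "\<omega> \<in> space (M n)" for n i \<omega> p
    by (rule tau_mpow_cong[OF W'[OF that]])
  have all_moments_entries: "all_moments (M n) (\<lambda>\<omega>. W n i \<omega> r c)" if "i < d n" "r < n" "c < n" for n i r c
    using meas[OF that] moments[OF that] by (simp add: all_moments_def)
  have all_moments_W': "all_moments (M n) (\<lambda>\<omega>. W' n i \<omega> r c)" for n i r c
  proof (cases "i < d n \<and> r < n \<and> c < n")
    case True
    then have L: "all_moments (M n) (\<lambda>\<omega>. W n i \<omega> r c)" using all_moments_entries by blast
    have eq: "W' n i \<omega> r c = W n i \<omega> r c" if "\<omega> \<in> space (M n)" for \<omega> using True that by (simp add: W'_def)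
    have "(\<lambda>\<omega>. W' n i \<omega> r c) \<in> borel_measurable (M n) \<longleftrightarrow> (\<lambda>\<omega>. W n i \<omega> r c) \<in> borel_measurable (M n)"
      by (rule measurable_cong) (rule eq)
    moreover have "integrable (M n) (\<lambda>\<omega>. cmod (W' n i \<omega> r c) ^ q) \<longleftrightarrow> integrable (M n) (\<lambda>\<omega>. cmod (W n i \<omega> r c) ^ q)" for q
      by (rule Bochner_Integration.integrable_cong) (simp_all only: eq)
    ultimately show ?thesis using L unfolding all_moments_def by blast
  next
    case False
    then have "(\<lambda>\<omega>. W' n i \<omega> r c) = (\<lambda>\<omega>. 0)" by (auto simp: W'_def fun_eq_iff)
    then show ?thesis using prob_space.all_moments_const[OF prob] by simp
  qed
  have int_tau: "integral\<^sup>L (M n) (\<lambda>\<omega>. tau n (mpow n (W' n i \<omega>) p)) = integral\<^sup>L (M n) (\<lambda>\<omega>. tau n (mpow n (W n i \<omega>) p))"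
    if "i < d n" for n i p
    by (intro Bochner_Integration.integral_cong refl tau_W' that)
  have cip: "conv_in_prob M (\<lambda>n \<omega>. tau n (mpow n (W' n i \<omega>) p)) c \<longleftrightarrow> conv_in_prob M (\<lambda>n \<omega>. tau n (mpow n (W n i \<omega>) p)) c" for i p c
    by (rule conv_in_prob_cong) (use ev_d[of i] in eventually_elim, use tau_W' in blast)
  have T': "mexp (M n) (n\<^sup>2) (\<lambda>\<omega>. kron_conj n (W' n i \<omega>)) = mexp (M n) (n\<^sup>2) (\<lambda>\<omega>. kron_conj n (W n i \<omega>))" if "i < d n" for n i
  proof -
    have "integral\<^sup>L (M n) (\<lambda>\<omega>. kron_conj n (W' n i \<omega>) r c) = integral\<^sup>L (M n) (\<lambda>\<omega>. kron_conj n (W n i \<omega>) r c)"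
      if "r < n\<^sup>2" "c < n\<^sup>2" for r c
    proof (intro Bochner_Integration.integral_cong refl)
      fix \<omega> assume "\<omega> \<in> space (M n)"
      from entries_eq_kron_conj[OF W'[OF \<open>i < d n\<close> this]] show "kron_conj n (W' n i \<omega>) r c = kron_conj n (W n i \<omega>) r c"
        using that unfolding entries_eq_def by blast
    qed
    then show ?thesis unfolding mexp_def by (simp cong: if_cong conj_cong add: fun_eq_iff)
  qed
  interpret tensor_clt M W'
  proof (intro tensor_clt.intro prob_seq.intro tensor_clt_axioms.intro)
    show "prob_space (M n)" for n by (rule prob)
    show "all_moments (M n) (\<lambda>\<omega>. W' n i \<omega> r c)" for n i r c by (rule all_moments_W')
    show "hermitian_mat n (W' n i \<omega>)" for n i \<omega>
    proof (cases "i < d n \<and> \<omega> \<in> space (M n)")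
      case True
      then have h: "\<forall>r<n. \<forall>c<n. W n i \<omega> c r = cnj (W n i \<omega> r c)" using herm unfolding hermitian_mat_def by blast
      show ?thesis
        unfolding hermitian_mat_def
      proof (intro allI impI)
        fix r c assume rc: "r < n" "c < n"
        then have "W n i \<omega> c r = cnj (W n i \<omega> r c)" using h by blast
        then show "W' n i \<omega> c r = cnj (W' n i \<omega> r c)" using True rc by (simp only: W'_def) simp
      qed
    qed (auto simp: hermitian_mat_def W'_def)
    fix i
    obtain \<mu> where \<mu>: "weak_conv_in_prob M (\<lambda>n. n) (\<lambda>n. W n i) \<mu>" "weak_conv_in_exp M (\<lambda>n. n) (\<lambda>n. W n i) \<mu>"
      using A1[of i] by blast
    have lim: "(\<lambda>n. integral\<^sup>L (M n) (\<lambda>\<omega>. tau n (mpow n (W n i \<omega>) p))) \<longlonglongrightarrow> complex_of_real (moment \<mu> p)" if "1 \<le> p" for p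
      using \<mu>(2) that unfolding weak_conv_in_exp_def by blast
    have limp: "conv_in_prob M (\<lambda>n \<omega>. tau n (mpow n (W n i \<omega>) p)) (complex_of_real (moment \<mu> p))" if "1 \<le> p" for p
      using \<mu>(1) that unfolding weak_conv_in_prob_def by blast
    show "convergent (\<lambda>n. integral\<^sup>L (M n) (\<lambda>\<omega>. tau n (mpow n (W' n i \<omega>) p)))" if "1 \<le> p" for p
    proof -
      have "eventually (\<lambda>n. integral\<^sup>L (M n) (\<lambda>\<omega>. tau n (mpow n (W' n i \<omega>) p))
          = integral\<^sup>L (M n) (\<lambda>\<omega>. tau n (mpow n (W n i \<omega>) p))) sequentially"
        using ev_d[of i] by eventually_elim (rule int_tau)
      from tendsto_cong[OF this, THEN iffD2, OF lim[OF that]] show ?thesis by (rule convergentI)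
    qed
    \<comment> \<open>The expectations are zero once \<open>i < d n\<close>, which identifies the
      first moment of the limit law; the same law describes the limit in probability.\<close>
    have m1: "complex_of_real (moment \<mu> 1) = 0"
    proof (rule LIMSEQ_unique[OF lim[of 1]])
      show "(\<lambda>n. integral\<^sup>L (M n) (\<lambda>\<omega>. tau n (mpow n (W n i \<omega>) 1))) \<longlonglongrightarrow> 0"
      proof (rule tendsto_eventually)
        have t1: "tau n (mpow n A 1) = tau n A" for n A by (rule tau_cong) (rule mpow_1)
        show "eventually (\<lambda>n. integral\<^sup>L (M n) (\<lambda>\<omega>. tau n (mpow n (W n i \<omega>) 1)) = 0) sequentially"
          unfolding t1 using ev_d[of i] by eventually_elim (rule norm1)
      qed
    qed simp
    show "conv_in_prob M (\<lambda>n \<omega>. tau n (mpow n (W' n i \<omega>) 1)) 0"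
      unfolding cip using limp[of 1] m1 by (simp only: order_refl)
    have m2: "complex_of_real (moment \<mu> 2) = 1"
    proof (rule LIMSEQ_unique[OF lim[of 2]])
      show "(\<lambda>n. integral\<^sup>L (M n) (\<lambda>\<omega>. tau n (mpow n (W n i \<omega>) 2))) \<longlonglongrightarrow> 1"
        by (rule tendsto_eventually) (use ev_d[of i] in eventually_elim, rule norm2)
    qed simp
    show "conv_in_prob M (\<lambda>n \<omega>. tau n (mpow n (W' n i \<omega>) 2)) 1"
      unfolding cip using limp[of 2] m2 by (simp only: one_le_numeral)
    show "(\<lambda>n. tau (n\<^sup>2) (mpow (n\<^sup>2) (mexp (M n) (n\<^sup>2) (\<lambda>\<omega>. kron_conj n (W' n i \<omega>))) p)) \<longlonglongrightarrow> 0" if "1 \<le> p" for p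
    proof -
      have "eventually (\<lambda>n. tau (n\<^sup>2) (mpow (n\<^sup>2) (mexp (M n) (n\<^sup>2) (\<lambda>\<omega>. kron_conj n (W' n i \<omega>))) p)
          = tau (n\<^sup>2) (mpow (n\<^sup>2) (mexp (M n) (n\<^sup>2) (\<lambda>\<omega>. kron_conj n (W n i \<omega>))) p)) sequentially"
        using ev_d[of i] by eventually_elim (simp only: T')
      from tendsto_cong[OF this] show ?thesis using A3[OF that, of i] unfolding kron_conj_def by blast
    qed
  next
    fix k
    show "asym_free_in_prob M (\<lambda>n. n) W' k"
      unfolding asym_free_in_prob_def
    proof (intro allI impI)
      fix "is" ps assume adm: "admissible_word k is ps"
      have "conv_in_prob M (\<lambda>n \<omega>. ttr n (map (\<lambda>(i, p). centered_prob n (W n i \<omega>) p) (zip is ps))) 0"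
        using A2[of k] adm unfolding asym_free_in_prob_def by blast
      moreover have "conv_in_prob M (\<lambda>n \<omega>. ttr n (map (\<lambda>(i, p). centered_prob n (W' n i \<omega>) p) (zip is ps))) 0
          \<longleftrightarrow> conv_in_prob M (\<lambda>n \<omega>. ttr n (map (\<lambda>(i, p). centered_prob n (W n i \<omega>) p) (zip is ps))) 0"
      proof (rule conv_in_prob_cong)
        show "eventually (\<lambda>n. \<forall>\<omega>\<in>space (M n). ttr n (map (\<lambda>(i, p). centered_prob n (W' n i \<omega>) p) (zip is ps))
            = ttr n (map (\<lambda>(i, p). centered_prob n (W n i \<omega>) p) (zip is ps))) sequentially"
          using ev_d[of k]
        proof eventually_elim
          case (elim n)
          show ?case
          proof (intro ballI ttr_map_cong)
            fix \<omega> x assume w: "\<omega> \<in> space (M n)" and x: "x \<in> set (zip is ps)"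
            obtain i p where ip: "x = (i, p)" by (cases x)
            then have "i \<in> set is" using x by (auto dest: set_zip_leftD)
            then have "i < d n" using adm elim unfolding admissible_word_def by auto
            from centered_prob_cong[OF W'[OF this w]]
            show "entries_eq n (case x of (i, p) \<Rightarrow> centered_prob n (W' n i \<omega>) p) (case x of (i, p) \<Rightarrow> centered_prob n (W n i \<omega>) p)"
              unfolding ip prod.case .
          qed
        qed
      qed
      ultimately show "conv_in_prob M (\<lambda>n \<omega>. ttr n (map (\<lambda>(i, p). centered_prob n (W' n i \<omega>) p) (zip is ps))) 0"
        by blast
    qed
  qed
  \<comment> \<open>Independence and equality in law are available for \<open>W\<close>, so the
    moment identities are derived there; \<open>X_eq\<close> carries them over to the tensors built
    from \<open>W'\<close>.\<close>
  have iid: "iid_mats (M n) (W n) n (d n)" for n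
  proof (intro iid_mats.intro iid_mats_axioms.intro)
    show "prob_space (M n)" by (rule prob)
  qed (fact all_moments_entries A4_indep A4_ident)+
  have X_eq: "entries_eq (n\<^sup>2) (X n i \<omega>) (iid_mats.Xc (M n) (W n) n i \<omega>)" if "i < d n" "\<omega> \<in> space (M n)" for n i \<omega>
    using entries_eq_kron_conj[OF W'[OF that]]
    by (simp add: entries_eq_def X_def T_def T'[OF that(1)] iid_mats.Xc_def[OF iid] iid_mats.mean_kron_conj_def[OF iid])
  have mixed_eq: "integral\<^sup>L (M n) (\<lambda>\<omega>. ttr (n\<^sup>2) (map (\<lambda>i. X n i \<omega>) w) * ttr (n\<^sup>2) (map (\<lambda>i. X n i \<omega>) v))
      = iid_mats.mixed (M n) (W n) n w v" if "set (w @ v) \<subseteq> {..<d n}" for n w v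
    unfolding iid_mats.mixed_def[OF iid]
  proof (intro Bochner_Integration.integral_cong refl arg_cong2[where f="(*)"] ttr_map_cong)
    fix \<omega> i assume "\<omega> \<in> space (M n)" "i \<in> set w"
    then show "entries_eq (n\<^sup>2) (X n i \<omega>) (iid_mats.Xc (M n) (W n) n i \<omega>)" using that by (intro X_eq) auto
  next
    fix \<omega> i assume "\<omega> \<in> space (M n)" "i \<in> set v"
    then show "entries_eq (n\<^sup>2) (X n i \<omega>) (iid_mats.Xc (M n) (W n) n i \<omega>)" using that by (intro X_eq) auto
  qed
  interpret tensor_clt_iid M W' d
  proof unfold_locales
    show "filterlim d at_top sequentially" by (rule d_inf)
    fix n w v x
    assume wv: "set (w @ v) \<subseteq> {..<d n}"
    {
      assume "x \<in> set (w @ v)" "count_list (w @ v) x = 1"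
      then show "integral\<^sup>L (M n) (\<lambda>\<omega>. ttr (n\<^sup>2) (map (\<lambda>i. X n i \<omega>) w) * ttr (n\<^sup>2) (map (\<lambda>i. X n i \<omega>) v)) = 0"
        unfolding mixed_eq[OF wv] by (rule iid_mats.mixed_eq_0[OF iid wv])
    }
    fix \<sigma> assume inj: "inj_on \<sigma> (set (w @ v))" and s: "set (map \<sigma> (w @ v)) \<subseteq> {..<d n}"
    have s': "set (map \<sigma> w @ map \<sigma> v) \<subseteq> {..<d n}" using s by simp
    show "integral\<^sup>L (M n) (\<lambda>\<omega>. ttr (n\<^sup>2) (map (\<lambda>i. X n i \<omega>) (map \<sigma> w)) * ttr (n\<^sup>2) (map (\<lambda>i. X n i \<omega>) (map \<sigma> v)))
        = integral\<^sup>L (M n) (\<lambda>\<omega>. ttr (n\<^sup>2) (map (\<lambda>i. X n i \<omega>) w) * ttr (n\<^sup>2) (map (\<lambda>i. X n i \<omega>) v))"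
      unfolding mixed_eq[OF wv] mixed_eq[OF s'] by (rule iid_mats.mixed_map_inj[OF iid inj wv s])
  qed
  \<comment> \<open>The identity holds at every sample point and for every \<open>n\<close>, so both
    modes of convergence transfer directly.\<close>
  have Delta_eq: "tau (n\<^sup>2) (mpow (n\<^sup>2) (Delta (M n) n (d n) (W n) \<omega>) p) = sum_trace p n \<omega>" if w: "\<omega> \<in> space (M n)" for n \<omega> p
    unfolding sum_trace_def
  proof (rule tau_mpow_cong)
    have "Delta (M n) n (d n) (W n) \<omega> r c = centred_sum n \<omega> r c" if rc: "r < n\<^sup>2" "c < n\<^sup>2" for r c
    proof -
      have "X n i \<omega> r c = kron n (W n i \<omega>) (mconj (W n i \<omega>)) r c
            - mexp (M n) (n\<^sup>2) (\<lambda>\<omega>'. kron n (W n i \<omega>') (mconj (W n i \<omega>'))) r c" if "i < d n" for i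
        using X_eq[OF that w] rc
        by (simp add: entries_eq_def iid_mats.Xc_def[OF iid] iid_mats.mean_kron_conj_def[OF iid] kron_conj_def)
      then show ?thesis unfolding Delta_def centred_sum_def inv_sqrt_d_def by simp
    qed
    then show "entries_eq (n\<^sup>2) (Delta (M n) n (d n) (W n) \<omega>) (centred_sum n \<omega>)" unfolding entries_eq_def by blast
  qed
  have P: "conv_in_prob M (\<lambda>n \<omega>. tau (n\<^sup>2) (mpow (n\<^sup>2) (Delta (M n) n (d n) (W n) \<omega>) p)) (of_nat (card (NC2 p)))" for p
  proof -
    have "conv_in_prob M (\<lambda>n \<omega>. tau (n\<^sup>2) (mpow (n\<^sup>2) (Delta (M n) n (d n) (W n) \<omega>) p)) (of_nat (card (NC2 p)))
        \<longleftrightarrow> conv_in_prob M (sum_trace p) (of_nat (card (NC2 p)))"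
      by (rule conv_in_prob_cong) (simp add: Delta_eq)
    then show ?thesis using conv_in_prob_sum_trace by blast
  qed
  have E: "(\<lambda>n. integral\<^sup>L (M n) (\<lambda>\<omega>. tau (n\<^sup>2) (mpow (n\<^sup>2) (Delta (M n) n (d n) (W n) \<omega>) p)))
      \<longlonglongrightarrow> of_nat (card (NC2 p))" for p
  proof -
    have "integral\<^sup>L (M n) (\<lambda>\<omega>. tau (n\<^sup>2) (mpow (n\<^sup>2) (Delta (M n) n (d n) (W n) \<omega>) p)) = integral\<^sup>L (M n) (sum_trace p n)" for n
      by (intro Bochner_Integration.integral_cong refl Delta_eq)
    then show ?thesis using tendsto_expectation_sum_trace[of p] by (simp only:)
  qed
  show ?thesis
    unfolding weak_conv_in_prob_def weak_conv_in_exp_def moment_mu_sc of_real_of_nat_eq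
    using P E by blast
qed

end
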